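(* Let $x_0\ge0$, $b\in\mathbb R$, and let $X$ be the strong solution of $dX_t=(1-bX_t)\,dt+2\sqrt{X_t}\,dW_t$, $X_0=x_0$. Let $\overline X^n_t=(\overline Z^n_t)^2$, $t\in[0,1]$, where $\overline Z^n$ is the projected equidistant Euler scheme with $n$ steps. Then for all $p\in[1,\infty)$, $$\left(\mathrm{E}\left(\sup_{0\le t\le1}\left|X_t-\overline X^n_t\right|^p\right)\right)^{1/p}\preccurlyeq n^{-1/2}\cdot\sqrt{\ln(1+n)}.$$
   Context: $W=(W_t)_{t\ge0}$ is a standard one-dimensional Brownian motion with respect to a filtration satisfying the usual conditions on a complete probability space. The SDE $dX_t=(1-bX_t)\,dt+2\sqrt{X_t}\,dW_t$, $X_0=x_0\ge0$, driven by $W$, has a unique non-negative strong solution $X$. For $n\in\mathbb N=\{1,2,\dots\}$ the projected Euler scheme $\overline Z^n=(\overline Z^n_t)_{0\le t\le1}$ is defined by $\overline Z^n_0=\sqrt{x_0}$, $$\overline Z^n_{(k+1)/n}=\max\left(\overline Z^n_{k/n}-\frac b2\cdot\overline Z^n_{k/n}\cdot\frac1n+\left(W_{(k+1)/n}-W_{k/n}\right),\,0\right),\quad k=0,\dots,n-1,$$ and piecewise constant interpolation $\overline Z^n_t=\overline Z^n_{k/n}$ for $t\in[k/n,(k+1)/n)$, $k=0,\dots,n-1$. For sequences of non-negative reals, $a_n\preccurlyeq b_n$ means there is a constant $c>0$ with $a_n\le c\,b_n$ for all $n\in\mathbb N$ (the constant may depend on $p$, $b$ and $x_0$, but not on $n$).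 *)

theory Defs
  imports "HOL-Probability.Probability"
begin

text \<open>
  Processes are functions \<open>real \<Rightarrow> 'a \<Rightarrow> real\<close>; only their values at times \<open>t \<ge> 0\<close> matter.
  Filtrations are indexed by \<open>real\<close> so that the library locale can be used. A filtration
  on \<open>[0,\<infinity>)\<close> extends to negative times by \<open>F 0\<close>, so this is no restriction.
\<close>

locale usual_filtered_prob_space =
  prob_space M + complete_measure M + filtration "space M" F
  for M :: "'a measure" and F :: "real \<Rightarrow> 'a measure" +
  assumes subalgebra_F: "\<And>t. subalgebra M (F t)"
    and null_sets_F0: "null_sets M \<subseteq> sets (F 0)"
    and right_continuous_F: "\<And>t. t \<ge> 0 \<Longrightarrow> sets (F t) = (\<Inter>s\<in>{t<..}. sets (F s))"

definition adapted :: "(real \<Rightarrow> 'a measure) \<Rightarrow> (real \<Rightarrow> 'a \<Rightarrow> real) \<Rightarrow> bool" where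
  "adapted F X \<longleftrightarrow> (\<forall>t\<ge>0. X t \<in> borel_measurable (F t))"

definition progressively_measurable ::
    "(real \<Rightarrow> 'a measure) \<Rightarrow> (real \<Rightarrow> 'a \<Rightarrow> real) \<Rightarrow> bool" where
  "progressively_measurable F H \<longleftrightarrow>
     (\<forall>T\<ge>0. (\<lambda>(t, \<omega>). H t \<omega>) \<in> borel_measurable (restrict_space borel {0..T} \<Otimes>\<^sub>M F T))"

definition continuous_paths :: "'a measure \<Rightarrow> (real \<Rightarrow> 'a \<Rightarrow> real) \<Rightarrow> bool" where
  "continuous_paths M X \<longleftrightarrow> (AE \<omega> in M. continuous_on {0..} (\<lambda>t. X t \<omega>))"

definition brownian_motion ::
    "'a measure \<Rightarrow> (real \<Rightarrow> 'a measure) \<Rightarrow> (real \<Rightarrow> 'a \<Rightarrow> real) \<Rightarrow> bool" where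
  "brownian_motion M F W \<longleftrightarrow>
     adapted F W \<and> continuous_paths M W \<and> (AE \<omega> in M. W 0 \<omega> = 0) \<and>
     (\<forall>s t. 0 \<le> s \<and> s < t \<longrightarrow>
        distributed M lborel (\<lambda>\<omega>. W t \<omega> - W s \<omega>) (normal_density 0 (sqrt (t - s))) \<and>
        prob_space.indep_set M (sets (F s))
          {(\<lambda>\<omega>. W t \<omega> - W s \<omega>) -` B \<inter> space M |B. B \<in> sets borel})"

text \<open>
  A simple process is a triple \<open>(m, \<tau>, \<xi>)\<close>, standing for
  \<open>\<Sum>i<m. \<xi> i \<cdot> 1\<close> on \<open>(\<tau> i, \<tau> (i + 1)]\<close>.
\<close>

type_synonym 'a simple_proc = "nat \<times> (nat \<Rightarrow> real) \<times> (nat \<Rightarrow> 'a \<Rightarrow> real)"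

definition simple_process ::
    "'a measure \<Rightarrow> (real \<Rightarrow> 'a measure) \<Rightarrow> 'a simple_proc \<Rightarrow> bool" where
  "simple_process M F = (\<lambda>(m, \<tau>, \<xi>).
     0 \<le> \<tau> 0 \<and> (\<forall>i<m. \<tau> i < \<tau> (Suc i) \<and> \<xi> i \<in> borel_measurable (F (\<tau> i)) \<and>
       (\<exists>K. \<forall>\<omega>\<in>space M. \<bar>\<xi> i \<omega>\<bar> \<le> K)))"

definition simple_val :: "'a simple_proc \<Rightarrow> real \<Rightarrow> 'a \<Rightarrow> real" where
  "simple_val = (\<lambda>(m, \<tau>, \<xi>) t \<omega>. \<Sum>i<m. \<xi> i \<omega> * indicator {\<tau> i<..\<tau> (Suc i)} t)"

definition simple_integral_wrt ::
    "(real \<Rightarrow> 'a \<Rightarrow> real) \<Rightarrow> 'a simple_proc \<Rightarrow> real \<Rightarrow> 'a \<Rightarrow> real" where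
  "simple_integral_wrt W = (\<lambda>(m, \<tau>, \<xi>) t \<omega>.
     \<Sum>i<m. \<xi> i \<omega> * (W (min t (\<tau> (Suc i))) \<omega> - W (min t (\<tau> i)) \<omega>))"

text \<open>
  Convergence in probability to 0. Measurability is part of the definition because
  \<^const>\<open>measure\<close> is 0 on non-measurable sets.
\<close>

definition tendsto_0_in_prob :: "'a measure \<Rightarrow> (nat \<Rightarrow> 'a \<Rightarrow> ennreal) \<Rightarrow> bool" where
  "tendsto_0_in_prob M Y \<longleftrightarrow>
     (\<forall>k. Y k \<in> borel_measurable M) \<and>
     (\<forall>\<epsilon>>0. (\<lambda>k. measure M {\<omega> \<in> space M. Y k \<omega> > ennreal \<epsilon>}) \<longlonglongrightarrow> 0)"

text \<open>
  \<open>I\<close> is (a continuous version of) the Ito integral process of \<open>H\<close> with respect to \<open>W\<close>: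
  the limit, uniformly on compacts in probability, of integrals of simple processes
  approximating \<open>H\<close> in \<open>L\<^sup>2([0,T])\<close> in probability. The limit does not
  depend on the approximating sequence, and one exists for every progressively measurable
  \<open>H\<close> with almost surely locally square integrable paths.
\<close>

definition ito_integral ::
    "'a measure \<Rightarrow> (real \<Rightarrow> 'a measure) \<Rightarrow> (real \<Rightarrow> 'a \<Rightarrow> real) \<Rightarrow> (real \<Rightarrow> 'a \<Rightarrow> real)
      \<Rightarrow> (real \<Rightarrow> 'a \<Rightarrow> real) \<Rightarrow> bool" where
  "ito_integral M F W H I \<longleftrightarrow>
     progressively_measurable F H \<and>
     (AE \<omega> in M. \<forall>T\<ge>0. (\<integral>\<^sup>+s\<in>{0..T}. ennreal ((H s \<omega>)\<^sup>2) \<partial>lborel) < \<infinity>) \<and>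
     adapted F I \<and> continuous_paths M I \<and>
     (\<exists>S. (\<forall>k. simple_process M F (S k)) \<and>
       (\<forall>T>0.
         tendsto_0_in_prob M
           (\<lambda>k \<omega>. \<integral>\<^sup>+s\<in>{0..T}. ennreal ((simple_val (S k) s \<omega> - H s \<omega>)\<^sup>2) \<partial>lborel) \<and>
         tendsto_0_in_prob M
           (\<lambda>k \<omega>. SUP t\<in>{0..T}. ennreal \<bar>simple_integral_wrt W (S k) t \<omega> - I t \<omega>\<bar>)))"

text \<open>
  \<open>X\<close> solves \<open>dX = \<mu>(X) dt + \<sigma>(X) dW\<close>, \<open>X\<^sub>0 = x0\<close>, for the given \<open>W\<close>
  on the given filtered space. Taking for \<open>F\<close> the augmented filtration of \<open>W\<close> gives
  strong solutions in the narrowest sense.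
\<close>

definition strong_solution ::
    "'a measure \<Rightarrow> (real \<Rightarrow> 'a measure) \<Rightarrow> (real \<Rightarrow> 'a \<Rightarrow> real) \<Rightarrow> (real \<Rightarrow> real) \<Rightarrow> (real \<Rightarrow> real)
      \<Rightarrow> real \<Rightarrow> (real \<Rightarrow> 'a \<Rightarrow> real) \<Rightarrow> bool" where
  "strong_solution M F W \<mu> \<sigma> x0 X \<longleftrightarrow>
     adapted F X \<and> continuous_paths M X \<and> (AE \<omega> in M. X 0 \<omega> = x0) \<and>
     (AE \<omega> in M. \<forall>t\<ge>0. set_integrable lborel {0..t} (\<lambda>s. \<mu> (X s \<omega>))) \<and>
     (\<exists>I. ito_integral M F W (\<lambda>t \<omega>. \<sigma> (X t \<omega>)) I \<and>
       (AE \<omega> in M. \<forall>t\<ge>0. X t \<omega> = x0 + (LBINT s:{0..t}. \<mu> (X s \<omega>)) + I t \<omega>))"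

text \<open>Here \<open>sqrt\<close> is only relevant on the non-negative half-line, where \<open>X\<close> lives.\<close>

definition cir_solution ::
    "'a measure \<Rightarrow> (real \<Rightarrow> 'a measure) \<Rightarrow> (real \<Rightarrow> 'a \<Rightarrow> real) \<Rightarrow> real \<Rightarrow> real
      \<Rightarrow> (real \<Rightarrow> 'a \<Rightarrow> real) \<Rightarrow> bool" where
  "cir_solution M F W b x0 X \<longleftrightarrow>
     strong_solution M F W (\<lambda>x. 1 - b * x) (\<lambda>x. 2 * sqrt x) x0 X \<and>
     (AE \<omega> in M. \<forall>t\<ge>0. X t \<omega> \<ge> 0)"

primrec proj_euler_grid ::
    "real \<Rightarrow> real \<Rightarrow> (real \<Rightarrow> 'a \<Rightarrow> real) \<Rightarrow> nat \<Rightarrow> nat \<Rightarrow> 'a \<Rightarrow> real" where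
  "proj_euler_grid b x0 W n 0 \<omega> = sqrt x0"
| "proj_euler_grid b x0 W n (Suc k) \<omega> =
     max (proj_euler_grid b x0 W n k \<omega> - b / 2 * proj_euler_grid b x0 W n k \<omega> * (1 / real n)
          + (W (real (Suc k) / real n) \<omega> - W (real k / real n) \<omega>)) 0"

definition proj_euler ::
    "real \<Rightarrow> real \<Rightarrow> (real \<Rightarrow> 'a \<Rightarrow> real) \<Rightarrow> nat \<Rightarrow> real \<Rightarrow> 'a \<Rightarrow> real" where
  "proj_euler b x0 W n t \<omega> = proj_euler_grid b x0 W n (nat \<lfloor>real n * t\<rfloor>) \<omega>"

text \<open>
  Taken in \<open>ennreal\<close>, so that the supremum is meaningful also on the null set of paths
  that may be unbounded. The supremum is measurable for the processes considered here, since
  \<open>M\<close> is complete and almost all paths are right-continuous.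
\<close>

definition sup_moment ::
    "'a measure \<Rightarrow> real \<Rightarrow> (real \<Rightarrow> 'a \<Rightarrow> real) \<Rightarrow> (real \<Rightarrow> 'a \<Rightarrow> real) \<Rightarrow> ennreal" where
  "sup_moment M p X Y =
     (\<integral>\<^sup>+\<omega>. (SUP t\<in>{0..1}. ennreal (\<bar>X t \<omega> - Y t \<omega>\<bar> powr p)) \<partial>M)"

end

theory Submission
  imports Defs
begin

text \<open>
  The square root \<open>Z\<close> of \<open>X\<close> is a reflected Ornstein-Uhlenbeck process driven by the same \<open>W\<close>:
  it dominates the unreflected increments and follows them as long as it is positive. The Euler
  scheme is the discrete version of this reflection, and a zero of \<open>Z\<close> inside a grid cell
  forgets the past error, so \<open>\<bar>Z - Z\<^sub>n\<bar>\<close> is bounded pathwise by the oscillation of \<open>W\<close> on grid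
  cells, which dyadic chaining controls.

  That \<open>Z\<close> is reflected follows from the Ito formula for \<open>sqrt (X + \<epsilon>)\<close>: its drift contains the
  non-negative term \<open>\<epsilon> / (2 * sqrt (X + \<epsilon>) ^ 3)\<close>, which becomes the reflection as \<open>\<epsilon> \<rightarrow> 0\<close>, and its
  martingale part converges to \<open>W\<close> because \<open>X\<close> spends no time at \<open>0\<close>. The Ito formula is proved
  along time grids; stochastic sums are controlled, without stopping times, by the Lenglart-type
  bound \<open>E (min 1 (M\<^sup>2)) \<le> 2 * E (min 1 \<langle>M\<rangle>)\<close>.
\<close>

section \<open>Reflected paths and the projected Euler scheme\<close>

text \<open>The coefficient \<open>2 * sqrt X\<close> is only Hoelder continuous of order 1/2 at
  \<open>0\<close>, so a Gronwall comparison of \<open>X\<close> with its approximation breaks down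
  there. For \<open>Z\<close> the noise is additive and cancels in the difference of path and
  scheme, which makes the error analysis deterministic. With
  \<open>q = sqrt (X + \<epsilon>)\<close>, the drift of \<open>q\<close> would contain the singular
  term \<open>1 / (2 * q)\<close>, but the constant drift \<open>1\<close> and the Ito correction of
  \<open>2 * sqrt X\<close> contribute it with opposite signs; only the \<epsilon>-term is left. The
  reflection term is never constructed from local times: its monotonicity and its constancy while
  \<open>X\<close> is positive suffice. There is an apparent circle: the estimate for the martingale
  part is useful only once \<open>X\<close> is known to spend no time at \<open>0\<close>. A scaled
  version of the same estimate breaks it. The logarithm in the rate is that of the modulus of
  continuity of \<open>W\<close> at scale \<open>1 / n\<close>. Apart from this rate, randomness
  enters the error only through logarithms of two functionals of \<open>W\<close> whose expectations
  do not depend on \<open>n\<close>; hence one argument covers every \<open>p\<close>, and the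
  constant is the same for all probability spaces.\<close>

lemma gronwall_continuous:
  fixes z :: "real \<Rightarrow> real"
  assumes cont: "continuous_on {0..1} z" and \<beta>: "0 \<le> \<beta>"
    and le: "\<And>r. r \<in> {0..1} \<Longrightarrow> z r \<le> K + \<beta> * integral {0..r} z"
    and r: "r \<in> {0..1}" and K: "0 \<le> K"
  shows "z r \<le> K * exp \<beta>"
proof -
  define J where "J r = integral {0..r} z" for r
  \<comment> \<open>Integrating factor: the hypothesis says exactly that the derivative of
    \<open>G\<close> is nonpositive, so \<open>G r \<le> G 0 = K\<close>.\<close>
  define G where "G r = exp (- \<beta> * r) * (K + \<beta> * J r)" for r
  have dJ: "(J has_real_derivative z x) (at x within {0..1})" if "x \<in> {0..1}" for x
    unfolding J_def using integral_has_real_derivative[OF cont that] .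
  have dG: "(G has_real_derivative exp (- \<beta> * x) * \<beta> * (z x - (K + \<beta> * J x))) (at x within {0..1})"
    if "x \<in> {0..1}" for x
    unfolding G_def by (rule derivative_eq_intros dJ[OF that] refl | simp add: algebra_simps)+
  have contG: "continuous_on {0..r} G"
    by (rule continuous_on_subset[of "{0..1}"], rule DERIV_continuous_on, rule dG) (use r in auto)
  have "G r \<le> G 0"
  proof (rule DERIV_nonpos_imp_decreasing_open[OF _ _ contG])
    fix x assume x: "0 < x" "x < r"
    then have x01: "x \<in> {0..1}" using r by auto
    have "at x within {0..1} = at x" using x r by (intro at_within_interior) auto
    then have "(G has_real_derivative exp (- \<beta> * x) * \<beta> * (z x - (K + \<beta> * J x))) (at x)"
      using dG[OF x01] by simp
    moreover have "exp (- \<beta> * x) * \<beta> * (z x - (K + \<beta> * J x)) \<le> 0"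
      using le[OF x01] \<beta> by (intro mult_nonneg_nonpos) (auto simp: J_def)
    ultimately show "\<exists>y. (G has_real_derivative y) (at x) \<and> y \<le> 0" by blast
  qed (use r in auto)
  then have "exp (- \<beta> * r) * (K + \<beta> * J r) \<le> K" by (simp add: G_def J_def)
  then have "exp (\<beta> * r) * (exp (- \<beta> * r) * (K + \<beta> * J r)) \<le> exp (\<beta> * r) * K"
    by (intro mult_left_mono) auto
  moreover have "exp (\<beta> * r) * exp (- \<beta> * r) = 1"
    unfolding exp_add[symmetric] by simp
  then have "exp (\<beta> * r) * (exp (- \<beta> * r) * (K + \<beta> * J r)) = K + \<beta> * J r"
    by (simp only: mult.assoc[symmetric] mult_1_left)
  moreover have "exp (\<beta> * r) * K \<le> exp \<beta> * K"
    using \<beta> r K by (intro mult_right_mono) (auto simp: mult_left_le)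
  ultimately have "K + \<beta> * J r \<le> exp \<beta> * K" by linarith
  then show ?thesis using le[OF r] by (simp add: J_def mult.commute)
qed

text \<open>
  \<open>z\<close> solves the Skorokhod reflection problem for \<open>w\<close> with drift \<open>-b/2 * z\<close>, in the form
  that avoids the reflection term: it dominates the unreflected increments, and follows them
  exactly as long as it stays positive.
\<close>

locale reflected_path =
  fixes z w :: "real \<Rightarrow> real" and b z0 :: real
  assumes cont_z: "continuous_on {0..1} z" and cont_w: "continuous_on {0..1} w"
    and z_nonneg: "\<And>r. r \<in> {0..1} \<Longrightarrow> 0 \<le> z r" and z_0: "z 0 = z0" and w_0: "w 0 = 0"
    and reflect_ge: "\<And>s r. 0 \<le> s \<Longrightarrow> s \<le> r \<Longrightarrow> r \<le> 1 \<Longrightarrow>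
        z s - b / 2 * integral {s..r} z + (w r - w s) \<le> z r"
    and reflect_eq: "\<And>s r. 0 \<le> s \<Longrightarrow> s \<le> r \<Longrightarrow> r \<le> 1 \<Longrightarrow> (\<And>q. q \<in> {s..r} \<Longrightarrow> 0 < z q) \<Longrightarrow>
        z r = z s - b / 2 * integral {s..r} z + (w r - w s)"
begin

lemma z_integrable: "0 \<le> s \<Longrightarrow> r \<le> 1 \<Longrightarrow> z integrable_on {s..r}"
  using cont_z by (intro integrable_continuous_interval) (auto intro: continuous_on_subset)

text \<open>After its last zero \<open>q\<close> the path is positive, so \<open>reflect_eq\<close>
  holds on \<open>{x..r}\<close> for every \<open>x\<close> in \<open>{q<..r}\<close>; letting
  \<open>x\<close> decrease to \<open>q\<close> gives the equation from \<open>q\<close> itself. The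
  value of \<open>z r\<close> thus forgets everything before \<open>q\<close>.\<close>

lemma last_zero:
  assumes s: "0 \<le> s" "s \<le> r" "r \<le> 1" and zero: "\<exists>q\<in>{s..r}. z q = 0"
  obtains q where "q \<in> {s..r}" "z q = 0" "z r = - b / 2 * integral {q..r} z + (w r - w q)"
proof -
  define Z where "Z = {q \<in> {s..r}. z q = 0}"
  have "continuous_on {s..r} z" using cont_z s by (auto intro: continuous_on_subset)
  then have "closed Z" unfolding Z_def using continuous_closed_preimage_constant[of "{s..r}" z 0] by simp
  moreover have "bounded Z" unfolding Z_def by (rule bounded_subset[of "{s..r}"]) auto
  moreover have "Z \<noteq> {}" using zero by (auto simp: Z_def)
  ultimately have q: "Sup Z \<in> Z"
    by (intro closed_contains_Sup bounded_imp_bdd_above)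
  define q where "q = Sup Z"
  have qZ: "q \<in> {s..r}" "z q = 0" using q by (auto simp: q_def Z_def)
  have pos: "0 < z x" if "q < x" "x \<le> r" for x
  proof -
    have "x \<notin> Z" using that cSup_upper[of x Z] bounded_imp_bdd_above[OF \<open>bounded Z\<close>] by (auto simp: q_def)
    then have "z x \<noteq> 0" using that qZ by (auto simp: Z_def)
    then show ?thesis using z_nonneg[of x] that qZ s by auto
  qed
  have eq: "z r = z x - b / 2 * integral {x..r} z + (w r - w x)" if "q < x" "x \<le> r" for x
    using that qZ s pos by (intro reflect_eq) auto
  have "z r = - b / 2 * integral {q..r} z + (w r - w q)"
  proof (cases "q = r")
    case True
    then show ?thesis using qZ by simp
  next
    case False
    then have qr: "q < r" using qZ by simp
    \<comment> \<open>\<open>f\<close> is continuous and equals \<open>z r\<close> on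
      \<open>{q<..r}\<close>, hence also at \<open>q\<close>, where positivity fails and
      \<open>reflect_eq\<close> does not apply.\<close>
    define f where "f x = z x - b / 2 * integral {x..r} z + (w r - w x)" for x
    have "continuous_on {q..r} f"
    proof -
      have "z integrable_on {q..r}" using z_integrable[of q r] qZ s by auto
      then have "continuous_on {q..r} (\<lambda>x. integral {x..r} z)" by (rule indefinite_integral_continuous_1')
      moreover have "continuous_on {q..r} z" "continuous_on {q..r} w"
        using cont_z cont_w qZ s by (auto intro: continuous_on_subset)
      ultimately show ?thesis unfolding f_def by (intro continuous_intros)
    qed
    then have "(f \<longlongrightarrow> f q) (at q within {q..r})" using qr by (auto simp: continuous_on_def)
    then have lim: "(f \<longlongrightarrow> f q) (at_right q)"
      using qr by (simp add: at_within_Icc_at_right)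
    have "f x = z r" if "q < x" "x \<le> r" for x using eq[OF that] by (simp add: f_def)
    then have "\<forall>\<^sub>F x in at_right q. f x = z r"
      unfolding eventually_at_right_field using qr by (intro exI[of _ r]) auto
    then have "(f \<longlongrightarrow> z r) (at_right q)" by (rule tendsto_eventually)
    then have "f q = z r" using lim tendsto_unique[OF trivial_limit_at_right_real] by blast
    then show ?thesis using qZ by (simp add: f_def)
  qed
  then show ?thesis using that qZ by blast
qed

text \<open>Either \<open>z r\<close> is the increment of \<open>w\<close> since the last zero plus
  drift, or the path is unreflected from time \<open>0\<close> on. In both cases the drift costs at
  most \<open>\<bar>b\<bar> / 2\<close> times the integral over \<open>{0..r}\<close>, and Gronwall
  applies. The factor 2 bounds an increment of \<open>w\<close> by two of its values.\<close>

lemma z_bound: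
  assumes \<omega>1: "\<And>r. r \<in> {0..1} \<Longrightarrow> \<bar>w r\<bar> \<le> \<omega>1" and r: "r \<in> {0..1}"
  shows "z r \<le> (z0 + 2 * \<omega>1) * exp (\<bar>b\<bar> / 2)"
proof (rule gronwall_continuous[OF cont_z _ _ r])
  have z0: "0 \<le> z0" using z_nonneg[of 0] z_0 by simp
  have w0: "0 \<le> \<omega>1" using \<omega>1[of 0] by simp
  then show "0 \<le> z0 + 2 * \<omega>1" using z0 by simp
  fix r :: real assume r: "r \<in> {0..1}"
  have int: "- b / 2 * integral {q..r} z \<le> \<bar>b\<bar> / 2 * integral {0..r} z" if "q \<in> {0..r}" for q
  proof -
    have i0: "0 \<le> integral {q..r} z" using that r z_nonneg by (intro integral_nonneg z_integrable) auto
    have "integral {q..r} z \<le> integral {0..r} z"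
      using that r z_nonneg by (intro integral_subset_le z_integrable) auto
    then have "\<bar>b\<bar> / 2 * integral {q..r} z \<le> \<bar>b\<bar> / 2 * integral {0..r} z" by (intro mult_left_mono) auto
    moreover have "- b / 2 * integral {q..r} z \<le> \<bar>b\<bar> / 2 * integral {q..r} z"
      using i0 by (intro mult_right_mono) auto
    ultimately show ?thesis by simp
  qed
  show "z r \<le> z0 + 2 * \<omega>1 + \<bar>b\<bar> / 2 * integral {0..r} z"
  proof (cases "\<exists>q\<in>{0..r}. z q = 0")
    case True
    obtain q where q: "q \<in> {0..r}" "z r = - b / 2 * integral {q..r} z + (w r - w q)"
      using last_zero[of 0 r] True r by (metis atLeastAtMost_iff order_refl)
    then show ?thesis using int[OF q(1)] \<omega>1[of r] \<omega>1[of q] r z0 by auto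
  next
    case False
    then have "z r = z 0 - b / 2 * integral {0..r} z + (w r - w 0)"
      using r z_nonneg by (intro reflect_eq) (auto simp: less_le)
    then show ?thesis using int[of 0] \<omega>1[of r] r z_0 w_0 w0 by auto
  qed
qed simp

text \<open>Downwards \<open>reflect_ge\<close> bounds the move. Upwards the reflection acts only if
  there is a zero, and then \<open>last_zero\<close> bounds \<open>z r\<close> with no reference to
  \<open>z s\<close>. This second bound is what lets the scheme error be reset at a zero.\<close>

lemma z_increment:
  assumes Zm: "\<And>r. r \<in> {0..1} \<Longrightarrow> z r \<le> Zm"
    and s: "0 \<le> s" "s \<le> r" "r \<le> 1" and h: "r - s \<le> h"
    and osc: "\<And>q q'. q \<in> {s..r} \<Longrightarrow> q' \<in> {s..r} \<Longrightarrow> \<bar>w q' - w q\<bar> \<le> \<omega>"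
  shows "\<bar>z r - z s\<bar> \<le> \<bar>b\<bar> / 2 * Zm * h + \<omega>"
    and "(\<exists>q\<in>{s..r}. z q = 0) \<Longrightarrow> z r \<le> \<bar>b\<bar> / 2 * Zm * h + \<omega>"
proof -
  have Zm0: "0 \<le> Zm" using Zm[of 0] z_nonneg[of 0] by simp
  have int: "\<bar>b / 2 * integral {q..r} z\<bar> \<le> \<bar>b\<bar> / 2 * Zm * h" if "q \<in> {s..r}" for q
  proof -
    have i0: "0 \<le> integral {q..r} z" using that s z_nonneg by (intro integral_nonneg z_integrable) auto
    have "integral {q..r} z \<le> integral {q..r} (\<lambda>_. Zm)"
      using that s Zm by (intro integral_le z_integrable) auto
    also have "\<dots> = Zm * (r - q)" using that by simp
    also have "\<dots> \<le> Zm * h" using that h Zm0 by (intro mult_left_mono) auto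
    finally have "\<bar>b\<bar> / 2 * integral {q..r} z \<le> \<bar>b\<bar> / 2 * (Zm * h)" by (intro mult_left_mono) auto
    then show ?thesis using i0 by (simp add: abs_mult mult.assoc)
  qed
  show up: "z r \<le> \<bar>b\<bar> / 2 * Zm * h + \<omega>" if zero: "\<exists>q\<in>{s..r}. z q = 0"
  proof -
    obtain q where q: "q \<in> {s..r}" "z r = - b / 2 * integral {q..r} z + (w r - w q)"
      using last_zero[OF s zero] by metis
    then show ?thesis using int[OF q(1)] osc[of q r] s by auto
  qed
  show "\<bar>z r - z s\<bar> \<le> \<bar>b\<bar> / 2 * Zm * h + \<omega>"
  proof (cases "\<exists>q\<in>{s..r}. z q = 0")
    case True
    have "z r - z s \<le> \<bar>b\<bar> / 2 * Zm * h + \<omega>" using up[OF True] z_nonneg[of s] s by auto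
    moreover have "z s - b / 2 * integral {s..r} z + (w r - w s) \<le> z r" using reflect_ge s by blast
    ultimately show ?thesis using int[of s] osc[of s r] s by auto
  next
    case False
    then have "z r = z s - b / 2 * integral {s..r} z + (w r - w s)"
      using s z_nonneg by (intro reflect_eq) (auto simp: less_le)
    then show ?thesis using int[of s] osc[of s r] s by auto
  qed
qed

text \<open>\<open>B\<close> bounds the variation of \<open>z\<close> inside a cell. If
  \<open>z\<close> stays positive in a cell, the error is multiplied by
  \<open>1 + \<beta> * h\<close> and gains \<open>\<beta> * B * h\<close>. If \<open>z\<close> has a
  zero there, it ends the cell below \<open>B\<close>, while the scheme is non-negative, so
  \<open>z - y\<close> is at most \<open>B\<close> whatever it was before. For \<open>y - z\<close>
  no case distinction is needed: \<open>reflect_ge\<close> compares with the unreflected Euler step,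
  and \<open>z\<close> is non-negative where the scheme is cut to \<open>0\<close>.\<close>

lemma scheme_error:
  fixes n :: nat and y :: "nat \<Rightarrow> real"
  assumes n: "1 \<le> n" and Zm: "\<And>r. r \<in> {0..1} \<Longrightarrow> z r \<le> Zm"
    and y0: "y 0 = z0"
    and y: "\<And>k. k < n \<Longrightarrow> y (Suc k) = max (y k - b / 2 * y k * (1 / real n) +
        (w (real (Suc k) / real n) - w (real k / real n))) 0"
    and osc: "\<And>k q. k < n \<Longrightarrow> q \<in> {real k / real n..real (Suc k) / real n} \<Longrightarrow> \<bar>w q - w (real k / real n)\<bar> \<le> \<omega>"
    and B: "B = \<bar>b\<bar> / 2 * Zm / real n + 2 * \<omega>" and k: "k \<le> n"
  shows "\<bar>z (real k / real n) - y k\<bar> \<le> B * ((1 + \<bar>b\<bar> / 2) * exp (\<bar>b\<bar> / 2))"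
    and "k < n \<Longrightarrow> r \<in> {real k / real n..real (Suc k) / real n} \<Longrightarrow> \<bar>z r - z (real k / real n)\<bar> \<le> B"
proof -
  define \<beta> where "\<beta> = \<bar>b\<bar> / 2"
  define h where "h = 1 / real n"
  have h: "0 < h" "\<beta> \<ge> 0" using n by (auto simp: h_def \<beta>_def)
  \<comment> \<open>Oscillations are measured from the left end of the cell; two arbitrary points
    cost twice as much, whence \<open>2 * \<omega>\<close> in \<open>B\<close>.\<close>
  have osc2: "\<bar>w q' - w q\<bar> \<le> 2 * \<omega>"
    if "k < n" "q \<in> {real k / real n..real (Suc k) / real n}" "q' \<in> {real k / real n..real (Suc k) / real n}" for k q q'
    using osc[OF that(1,2)] osc[OF that(1,3)] by linarith
  have Zm0: "0 \<le> Zm" using Zm[of 0] z_nonneg[of 0] by simp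
  have \<omega>0: "0 \<le> \<omega>" using osc[of 0 0] n by simp
  have B': "B = \<bar>b\<bar> / 2 * Zm * h + 2 * \<omega>" by (simp add: B h_def)
  have B0: "0 \<le> B" using Zm0 \<omega>0 h by (simp add: B')
  have grid: "0 \<le> real k / real n" "real k / real n \<le> real (Suc k) / real n" "real (Suc k) / real n \<le> 1"
    "real (Suc k) / real n - real k / real n = h" if "k < n" for k
    using that n by (auto simp: h_def field_simps)
  have inc: "\<bar>z r - z (real k / real n)\<bar> \<le> B" if "k < n" "r \<in> {real k / real n..real (Suc k) / real n}" for k r
  proof -
    have "0 \<le> real k / real n" "real k / real n \<le> r" "r \<le> 1" "r - real k / real n \<le> h"
      using that(2) grid[OF that(1)] by (simp_all only: atLeastAtMost_iff) linarith+
    moreover have "\<bar>w q' - w q\<bar> \<le> 2 * \<omega>" if "q \<in> {real k / real n..r}" "q' \<in> {real k / real n..r}" for q q'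
      using that \<open>r \<in> _\<close> by (intro osc2[OF \<open>k < n\<close>]) (auto simp del: of_nat_Suc)
    ultimately show ?thesis unfolding B' by (intro z_increment(1)[OF Zm]; blast)
  qed
  then show "k < n \<Longrightarrow> r \<in> {real k / real n..real (Suc k) / real n} \<Longrightarrow> \<bar>z r - z (real k / real n)\<bar> \<le> B" .
  have step: "\<bar>z (real (Suc k) / real n) - y (Suc k)\<bar> \<le> max (\<bar>z (real k / real n) - y k\<bar> * (1 + \<beta> * h) + \<beta> * B * h) B"
    if k: "k < n" for k
  proof -
    let ?s = "real k / real n" and ?r = "real (Suc k) / real n"
    define e where "e = z ?s - y k"
    define I where "I = integral {?s..?r} z"
    define dw where "dw = w ?r - w ?s"
    have I: "\<bar>I - z ?s * h\<bar> \<le> B * h"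
    proof -
      have "I - z ?s * h = integral {?s..?r} (\<lambda>x. z x - z ?s)"
        unfolding I_def using z_integrable[of ?s ?r] grid[OF k]
        by (subst Henstock_Kurzweil_Integration.integral_diff) (auto simp: mult.commute)
      moreover have "continuous_on {?s..?r} z"
        using grid[OF k] by (intro continuous_on_subset[OF cont_z]) (auto simp del: of_nat_Suc)
      then have "norm (integral {?s..?r} (\<lambda>x. z x - z ?s)) \<le> B * (?r - ?s)"
        using grid(2)[OF k] inc[OF k] B0 by (intro integral_bound continuous_intros) auto
      ultimately show ?thesis using grid(4)[OF k] by simp
    qed
    have "b / 2 * I - b / 2 * y k * h = b / 2 * (I - z ?s * h) + b / 2 * e * h"
      by (simp add: e_def algebra_simps)
    moreover have "\<bar>b / 2 * (I - z ?s * h)\<bar> \<le> \<beta> * (B * h)"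
      unfolding \<beta>_def abs_mult using I by (intro mult_mono) auto
    moreover have "\<bar>b / 2 * e * h\<bar> = \<beta> * \<bar>e\<bar> * h"
      using h by (simp add: abs_mult \<beta>_def)
    ultimately have drift: "\<bar>b / 2 * I - b / 2 * y k * h\<bar> \<le> \<beta> * B * h + \<beta> * \<bar>e\<bar> * h"
      by (simp add: mult.assoc)
    have ge: "z ?s - b / 2 * I + dw \<le> z ?r"
      using reflect_ge[of ?s ?r] grid[OF k] by (simp add: I_def dw_def)
    have yS: "y (Suc k) = max (y k - b / 2 * y k * h + dw) 0" using y[OF k] by (simp add: h_def dw_def)
    have zr: "0 \<le> z ?r" using z_nonneg[of ?r] grid[OF k] by auto
    have ub: "\<bar>e\<bar> * (1 + \<beta> * h) + \<beta> * B * h = \<bar>e\<bar> + (\<beta> * B * h + \<beta> * \<bar>e\<bar> * h)"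
      by (simp add: algebra_simps)
    have nn: "0 \<le> \<beta> * B * h + \<beta> * \<bar>e\<bar> * h" using h B0 by auto
    have "y (Suc k) - z ?r \<le> \<bar>e\<bar> * (1 + \<beta> * h) + \<beta> * B * h"
      unfolding ub yS using ge drift zr nn by (auto simp: max_def e_def)
    moreover have "z ?r - y (Suc k) \<le> max (\<bar>e\<bar> * (1 + \<beta> * h) + \<beta> * B * h) B"
    proof (cases "\<exists>q\<in>{?s..?r}. z q = 0")
      case True
      have "z ?r \<le> B" unfolding B'
        using True grid[OF k] osc2[OF k] by (intro z_increment(2)[OF Zm]) auto
      then show ?thesis using yS by auto
    next
      case False
      have pos: "0 < z q" if q: "q \<in> {?s..?r}" for q
      proof -
        have "q \<in> {0..1}"
          using q grid(1,3)[OF k] unfolding atLeastAtMost_iff by linarith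
        moreover have "z q \<noteq> 0" using False q by blast
        ultimately show ?thesis using z_nonneg[of q] by linarith
      qed
      have "z ?r = z ?s - b / 2 * I + dw"
        unfolding I_def dw_def by (rule reflect_eq[OF grid(1-3)[OF k] pos])
      moreover have "y k - b / 2 * y k * h + dw \<le> y (Suc k)" unfolding yS by simp
      ultimately have "z ?r - y (Suc k) \<le> e - (b / 2 * I - b / 2 * y k * h)"
        unfolding e_def by linarith
      then have "z ?r - y (Suc k) \<le> \<bar>e\<bar> * (1 + \<beta> * h) + \<beta> * B * h"
        unfolding ub using drift by linarith
      then show ?thesis by simp
    qed
    ultimately show ?thesis unfolding e_def by linarith
  qed
  \<comment> \<open>This majorant dominates both branches of the maximum in \<open>step\<close>: it
    is never below \<open>B\<close>, and its factor \<open>1 + \<beta> * (real k * h)\<close>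
    absorbs the additive term \<open>\<beta> * B * h\<close> of each step.\<close>
  have main: "\<bar>z (real k / real n) - y k\<bar> \<le> B * (1 + \<beta> * (real k * h)) * (1 + \<beta> * h) ^ k" if "k \<le> n" for k
    using that
  proof (induction k)
    case 0
    then show ?case using y0 z_0 B0 by simp
  next
    case (Suc k)
    let ?E = "\<lambda>k. B * (1 + \<beta> * (real k * h)) * (1 + \<beta> * h) ^ k"
    have p1: "1 \<le> (1 + \<beta> * h) ^ k" for k using h by (intro one_le_power) auto
    have 1: "?E (Suc k) = ?E k * (1 + \<beta> * h) + \<beta> * B * h * (1 + \<beta> * h) ^ Suc k"
      by (simp add: algebra_simps)
    have 2: "\<beta> * B * h * 1 \<le> \<beta> * B * h * (1 + \<beta> * h) ^ Suc k"
      using p1[of "Suc k"] B0 h by (intro mult_left_mono) auto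
    have 3: "\<bar>z (real k / real n) - y k\<bar> * (1 + \<beta> * h) \<le> ?E k * (1 + \<beta> * h)"
      using Suc h by (intro mult_right_mono) auto
    have "B * 1 * 1 \<le> ?E (Suc k)"
      using p1[of "Suc k"] B0 h by (intro mult_mono) auto
    then have "B \<le> ?E (Suc k)" by (simp only: mult_1_right)
    moreover have "\<bar>z (real k / real n) - y k\<bar> * (1 + \<beta> * h) + \<beta> * B * h \<le> ?E (Suc k)"
      unfolding 1 using 2 3 by linarith
    ultimately have "max (\<bar>z (real k / real n) - y k\<bar> * (1 + \<beta> * h) + \<beta> * B * h) B \<le> ?E (Suc k)"
      by (rule max.boundedI[rotated])
    then show ?case using step[of k] Suc.prems by linarith
  qed
  have "real k * h \<le> 1" using k n by (simp add: h_def)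
  then have 1: "1 + \<beta> * (real k * h) \<le> 1 + \<beta>" using h mult_left_mono[of "real k * h" 1 \<beta>] by simp
  have "(1 + \<beta> * h) ^ k \<le> exp (\<beta> * h) ^ k" using h by (intro power_mono exp_ge_add_one_self) auto
  also have "\<dots> = exp (\<beta> * (real k * h))" by (simp add: exp_of_nat_mult[symmetric] mult_ac)
  also have "\<dots> \<le> exp \<beta>" using 1 by simp
  finally have "B * (1 + \<beta> * (real k * h)) * (1 + \<beta> * h) ^ k \<le> B * (1 + \<beta>) * exp \<beta>"
    using B0 h 1 by (intro mult_mono) auto
  then show "\<bar>z (real k / real n) - y k\<bar> \<le> B * ((1 + \<bar>b\<bar> / 2) * exp (\<bar>b\<bar> / 2))"
    using main[OF k] unfolding \<beta>_def by (simp add: mult.assoc)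
qed

end

section \<open>Modulus of continuity by dyadic chaining\<close>

text \<open>\<open>x j\<close> is \<open>r\<close> rounded down to the grid with
  \<open>n * 2 ^ j\<close> cells. From \<open>x j\<close> to \<open>x (Suc j)\<close> the point
  stays or moves by one cell of the finer grid, so \<open>w r\<close> is reached from
  \<open>w (k / n)\<close> with at most one increment per level, and by continuity in the
  limit.\<close>

lemma dyadic_chaining:
  fixes w :: "real \<Rightarrow> real" and a :: "nat \<Rightarrow> real" and n :: nat
  assumes cont: "continuous_on {0..1} w" and n: "1 \<le> n" and K: "0 \<le> K"
    and a: "summable a" "\<And>j. 0 \<le> a j"
    and inc: "\<And>j i. i < n * 2 ^ j \<Longrightarrow>
        \<bar>w (real (Suc i) / real (n * 2 ^ j)) - w (real i / real (n * 2 ^ j))\<bar> \<le> K * a j"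
    and k: "k < n" and r: "r \<in> {real k / real n..real (Suc k) / real n}"
  shows "\<bar>w r - w (real k / real n)\<bar> \<le> K * suminf a"
\<comment> \<open>Rounding down the right end of the cell would give
  \<open>real (Suc k) / real n\<close> instead of \<open>real k / real n\<close>; that point is
  reached by a single increment of level \<open>0\<close>.\<close>
proof (cases "r = real (Suc k) / real n")
  case True
  have "\<bar>w r - w (real k / real n)\<bar> \<le> K * a 0" using inc[of k 0] k True by simp
  also have "\<dots> \<le> K * suminf a"
    using sum_le_suminf[OF a(1), of "{0}"] a(2) K by (intro mult_left_mono) auto
  finally show ?thesis .
next
  case False
  then have rk: "real k / real n \<le> r" "r < real (Suc k) / real n" using r by auto
  have n0: "0 < real n" using n by simp
  have kr: "real k \<le> r * real n" "r * real n < real (Suc k)"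
    using rk n0 by (auto simp only: pos_divide_le_eq pos_less_divide_eq)
  have r0: "0 \<le> r" using rk n0 by (meson divide_nonneg_pos of_nat_0_le_iff order.trans)
  have "real (Suc k) / real n \<le> 1" using k n0 by simp
  then have r1: "r < 1" using rk by linarith
  define N where "N j = n * 2 ^ j" for j
  have N: "0 < N j" for j using n by (simp add: N_def)
  define i where "i j = nat \<lfloor>r * real (N j)\<rfloor>" for j
  have fl: "real (i j) \<le> r * real (N j)" "r * real (N j) < real (i j) + 1" for j
    using r0 by (auto simp: i_def of_nat_nat)
  have iN: "i j < N j" for j
  proof -
    have "r * real (N j) < 1 * real (N j)" using r1 N[of j] by (intro mult_strict_right_mono) auto
    then show ?thesis using fl(1)[of j] by linarith
  qed
  define x where "x j = real (i j) / real (N j)" for j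
  have N2: "real (N (Suc j)) = 2 * real (N j)" for j by (simp add: N_def)
  have step: "\<bar>w (x (Suc j)) - w (x j)\<bar> \<le> K * a (Suc j)" for j
  proof -
    have "2 * real (i j) \<le> r * real (N (Suc j))" "r * real (N (Suc j)) < 2 * real (i j) + 2"
      using fl[of j] by (auto simp: N2)
    then have "real (2 * i j) < real (i (Suc j) + 1)" "real (i (Suc j)) < real (2 * i j + 2)"
      using fl[of "Suc j"] by auto
    then have c: "i (Suc j) = 2 * i j \<or> i (Suc j) = Suc (2 * i j)" by linarith
    have xj: "x j = real (2 * i j) / real (N (Suc j))" by (simp add: x_def N2)
    from c show ?thesis
    proof
      assume "i (Suc j) = 2 * i j"
      then have "x (Suc j) = x j" unfolding xj unfolding x_def by simp
      then show ?thesis using K a(2) by simp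
    next
      assume i: "i (Suc j) = Suc (2 * i j)"
      then have "2 * i j < N (Suc j)" using iN[of "Suc j"] by simp
      from inc[OF this[unfolded N_def]] show ?thesis
        unfolding xj unfolding x_def i N_def .
    qed
  qed
  have x0: "x 0 = real k / real n"
  proof -
    have "\<lfloor>r * real n\<rfloor> = int k" using kr by (simp add: floor_eq_iff)
    then show ?thesis by (simp add: x_def i_def N_def)
  qed
  have sum: "\<bar>w (x m) - w (x 0)\<bar> \<le> K * (\<Sum>l<Suc m. a l)" for m
  proof (induction m)
    case 0
    then show ?case using K a(2) by simp
  next
    case (Suc m)
    then show ?case using step[of m] by (simp add: distrib_left)
  qed
  have bound: "\<bar>w (x m) - w (x 0)\<bar> \<le> K * suminf a" for m
    using order.trans[OF sum[of m] mult_left_mono[OF sum_le_suminf[OF a(1)] K]] a(2) by auto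
  have x01: "x j \<in> {0..1}" for j using iN[of j] by (auto simp: x_def)
  have "x \<longlonglongrightarrow> r"
  proof (rule LIMSEQ_I)
    fix e :: real assume e: "0 < e"
    obtain J where J: "(1 / 2) ^ J < e" using real_arch_pow_inv[OF e, of "1/2"] by auto
    have "norm (x j - r) < e" if "J \<le> j" for j
    proof -
      have "\<bar>x j - r\<bar> * real (N j) = \<bar>real (i j) - r * real (N j)\<bar>"
        using N[of j] by (simp add: x_def abs_mult_pos left_diff_distrib)
      also have "\<dots> \<le> 1" using fl[of j] by linarith
      finally have "\<bar>x j - r\<bar> \<le> 1 / real (N j)" using N[of j] by (simp add: pos_le_divide_eq)
      also have "\<dots> \<le> 1 / 2 ^ j"
        using n by (intro divide_left_mono) (auto simp: N_def)
      also have "\<dots> = (1 / 2) ^ j" by (simp add: power_divide)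
      also have "\<dots> \<le> (1 / 2) ^ J" using that by (intro power_decreasing) auto
      finally show ?thesis using J by simp
    qed
    then show "\<exists>no. \<forall>n\<ge>no. norm (x n - r) < e" by blast
  qed
  then have "(\<lambda>m. w (x m)) \<longlonglongrightarrow> w r"
    using cont x01 r0 r1 by (intro continuous_on_tendsto_compose[OF cont]) auto
  then have "(\<lambda>m. \<bar>w (x m) - w (x 0)\<bar>) \<longlonglongrightarrow> \<bar>w r - w (x 0)\<bar>" by (intro tendsto_intros)
  then have "\<bar>w r - w (x 0)\<bar> \<le> K * suminf a" by (rule LIMSEQ_le_const2) (use bound in blast)
  then show ?thesis by (simp add: x0)
qed

text \<open>The factor \<open>1 / sqrt (2 ^ j)\<close> is the standard deviation of a Brownian
  increment of level \<open>j\<close> relative to level \<open>0\<close>;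
  \<open>1 + 2 * real j\<close> is the growth in \<open>j\<close> of the logarithm that bounds all
  increments of the level, caused by the weight \<open>1 / 4 ^ j\<close> in
  \<open>chain_sum\<close>.\<close>

definition chain_weight :: "nat \<Rightarrow> real" where
  "chain_weight j = sqrt ((1 + 2 * real j) / 2 ^ j)"

lemma summable_chain_weight: "summable chain_weight"
proof (rule summable_comparison_test')
  have "sqrt (3 / 4) < 1" by (simp add: real_sqrt_less_iff[of _ 1, simplified])
  then show "summable (\<lambda>j. sqrt 3 * sqrt (3 / 4) ^ j)"
    by (intro summable_mult summable_geometric) auto
  \<comment> \<open>Any ratio between 1 and 2 would do: after division by \<open>2 ^ j\<close> a
    convergent geometric series remains. Comparing consecutive terms works from \<open>j = 2\<close>
    on; the first two steps are evaluated.\<close>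
  have "1 + 2 * real j \<le> 3 * (3 / 2) ^ j" for j
  proof (induction j)
    case (Suc j)
    show ?case
    proof (cases "j \<le> 1")
      case True
      then have "j = 0 \<or> j = 1" by auto
      then show ?thesis by auto
    next
      case False
      then have "1 + 2 * real (Suc j) \<le> 3 / 2 * (1 + 2 * real j)" by simp
      then show ?thesis using Suc by simp
    qed
  qed simp
  then have "(1 + 2 * real j) / 2 ^ j \<le> 3 * (3 / 4) ^ j" for j
  proof -
    have "(1 + 2 * real j) / 2 ^ j \<le> 3 * (3 / 2) ^ j / 2 ^ j"
      using \<open>1 + 2 * real j \<le> 3 * (3 / 2) ^ j\<close> by (intro divide_right_mono) auto
    also have "\<dots> = 3 * ((3 / 2) / 2) ^ j" by (simp only: power_divide)
    finally show ?thesis by simp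
  qed
  then show "norm (chain_weight j) \<le> sqrt 3 * sqrt (3 / 4) ^ j" if "0 \<le> j" for j
    using real_sqrt_le_mono[of "(1 + 2 * real j) / 2 ^ j" "3 * (3 / 4) ^ j"]
    by (simp add: chain_weight_def real_sqrt_mult real_sqrt_power)
qed

lemma chain_weight_nonneg: "0 \<le> chain_weight j"
  by (simp add: chain_weight_def)

text \<open>
  For Brownian motion the expectation is \<open>2 * sqrt 2\<close>, while its logarithm bounds all
  rescaled dyadic increments at once.
\<close>

definition chain_sum :: "nat \<Rightarrow> (real \<Rightarrow> real) \<Rightarrow> ennreal" where
  "chain_sum n w = (\<Sum>j. ennreal (1 / (real n * 4 ^ j)) * (\<Sum>i<n * 2 ^ j.
     ennreal (exp (real (n * 2 ^ j) * (w (real (Suc i) / real (n * 2 ^ j)) - w (real i / real (n * 2 ^ j)))\<^sup>2 / 4))))"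

text \<open>The factor 2 undoes, after taking a square root, the division by 4 in the exponents of
  \<open>chain_sum\<close>.\<close>

definition chain_const :: real where "chain_const = 2 * suminf chain_weight"

text \<open>Size of the oscillation of \<open>W\<close> on cells of length \<open>1 / n\<close>, up
  to a random factor. The summand 1 keeps it positive at \<open>n = 1\<close>.\<close>

definition mod_rate :: "nat \<Rightarrow> real" where "mod_rate n = sqrt ((1 + ln (real n)) / real n)"

lemma chain_const_nonneg: "0 \<le> chain_const"
  unfolding chain_const_def using suminf_nonneg[OF summable_chain_weight chain_weight_nonneg] by simp

text \<open>The third bound absorbs the drift error of order \<open>1 / n\<close> into the rate. The
  3 in the last one comes from \<open>1 + ln n \<le> 3 * ln (1 + n)\<close>, where
  \<open>ln (1 + n) \<ge> ln 2 \<ge> 1 / 2\<close> pays for the constant.\<close>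

lemma mod_rate_bounds:
  assumes "1 \<le> n"
  shows "0 \<le> mod_rate n" "mod_rate n \<le> 1" "1 / real n \<le> mod_rate n"
    "mod_rate n \<le> sqrt 3 * (real n powr (- 1 / 2) * sqrt (ln (1 + real n)))"
proof -
  have n: "1 \<le> real n" "0 \<le> ln (real n)" using assms by auto
  show "0 \<le> mod_rate n" using n by (simp add: mod_rate_def)
  have "1 + ln (real n) \<le> real n" using ln_le_minus_one[of "real n"] n by simp
  then have "(1 + ln (real n)) / real n \<le> 1" using n by (simp add: divide_le_eq)
  then show "mod_rate n \<le> 1" by (simp add: mod_rate_def)
  have "1 / real n \<le> 1" using n by simp
  then have "1 / real n \<le> 1 + ln (real n)" using n by linarith
  then have "(1 / real n) / real n \<le> (1 + ln (real n)) / real n"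
    by (rule divide_right_mono) simp
  then have "(1 / real n)\<^sup>2 \<le> (1 + ln (real n)) / real n" by (simp add: power2_eq_square)
  then show "1 / real n \<le> mod_rate n" unfolding mod_rate_def by (rule real_le_rsqrt)
  have "1 / 2 \<le> ln (2::real)" using ln2_ge_two_thirds by simp
  also have "ln 2 \<le> ln (1 + real n)" using n by simp
  finally have "1 / 2 \<le> ln (1 + real n)" .
  moreover have "ln (real n) \<le> ln (1 + real n)" using n by simp
  ultimately have "1 + ln (real n) \<le> 3 * ln (1 + real n)" by linarith
  then have "(1 + ln (real n)) / real n \<le> 3 * ((1 / real n) * ln (1 + real n))"
    using n by (simp add: divide_right_mono)
  then have "mod_rate n \<le> sqrt (3 * ((1 / real n) * ln (1 + real n)))"
    unfolding mod_rate_def by (rule real_sqrt_le_mono)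
  also have "\<dots> = sqrt 3 * (sqrt (1 / real n) * sqrt (ln (1 + real n)))" by (simp only: real_sqrt_mult)
  also have "sqrt (1 / real n) = real n powr (- 1 / 2)"
  proof -
    have "real n powr (- 1 / 2) = real n powr (- (1 / 2))" by simp
    also have "\<dots> = inverse (sqrt (real n))" unfolding powr_minus using n by (simp only: powr_half_sqrt)
    finally show ?thesis by (simp add: real_sqrt_divide inverse_eq_divide)
  qed
  finally show "mod_rate n \<le> sqrt 3 * (real n powr (- 1 / 2) * sqrt (ln (1 + real n)))" .
qed

lemma chain_sum_term_le:
  assumes n: "1 \<le> n" and Y: "chain_sum n w \<le> ennreal Y" "0 \<le> Y" and i: "i < n * 2 ^ j"
  shows "exp (real (n * 2 ^ j) * (w (real (Suc i) / real (n * 2 ^ j)) - w (real i / real (n * 2 ^ j)))\<^sup>2 / 4) \<le> Y * (real n * 4 ^ j)"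
proof -
  define e where "e j i = exp (real (n * 2 ^ j) * (w (real (Suc i) / real (n * 2 ^ j)) - w (real i / real (n * 2 ^ j)))\<^sup>2 / 4)" for j i
  define T where "T j = ennreal (1 / (real n * 4 ^ j)) * (\<Sum>i<n * 2 ^ j. ennreal (e j i))" for j
  have "ennreal (1 / (real n * 4 ^ j) * e j i) = ennreal (1 / (real n * 4 ^ j)) * ennreal (e j i)"
    by (rule ennreal_mult) (auto simp: e_def)
  also have "\<dots> \<le> T j" unfolding T_def using i by (intro mult_left_mono member_le_sum) auto
  also have "T j \<le> (\<Sum>j. T j)" using sum_le_suminf[of T "{j}"] by simp
  also have "\<dots> \<le> ennreal Y" using Y(1) by (simp add: chain_sum_def T_def e_def)
  finally have "1 / (real n * 4 ^ j) * e j i \<le> Y" using Y(2) by (simp add: ennreal_le_iff)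
  then have "e j i \<le> Y * (real n * 4 ^ j)" using n by (simp add: field_simps)
  then show ?thesis by (simp add: e_def)
qed

text \<open>For an increment \<open>d\<close> of level \<open>j\<close>, the logarithm of a single
  term of the series gives \<open>n * 2 ^ j * d\<^sup>2 / 4 \<le> ln Y + ln n + j * ln 4\<close>.
  Bounding this sum by a product separates the random factor, the rate in \<open>n\<close> and the
  weight of level \<open>j\<close>, which is the form that \<open>dyadic_chaining\<close>
  expects.\<close>

lemma chain_sum_modulus:
  assumes n: "1 \<le> n" and cont: "continuous_on {0..1} w" and Y: "chain_sum n w \<le> ennreal Y" "0 \<le> Y"
  shows "1 \<le> Y"
    and "\<And>k r. k < n \<Longrightarrow> r \<in> {real k / real n..real (Suc k) / real n} \<Longrightarrow>
      \<bar>w r - w (real k / real n)\<bar> \<le> chain_const * mod_rate n * sqrt (1 + ln Y)"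
proof -
  \<comment> \<open>Level \<open>0\<close> alone consists of \<open>n\<close> exponentials, each at
    least 1, weighted by \<open>1 / n\<close>. This makes \<open>ln Y\<close> non-negative in all
    that follows.\<close>
  have "(\<Sum>i<n. 1::real) \<le> (\<Sum>i<n. exp (real n * (w (real (Suc i) / real n) - w (real i / real n))\<^sup>2 / 4))"
    by (intro sum_mono) auto
  then have le: "real n \<le> (\<Sum>i<n. exp (real n * (w (real (Suc i) / real n) - w (real i / real n))\<^sup>2 / 4))" (is "_ \<le> ?S") by simp
  have "1 \<le> 1 / real n * ?S" using le n by (simp add: field_simps)
  then have "1 \<le> ennreal (1 / real n * ?S)" by (subst ennreal_1[symmetric]) (rule ennreal_leI)
  also have "\<dots> = ennreal (1 / real n) * ennreal ?S" by (rule ennreal_mult) (auto intro: sum_nonneg)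
  also have "ennreal ?S = (\<Sum>i<n. ennreal (exp (real n * (w (real (Suc i) / real n) - w (real i / real n))\<^sup>2 / 4)))"
    by (rule sum_ennreal[symmetric]) auto
  also have "ennreal (1 / real n) * \<dots> \<le> chain_sum n w"
    using sum_le_suminf[of "\<lambda>j. ennreal (1 / (real n * 4 ^ j)) * (\<Sum>i<n * 2 ^ j.
     ennreal (exp (real (n * 2 ^ j) * (w (real (Suc i) / real (n * 2 ^ j)) - w (real i / real (n * 2 ^ j)))\<^sup>2 / 4)))" "{0}"]
    by (simp add: chain_sum_def)
  finally have "1 \<le> chain_sum n w" .
  then have "ennreal 1 \<le> ennreal Y" unfolding ennreal_1 using Y(1) by (rule order.trans)
  then show Y1: "1 \<le> Y" using ennreal_le_iff[OF Y(2), of 1] by blast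
  fix k r assume k: "k < n" and r: "r \<in> {real k / real n..real (Suc k) / real n}"
  define K where "K = 2 * mod_rate n * sqrt (1 + ln Y)"
  have n0: "0 < real n" "1 \<le> real n" using n by auto
  have "\<bar>w r - w (real k / real n)\<bar> \<le> K * suminf chain_weight"
  proof (rule dyadic_chaining[OF cont n _ summable_chain_weight chain_weight_nonneg _ k r])
    show "0 \<le> K" using mod_rate_bounds(1)[OF n] Y1 by (simp add: K_def)
    fix j i assume i: "i < n * 2 ^ j"
    define d where "d = w (real (Suc i) / real (n * 2 ^ j)) - w (real i / real (n * 2 ^ j))"
    have e: "exp (real (n * 2 ^ j) * d\<^sup>2 / 4) \<le> Y * (real n * 4 ^ j)"
      using chain_sum_term_le[OF n Y i] by (simp add: d_def)
    then have "real (n * 2 ^ j) * d\<^sup>2 / 4 \<le> ln (Y * (real n * 4 ^ j))"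
      using Y1 n0 by (subst ln_ge_iff) auto
    also have "\<dots> = ln Y + ln (real n) + real j * ln 4"
      using Y1 n0 by (simp add: ln_mult ln_realpow)
    also have "\<dots> \<le> (1 + ln Y) * (1 + ln (real n)) * (1 + 2 * real j)"
    proof -
      have "ln (4::real) = 2 * ln 2" using ln_realpow[of 2 2] by simp
      also have "\<dots> \<le> 2" using ln_2_less_1 by simp
      finally have "real j * ln 4 \<le> real j * 2" by (intro mult_left_mono) auto
      moreover have "0 \<le> ln Y" "0 \<le> ln (real n)" using Y1 n0 by auto
      then have "1 + ln Y + ln (real n) \<le> (1 + ln Y) * (1 + ln (real n))"
        by (simp add: algebra_simps)
      moreover from this have "(1 + ln Y) * (1 + ln (real n)) + 2 * real j \<le> (1 + ln Y) * (1 + ln (real n)) * (1 + 2 * real j)"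
        using \<open>0 \<le> ln Y\<close> \<open>0 \<le> ln (real n)\<close> mult_right_mono[of 1 "(1 + ln Y) * (1 + ln (real n))" "2 * real j"]
        by (simp add: distrib_left)
      ultimately show ?thesis by linarith
    qed
    finally have "d\<^sup>2 \<le> 4 * ((1 + ln Y) * (1 + ln (real n)) * (1 + 2 * real j)) / real (n * 2 ^ j)"
      using n0 by (simp add: field_simps)
    also have "\<dots> = 4 * (1 + ln Y) * ((1 + ln (real n)) / real n) * ((1 + 2 * real j) / 2 ^ j)"
      by simp
    finally have "\<bar>d\<bar> \<le> sqrt (4 * (1 + ln Y) * ((1 + ln (real n)) / real n) * ((1 + 2 * real j) / 2 ^ j))"
      by (intro real_le_rsqrt) simp
    also have "\<dots> = K * chain_weight j"
      by (simp only: real_sqrt_mult K_def mod_rate_def chain_weight_def) simp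
    finally show "\<bar>w (real (Suc i) / real (n * 2 ^ j)) - w (real i / real (n * 2 ^ j))\<bar> \<le> K * chain_weight j"
      by (simp only: d_def)
  qed
  then show "\<bar>w r - w (real k / real n)\<bar> \<le> chain_const * mod_rate n * sqrt (1 + ln Y)"
    by (simp add: K_def chain_const_def mult_ac)
qed

section \<open>From the pathwise error to powers of every order\<close>

lemma powr_le_exp_half:
  fixes u p :: real
  assumes "0 < u" "1 \<le> p"
  shows "u powr p \<le> (2 * p) powr p * exp (u / 2)"
proof -
  \<comment> \<open>Tangent bound for \<open>ln\<close>, scaled by \<open>2 * p\<close> so that
    multiplication by \<open>p\<close> leaves exactly \<open>u / 2\<close>.\<close>
  have "ln (u / (2 * p)) \<le> u / (2 * p) - 1" using assms by (intro ln_le_minus_one) auto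
  then have "p * ln u \<le> p * (ln (2 * p) + u / (2 * p))"
    using assms by (intro mult_left_mono) (auto simp: ln_div)
  also have "\<dots> = p * ln (2 * p) + u / 2" using assms by (simp add: distrib_left)
  finally have "exp (p * ln u) \<le> exp (p * ln (2 * p)) * exp (u / 2)" by (simp add: exp_add[symmetric])
  then show ?thesis using assms by (simp add: powr_def)
qed

text \<open>Per unit of the random factor, \<open>c1\<close> bounds \<open>z\<close> and
  \<open>c3\<close> bounds the error of the scheme divided by the rate; the product comes from
  factoring a difference of squares.\<close>

definition scheme_const :: "real \<Rightarrow> real \<Rightarrow> real" where
  "scheme_const b z0 = (let c1 = (z0 + 2 * chain_const) * exp (\<bar>b\<bar> / 2);
     c3 = (\<bar>b\<bar> / 2 * c1 + 2 * chain_const) * (1 + (1 + \<bar>b\<bar> / 2) * exp (\<bar>b\<bar> / 2))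
   in c3 * (2 * c1 + c3))"

text \<open>Two functionals occur: with a single cell, \<open>chain_sum 1\<close> controls
  \<open>w\<close> on all of \<open>{0..1}\<close> and thereby the size of \<open>z\<close>;
  \<open>chain_sum n\<close> controls the oscillation on grid cells and thereby the error. The
  factors \<open>\<bar>z - y\<bar>\<close> and \<open>\<bar>z + y\<bar>\<close> each contribute one
  power of \<open>S\<close>.\<close>

lemma (in reflected_path) scheme_square_error:
  fixes n :: nat and y :: "nat \<Rightarrow> real"
  assumes n: "1 \<le> n" and y0: "y 0 = z0"
    and y: "\<And>k. k < n \<Longrightarrow> y (Suc k) = max (y k - b / 2 * y k * (1 / real n) +
        (w (real (Suc k) / real n) - w (real k / real n))) 0"
    and Y: "chain_sum 1 w \<le> ennreal Y1" "0 \<le> Y1" "chain_sum n w \<le> ennreal Yn" "0 \<le> Yn"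
    and t: "t \<in> {0..1}"
  shows "\<bar>(z t)\<^sup>2 - (y (nat \<lfloor>real n * t\<rfloor>))\<^sup>2\<bar> \<le>
    scheme_const b z0 * mod_rate n * (1 + sqrt (1 + ln Y1) + sqrt (1 + ln Yn))\<^sup>2"
proof -
  define R1 where "R1 = sqrt (1 + ln Y1)"
  define Rn where "Rn = sqrt (1 + ln Yn)"
  define S where "S = 1 + R1 + Rn"
  define \<rho> where "\<rho> = mod_rate n"
  define \<beta> where "\<beta> = \<bar>b\<bar> / 2"
  define c1 where "c1 = (z0 + 2 * chain_const) * exp \<beta>"
  define c2 where "c2 = \<beta> * c1 + 2 * chain_const"
  define c3 where "c3 = c2 * (1 + (1 + \<beta>) * exp \<beta>)"
  have Y1: "1 \<le> Y1" and Yn: "1 \<le> Yn"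
    using chain_sum_modulus(1)[OF order_refl cont_w Y(1,2)] chain_sum_modulus(1)[OF n cont_w Y(3,4)] by auto
  have R: "0 \<le> R1" "0 \<le> Rn" "1 \<le> S" "R1 \<le> S" "Rn \<le> S" using Y1 Yn by (auto simp: R1_def Rn_def S_def)
  have nonneg: "0 \<le> z0" "0 \<le> \<beta>" "0 \<le> chain_const" using z_nonneg[of 0] z_0 chain_const_nonneg by (auto simp: \<beta>_def)
  then have c: "0 \<le> c1" "0 \<le> c2" "0 \<le> c3" by (auto simp: c1_def c2_def c3_def)
  have \<rho>: "0 \<le> \<rho>" "\<rho> \<le> 1" "1 / real n \<le> \<rho>" using mod_rate_bounds[OF n] by (auto simp: \<rho>_def)
  have w1: "\<bar>w r\<bar> \<le> chain_const * R1" if "r \<in> {0..1}" for r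
    using chain_sum_modulus(2)[OF order_refl cont_w Y(1,2), of 0 r] that w_0
    by (simp add: R1_def mod_rate_def)
  define Zm where "Zm = (z0 + 2 * (chain_const * R1)) * exp \<beta>"
  have Zm: "z r \<le> Zm" if "r \<in> {0..1}" for r
    using z_bound[OF w1 that] by (simp add: Zm_def \<beta>_def)
  have "z0 + 2 * (chain_const * R1) \<le> z0 * S + 2 * chain_const * S"
    using R nonneg mult_left_mono[of 1 S z0] mult_left_mono[of R1 S "2 * chain_const"] by simp
  then have "Zm \<le> (z0 * S + 2 * chain_const * S) * exp \<beta>" unfolding Zm_def by (intro mult_right_mono) auto
  also have "\<dots> = c1 * S" by (simp add: c1_def algebra_simps)
  finally have ZmS: "Zm \<le> c1 * S" .
  define B where "B = \<bar>b\<bar> / 2 * Zm / real n + 2 * (chain_const * \<rho> * Rn)"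
  have B: "B \<le> c2 * \<rho> * S"
  proof -
    have "\<beta> * Zm * (1 / real n) \<le> \<beta> * (c1 * S) * \<rho>"
      using ZmS nonneg c R \<rho> by (intro mult_mono mult_left_mono) auto
    moreover have "chain_const * \<rho> * Rn \<le> chain_const * \<rho> * S"
      using nonneg \<rho> R by (intro mult_left_mono) auto
    ultimately show ?thesis by (simp add: B_def c2_def \<beta>_def algebra_simps)
  qed
  define D where "D = (1 + \<beta>) * exp \<beta>"
  have D: "0 \<le> D" using nonneg by (simp add: D_def)
  define k where "k = nat \<lfloor>real n * t\<rfloor>"
  have nt: "0 \<le> real n * t" "real n * t \<le> real n" using t n by (auto simp: mult_left_le)
  have kn: "k \<le> n" using nt unfolding k_def by linarith
  have kt: "real k \<le> real n * t" "real n * t < real k + 1" using nt unfolding k_def by (auto simp: of_nat_nat)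
  have osc: "\<bar>w q - w (real k / real n)\<bar> \<le> chain_const * \<rho> * Rn"
    if "k < n" "q \<in> {real k / real n..real (Suc k) / real n}" for k q
    using chain_sum_modulus(2)[OF n cont_w Y(3,4) that] by (simp add: Rn_def \<rho>_def)
  have e1: "\<bar>z (real k / real n) - y k\<bar> \<le> B * D"
    using scheme_error(1)[OF n Zm y0 y osc B_def kn] by (simp add: D_def \<beta>_def)
  have e2: "\<bar>z t - z (real k / real n)\<bar> \<le> B"
  proof (cases "k < n")
    case True
    have "t \<in> {real k / real n..real (Suc k) / real n}"
      using kt n by (simp add: field_simps)
    from scheme_error(2)[OF n Zm y0 y osc B_def kn True this] show ?thesis .
  next
    \<comment> \<open>Only \<open>t = 1\<close> is left: it is the last grid point, with no cell to
      its right.\<close>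
    case False
    then have "k = n" using kn by simp
    then have "t = real k / real n" using kt t n by (simp add: field_simps)
    moreover have "0 < D" using nonneg by (simp add: D_def add_pos_nonneg)
    then have "0 \<le> B" using order.trans[OF abs_ge_zero e1] by (simp add: zero_le_mult_iff)
    ultimately show ?thesis by simp
  qed
  have "\<bar>z t - y k\<bar> \<le> B * (1 + D)" using e1 e2 by (simp add: distrib_left)
  also have "\<dots> \<le> c2 * \<rho> * S * (1 + D)" using B D by (intro mult_right_mono) auto
  also have "\<dots> = c3 * \<rho> * S" by (simp add: c3_def D_def)
  finally have e: "\<bar>z t - y k\<bar> \<le> c3 * \<rho> * S" .
  \<comment> \<open>No separate bound for the scheme is derived: \<open>y k\<close> is controlled by
    \<open>z t\<close> plus the error, with \<open>\<rho>\<close> replaced by 1.\<close>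
  also have "\<dots> \<le> c3 * 1 * S" using c \<rho> R by (intro mult_right_mono mult_left_mono) auto
  finally have "\<bar>z t + y k\<bar> \<le> 2 * (c1 * S) + c3 * S"
    using ZmS Zm[OF t] z_nonneg[OF t] by simp
  then have "\<bar>z t - y k\<bar> * \<bar>z t + y k\<bar> \<le> (c3 * \<rho> * S) * (2 * (c1 * S) + c3 * S)"
    using e by (intro mult_mono) auto
  also have "\<dots> = c3 * (2 * c1 + c3) * \<rho> * S\<^sup>2" by (simp add: algebra_simps power2_eq_square)
  also have "c3 * (2 * c1 + c3) = scheme_const b z0"
    by (simp add: scheme_const_def Let_def c3_def c2_def c1_def \<beta>_def)
  also have "\<bar>z t - y k\<bar> * \<bar>z t + y k\<bar> = \<bar>(z t)\<^sup>2 - (y k)\<^sup>2\<bar>"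
    by (simp add: abs_mult[symmetric] power2_eq_square algebra_simps)
  finally show ?thesis unfolding k_def S_def R1_def Rn_def \<rho>_def .
qed

lemma scheme_const_nonneg: "0 \<le> z0 \<Longrightarrow> 0 \<le> scheme_const b z0"
  unfolding scheme_const_def Let_def using chain_const_nonneg
  by (intro mult_nonneg_nonneg add_nonneg_nonneg) auto

text \<open>The summand 1 makes the constant positive although \<open>scheme_const\<close> is only
  shown non-negative; positivity makes the right-hand side infinite when a chain sum is. The factor
  3 comes from squaring a sum of three terms.\<close>

definition moment_const :: "real \<Rightarrow> real \<Rightarrow> real \<Rightarrow> real" where
  "moment_const b z0 p = ((scheme_const b z0 + 1) * 3) powr p * ((2 * p) powr p * exp (3 / 2))"

text \<open>The random factor involves the chain sums only through logarithms, so each of its powers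
  is dominated by an exponential of \<open>m\<close>, which is linear in the chain sums. Moments of
  every order therefore cost just their expectations.\<close>

lemma (in reflected_path) scheme_square_error_powr:
  fixes n :: nat and y :: "nat \<Rightarrow> real"
  assumes n: "1 \<le> n" and y0: "y 0 = z0" and p: "1 \<le> p"
    and y: "\<And>k. k < n \<Longrightarrow> y (Suc k) = max (y k - b / 2 * y k * (1 / real n) +
        (w (real (Suc k) / real n) - w (real k / real n))) 0"
    and t: "t \<in> {0..1}"
  shows "ennreal (\<bar>(z t)\<^sup>2 - (y (nat \<lfloor>real n * t\<rfloor>))\<^sup>2\<bar> powr p) \<le>
    ennreal (moment_const b z0 p * mod_rate n powr p) * (chain_sum 1 w + chain_sum n w)"
proof (cases "chain_sum 1 w = \<top> \<or> chain_sum n w = \<top>")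
  case True
  have "0 < moment_const b z0 p" using scheme_const_nonneg[of z0 b] z_nonneg[of 0] z_0 p
    by (simp add: moment_const_def)
  moreover have "0 < mod_rate n" using n by (simp add: mod_rate_def add_pos_nonneg)
  ultimately have "ennreal (moment_const b z0 p * mod_rate n powr p) \<noteq> 0" by simp
  then have "ennreal (moment_const b z0 p * mod_rate n powr p) * (chain_sum 1 w + chain_sum n w) = \<top>"
    using True by (auto simp: ennreal_mult_eq_top_iff)
  then show ?thesis by simp
next
  case False
  then obtain Y1 Yn where Y: "chain_sum 1 w = ennreal Y1" "0 \<le> Y1" "chain_sum n w = ennreal Yn" "0 \<le> Yn"
    by (metis ennreal_cases)
  have Y1: "1 \<le> Y1" and Yn: "1 \<le> Yn"
    using chain_sum_modulus(1)[OF order_refl cont_w, of Y1] chain_sum_modulus(1)[OF n cont_w, of Yn] Y by auto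
  have z0: "0 \<le> z0" using z_nonneg[of 0] z_0 by simp
  define m where "m = max (ln Y1) (ln Yn)"
  define S where "S = 1 + sqrt (1 + ln Y1) + sqrt (1 + ln Yn)"
  have m0: "0 \<le> m" using Y1 by (simp add: m_def le_max_iff_disj)
  have "S\<^sup>2 \<le> 3 * (1\<^sup>2 + (sqrt (1 + ln Y1))\<^sup>2 + (sqrt (1 + ln Yn))\<^sup>2)"
  proof -
    have "(a + b + c)\<^sup>2 \<le> 3 * (a\<^sup>2 + b\<^sup>2 + c\<^sup>2)" for a b c :: real
      using sum_squares_bound[of a b] sum_squares_bound[of a c] sum_squares_bound[of b c]
      by (simp add: power2_eq_square algebra_simps)
    then show ?thesis unfolding S_def .
  qed
  also have "\<dots> \<le> 3 * (3 + 2 * m)" using Y1 Yn by (simp add: m_def)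
  finally have S: "S\<^sup>2 \<le> 3 * (3 + 2 * m)" .
  have "\<bar>(z t)\<^sup>2 - (y (nat \<lfloor>real n * t\<rfloor>))\<^sup>2\<bar> \<le> scheme_const b z0 * mod_rate n * S\<^sup>2"
    unfolding S_def using Y by (intro scheme_square_error[OF n y0 y _ _ _ _ t]) auto
  also have "\<dots> \<le> (scheme_const b z0 + 1) * mod_rate n * (3 * (3 + 2 * m))"
    using S scheme_const_nonneg[OF z0] mod_rate_bounds(1)[OF n] by (intro mult_mono) auto
  also have "\<dots> = (scheme_const b z0 + 1) * 3 * mod_rate n * (3 + 2 * m)" by (simp only: mult_ac)
  finally have "\<bar>(z t)\<^sup>2 - (y (nat \<lfloor>real n * t\<rfloor>))\<^sup>2\<bar> powr p \<le> ((scheme_const b z0 + 1) * 3 * mod_rate n * (3 + 2 * m)) powr p"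
    using p by (intro powr_mono2) auto
  also have "\<dots> = ((scheme_const b z0 + 1) * 3) powr p * mod_rate n powr p * (3 + 2 * m) powr p"
    using m0 scheme_const_nonneg[OF z0] mod_rate_bounds(1)[OF n] by (simp add: powr_mult)
  also have "\<dots> \<le> ((scheme_const b z0 + 1) * 3) powr p * mod_rate n powr p * ((2 * p) powr p * exp ((3 + 2 * m) / 2))"
    using m0 p by (intro mult_left_mono powr_le_exp_half) auto
  \<comment> \<open>The exponent \<open>u / 2\<close> in \<open>powr_le_exp_half\<close> is made for
    this place: it turns \<open>2 * m\<close> into \<open>m\<close>, and \<open>exp m\<close> is the
    larger of \<open>Y1\<close> and \<open>Yn\<close>.\<close>
  also have "exp ((3 + 2 * m) / 2) = exp (3 / 2) * exp m" by (simp add: exp_add[symmetric] add_divide_distrib)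
  also have "((scheme_const b z0 + 1) * 3) powr p * mod_rate n powr p * ((2 * p) powr p * (exp (3 / 2) * exp m)) \<le>
      ((scheme_const b z0 + 1) * 3) powr p * mod_rate n powr p * ((2 * p) powr p * (exp (3 / 2) * (Y1 + Yn)))"
    using Y1 Yn by (intro mult_left_mono) (auto simp: m_def max_def)
  also have "\<dots> = moment_const b z0 p * mod_rate n powr p * (Y1 + Yn)"
    by (simp only: moment_const_def mult_ac)
  finally have "\<bar>(z t)\<^sup>2 - (y (nat \<lfloor>real n * t\<rfloor>))\<^sup>2\<bar> powr p \<le> moment_const b z0 p * mod_rate n powr p * (Y1 + Yn)" .
  then have "ennreal (\<bar>(z t)\<^sup>2 - (y (nat \<lfloor>real n * t\<rfloor>))\<^sup>2\<bar> powr p) \<le> ennreal (moment_const b z0 p * mod_rate n powr p * (Y1 + Yn))"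
    by (rule ennreal_leI)
  also have "\<dots> = ennreal (moment_const b z0 p * mod_rate n powr p) * (ennreal Y1 + ennreal Yn)"
    using Y by (subst ennreal_mult) (auto simp: moment_const_def ennreal_plus)
  finally show ?thesis using Y by simp
qed

section \<open>Brownian increments\<close>

locale brownian_setting = usual_filtered_prob_space M F
  for M :: "'a measure" and F :: "real \<Rightarrow> 'a measure" +
  fixes W :: "real \<Rightarrow> 'a \<Rightarrow> real"
  assumes brownian_motion_W: "brownian_motion M F W"
begin

lemma space_F_eq: "space (F t) = space M"
  using space_F by simp

lemma measurable_F_mono:
  assumes "f \<in> borel_measurable (F s)" "s \<le> t"
  shows "f \<in> borel_measurable (F t)"
proof -
  have "subalgebra (F t) (F s)"
    using sets_F_mono[OF assms(2)] space_F_eq by (auto simp: subalgebra_def)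
  then show ?thesis using assms(1) by (rule measurable_from_subalg)
qed

lemma measurable_F_M:
  assumes "f \<in> borel_measurable (F s)"
  shows "f \<in> borel_measurable M"
  using subalgebra_F assms by (rule measurable_from_subalg)

lemma W_measurable_F: "0 \<le> s \<Longrightarrow> s \<le> t \<Longrightarrow> W s \<in> borel_measurable (F t)"
  using brownian_motion_W measurable_F_mono unfolding brownian_motion_def adapted_def by blast

lemma W_measurable [measurable]: "0 \<le> t \<Longrightarrow> W t \<in> borel_measurable M"
  using W_measurable_F[of t t] measurable_F_M by simp

lemma increment_distributed:
  "0 \<le> s \<Longrightarrow> s < t \<Longrightarrow>
    distributed M lborel (\<lambda>\<omega>. W t \<omega> - W s \<omega>) (normal_density 0 (sqrt (t - s)))"
  using brownian_motion_W unfolding brownian_motion_def by blast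

text \<open>\<open>brownian_motion\<close> gives independence of events. Preimages of Borel sets are
  stable under intersection, so it extends to the generated sigma-algebras, hence to random
  variables and to functions of the increment.\<close>

lemma increment_indep:
  fixes \<phi> :: "'a \<Rightarrow> real" and g :: "real \<Rightarrow> real"
  assumes "0 \<le> s" "s < t" "\<phi> \<in> borel_measurable (F s)" "g \<in> borel_measurable borel"
  shows "indep_var borel \<phi> borel (\<lambda>\<omega>. g (W t \<omega> - W s \<omega>))"
proof -
  let ?D = "\<lambda>\<omega>. W t \<omega> - W s \<omega>"
  have mD: "?D \<in> borel_measurable M"
    using assms(1,2) by (intro borel_measurable_diff W_measurable) auto
  have m\<phi>: "\<phi> \<in> borel_measurable M" using measurable_F_M assms(3) .
  have ind: "indep_set (sets (F s)) {?D -` B \<inter> space M |B. B \<in> sets borel}"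
    using brownian_motion_W assms(1,2) unfolding brownian_motion_def by blast
  have prod: "prob (a \<inter> b) = prob a * prob b"
    if "a \<in> {\<phi> -` A \<inter> space M |A. A \<in> sets borel}" "b \<in> {?D -` B \<inter> space M |B. B \<in> sets borel}" for a b
  proof -
    have "a \<in> sets (F s)"
      using that(1) measurable_sets[OF assms(3)] space_F_eq by auto
    then show ?thesis using indep_setD[OF ind] that(2) by blast
  qed
  have "indep_set {\<phi> -` A \<inter> space M |A. A \<in> sets borel} {?D -` B \<inter> space M |B. B \<in> sets borel}"
    using prod measurable_sets[OF m\<phi>] measurable_sets[OF mD] by (intro indep_setI) auto
  moreover have "Int_stable {f -` A \<inter> space M |A. A \<in> sets borel}" for f :: "'a \<Rightarrow> real"
  proof (safe intro!: Int_stableI)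
    fix A B :: "real set" assume "A \<in> sets borel" "B \<in> sets borel"
    then show "\<exists>C. (f -` A \<inter> space M) \<inter> (f -` B \<inter> space M) = (f -` C \<inter> space M) \<and> C \<in> sets borel"
      by (intro exI[of _ "A \<inter> B"]) auto
  qed
  ultimately have "indep_var borel \<phi> borel ?D"
    unfolding indep_var_eq using m\<phi> mD by (intro conjI indep_set_sigma_sets) auto
  from indep_var_compose[OF this, of "\<lambda>x. x" borel g borel] assms(4)
  show ?thesis by (simp add: comp_def)
qed

text \<open>The case \<open>s = t\<close>, where the increment is constantly \<open>0\<close>, is
  included because the refined grids used later have empty cells.\<close>

lemma indep_expectation_mult:
  fixes \<phi> :: "'a \<Rightarrow> real" and g :: "real \<Rightarrow> real"
  assumes "0 \<le> s" "s \<le> t" "\<phi> \<in> borel_measurable (F s)" "g \<in> borel_measurable borel"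
    "integrable M \<phi>" "integrable M (\<lambda>\<omega>. g (W t \<omega> - W s \<omega>))"
  shows "integrable M (\<lambda>\<omega>. \<phi> \<omega> * g (W t \<omega> - W s \<omega>))"
    and "expectation (\<lambda>\<omega>. \<phi> \<omega> * g (W t \<omega> - W s \<omega>)) =
      expectation \<phi> * expectation (\<lambda>\<omega>. g (W t \<omega> - W s \<omega>))"
proof -
  show "integrable M (\<lambda>\<omega>. \<phi> \<omega> * g (W t \<omega> - W s \<omega>))"
  proof (cases "s < t")
    case True
    from indep_var_integrable[OF increment_indep[OF assms(1) True assms(3,4)] assms(5,6)] show ?thesis .
  next
    case False
    then show ?thesis using assms by simp
  qed
  show "expectation (\<lambda>\<omega>. \<phi> \<omega> * g (W t \<omega> - W s \<omega>)) =
      expectation \<phi> * expectation (\<lambda>\<omega>. g (W t \<omega> - W s \<omega>))"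
  proof (cases "s < t")
    case True
    from indep_var_lebesgue_integral[OF increment_indep[OF assms(1) True assms(3,4)] assms(5,6)] show ?thesis .
  next
    case False
    then show ?thesis using assms by (simp add: prob_space)
  qed
qed

text \<open>The last identity is the variance of a squared increment: with \<open>h = t - s\<close>,
  the fourth moment \<open>3 * h\<^sup>2\<close> combines with
  \<open>- 2 * h\<^sup>2 + h\<^sup>2\<close>. It drives the convergence of the quadratic
  variation.\<close>

lemma increment_moments:
  assumes "0 \<le> s" "s \<le> t"
  shows "integrable M (\<lambda>\<omega>. (W t \<omega> - W s \<omega>) ^ k)"
    and "expectation (\<lambda>\<omega>. W t \<omega> - W s \<omega>) = 0"
    and "expectation (\<lambda>\<omega>. (W t \<omega> - W s \<omega>)\<^sup>2) = t - s"
    and "expectation (\<lambda>\<omega>. ((W t \<omega> - W s \<omega>)\<^sup>2 - (t - s))\<^sup>2) = 2 * (t - s)\<^sup>2"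
proof -
  have *: "integrable M (\<lambda>\<omega>. (W t \<omega> - W s \<omega>) ^ k) \<and> expectation (\<lambda>\<omega>. W t \<omega> - W s \<omega>) = 0
    \<and> expectation (\<lambda>\<omega>. (W t \<omega> - W s \<omega>)\<^sup>2) = t - s
    \<and> expectation (\<lambda>\<omega>. ((W t \<omega> - W s \<omega>)\<^sup>2 - (t - s))\<^sup>2) = 2 * (t - s)\<^sup>2"
  proof (cases "s < t")
    case True
    define \<sigma> where "\<sigma> = sqrt (t - s)"
    have \<sigma>: "0 < \<sigma>" "\<sigma>\<^sup>2 = t - s" using True by (auto simp: \<sigma>_def)
    have D: "distributed M lborel (\<lambda>\<omega>. W t \<omega> - W s \<omega>) (normal_density 0 \<sigma>)"
      using increment_distributed[OF assms(1) True] by (simp add: \<sigma>_def)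
    have i: "integrable M (\<lambda>\<omega>. (W t \<omega> - W s \<omega>) ^ k)" for k
      using distributed_integrable[OF D, of "\<lambda>x. x ^ k"] integrable_normal_moment[OF \<sigma>(1), of 0 k] by simp
    have e: "expectation (\<lambda>\<omega>. (W t \<omega> - W s \<omega>) ^ (2 * k)) = fact (2 * k) / ((2 / \<sigma>\<^sup>2) ^ k * fact k)" for k
      using distributed_integral[OF D, of "\<lambda>x. x ^ (2 * k)"] integral_normal_moment_even[OF \<sigma>(1), of 0 k] by simp
    have e2: "expectation (\<lambda>\<omega>. (W t \<omega> - W s \<omega>)\<^sup>2) = t - s"
      using e[of 1] \<sigma> by (simp add: fact_numeral)
    have e4: "expectation (\<lambda>\<omega>. (W t \<omega> - W s \<omega>) ^ 4) = 3 * (t - s)\<^sup>2"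
      using e[of 2] \<sigma> by (simp add: fact_numeral power2_eq_square)
    have "(\<lambda>\<omega>. ((W t \<omega> - W s \<omega>)\<^sup>2 - (t - s))\<^sup>2) =
      (\<lambda>\<omega>. (W t \<omega> - W s \<omega>) ^ 4 - 2 * (t - s) * (W t \<omega> - W s \<omega>)\<^sup>2 + (t - s)\<^sup>2)"
      by (auto simp: power2_eq_square power4_eq_xxxx algebra_simps)
    then have "expectation (\<lambda>\<omega>. ((W t \<omega> - W s \<omega>)\<^sup>2 - (t - s))\<^sup>2) = 2 * (t - s)\<^sup>2"
      using i[of 4] i[of 2] e2 e4 by (simp add: prob_space power2_eq_square)
    then show ?thesis using i e2 normal_distributed_expectation[OF \<sigma>(1) D] by blast
  next
    case False
    then show ?thesis using assms by (cases k) auto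
  qed
  then show "integrable M (\<lambda>\<omega>. (W t \<omega> - W s \<omega>) ^ k)"
    and "expectation (\<lambda>\<omega>. W t \<omega> - W s \<omega>) = 0"
    and "expectation (\<lambda>\<omega>. (W t \<omega> - W s \<omega>)\<^sup>2) = t - s"
    and "expectation (\<lambda>\<omega>. ((W t \<omega> - W s \<omega>)\<^sup>2 - (t - s))\<^sup>2) = 2 * (t - s)\<^sup>2"
    by blast+
qed

section \<open>Discrete Ito isometry and Lenglart bound\<close>

lemma expectation_sum_square_orthogonal:
  fixes d :: "nat \<Rightarrow> 'a \<Rightarrow> real"
  assumes "finite A" "\<And>p q. p \<in> A \<Longrightarrow> q \<in> A \<Longrightarrow> integrable M (\<lambda>\<omega>. d p \<omega> * d q \<omega>)"
    and "\<And>p q. p \<in> A \<Longrightarrow> q \<in> A \<Longrightarrow> p < q \<Longrightarrow> expectation (\<lambda>\<omega>. d p \<omega> * d q \<omega>) = 0"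
  shows "expectation (\<lambda>\<omega>. (\<Sum>q\<in>A. d q \<omega>)\<^sup>2) = (\<Sum>q\<in>A. expectation (\<lambda>\<omega>. (d q \<omega>)\<^sup>2))"
proof -
  have "expectation (\<lambda>\<omega>. (\<Sum>q\<in>A. d q \<omega>)\<^sup>2) = expectation (\<lambda>\<omega>. \<Sum>p\<in>A. \<Sum>q\<in>A. d p \<omega> * d q \<omega>)"
    by (simp add: power2_eq_square sum_product)
  also have "\<dots> = (\<Sum>p\<in>A. \<Sum>q\<in>A. expectation (\<lambda>\<omega>. d p \<omega> * d q \<omega>))"
    using assms(2) by (simp add: Bochner_Integration.integral_sum)
  also have "\<dots> = (\<Sum>p\<in>A. \<Sum>q\<in>A. if q = p then expectation (\<lambda>\<omega>. (d p \<omega>)\<^sup>2) else 0)"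
  proof (intro sum.cong refl)
    fix p q assume pq: "p \<in> A" "q \<in> A"
    show "expectation (\<lambda>\<omega>. d p \<omega> * d q \<omega>) = (if q = p then expectation (\<lambda>\<omega>. (d p \<omega>)\<^sup>2) else 0)"
      using assms(3)[OF pq] assms(3)[OF pq(2,1)]
      by (cases p q rule: linorder_cases) (auto simp: power2_eq_square mult.commute)
  qed
  also have "\<dots> = (\<Sum>q\<in>A. expectation (\<lambda>\<omega>. (d q \<omega>)\<^sup>2))"
    using assms(1) by simp
  finally show ?thesis .
qed

lemma bounded_mult_integrable:
  fixes \<phi> f :: "'a \<Rightarrow> real"
  assumes "\<phi> \<in> borel_measurable M" "\<And>\<omega>. \<omega> \<in> space M \<Longrightarrow> \<bar>\<phi> \<omega>\<bar> \<le> K" "integrable M f"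
  shows "integrable M (\<lambda>\<omega>. \<phi> \<omega> * f \<omega>)"
proof (rule Bochner_Integration.integrable_bound[where f = "\<lambda>\<omega>. K * f \<omega>"])
  show "AE \<omega> in M. norm (\<phi> \<omega> * f \<omega>) \<le> norm (K * f \<omega>)"
  proof (rule AE_I2)
    fix \<omega> assume "\<omega> \<in> space M"
    from assms(2)[OF this] show "norm (\<phi> \<omega> * f \<omega>) \<le> norm (K * f \<omega>)"
      by (auto simp: abs_mult intro!: mult_right_mono)
  qed
qed (use assms in auto)

text \<open>For \<open>p < q\<close> the product \<open>d p * \<phi> q\<close> is known at time
  \<open>u q\<close>, hence independent of the centred factor from the next increment; mixed terms
  vanish. The function \<open>g\<close> is the identity for stochastic sums and
  \<open>x\<^sup>2 - h\<close> for compensated squares.\<close>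

lemma expectation_weighted_increments:
  fixes \<phi> :: "nat \<Rightarrow> 'a \<Rightarrow> real" and g :: "nat \<Rightarrow> real \<Rightarrow> real" and u :: "nat \<Rightarrow> real"
  assumes u: "mono u" "0 \<le> u 0"
    and \<phi>: "\<And>q. q \<in> A \<Longrightarrow> \<phi> q \<in> borel_measurable (F (u q))"
    and K: "\<And>q \<omega>. q \<in> A \<Longrightarrow> \<omega> \<in> space M \<Longrightarrow> \<bar>\<phi> q \<omega>\<bar> \<le> K q"
    and g[measurable]: "\<And>q. g q \<in> borel_measurable borel"
    and g2: "\<And>q. integrable M (\<lambda>\<omega>. (g q (W (u (Suc q)) \<omega> - W (u q) \<omega>))\<^sup>2)"
    and g0: "\<And>q. expectation (\<lambda>\<omega>. g q (W (u (Suc q)) \<omega> - W (u q) \<omega>)) = 0"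
    and A: "finite A"
  shows "integrable M (\<lambda>\<omega>. (\<Sum>q\<in>A. \<phi> q \<omega> * g q (W (u (Suc q)) \<omega> - W (u q) \<omega>))\<^sup>2)"
    and "expectation (\<lambda>\<omega>. (\<Sum>q\<in>A. \<phi> q \<omega> * g q (W (u (Suc q)) \<omega> - W (u q) \<omega>))\<^sup>2) =
      (\<Sum>q\<in>A. expectation (\<lambda>\<omega>. (\<phi> q \<omega>)\<^sup>2) * expectation (\<lambda>\<omega>. (g q (W (u (Suc q)) \<omega> - W (u q) \<omega>))\<^sup>2))"
proof -
  define G where "G q \<omega> = g q (W (u (Suc q)) \<omega> - W (u q) \<omega>)" for q \<omega>
  define d where "d q \<omega> = \<phi> q \<omega> * G q \<omega>" for q \<omega>
  have up: "0 \<le> u q" for q using u monoD[OF u(1), of 0 q] by simp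
  have us: "u q \<le> u (Suc q)" for q using monoD[OF u(1)] by simp
  have mG[measurable]: "G q \<in> borel_measurable M" for q
    unfolding G_def using up by measurable
  have mGF: "G q \<in> borel_measurable (F (u p))" if "q < p" for p q
  proof -
    have "u q \<le> u p" "u (Suc q) \<le> u p" using that monoD[OF u(1)] by auto
    then have [measurable]: "W (u q) \<in> borel_measurable (F (u p))" "W (u (Suc q)) \<in> borel_measurable (F (u p))"
      using W_measurable_F up by auto
    show ?thesis unfolding G_def by measurable
  qed
  have m\<phi>[measurable]: "q \<in> A \<Longrightarrow> \<phi> q \<in> borel_measurable M" for q
    using \<phi> measurable_F_M by blast
  have iG2: "integrable M (\<lambda>\<omega>. (G q \<omega>)\<^sup>2)" for q using g2 by (simp add: G_def)
  have iG: "integrable M (G q)" for q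
    using iG2 by (rule square_integrable_imp_integrable[rotated]) simp
  have iGG: "integrable M (\<lambda>\<omega>. G p \<omega> * G q \<omega>)" for p q
  proof (rule Bochner_Integration.integrable_bound[where f = "\<lambda>\<omega>. (G p \<omega>)\<^sup>2 + (G q \<omega>)\<^sup>2"])
    show "AE \<omega> in M. norm (G p \<omega> * G q \<omega>) \<le> norm ((G p \<omega>)\<^sup>2 + (G q \<omega>)\<^sup>2)"
    proof (rule AE_I2)
      fix \<omega>
      have "2 * \<bar>G p \<omega>\<bar> * \<bar>G q \<omega>\<bar> \<le> \<bar>G p \<omega>\<bar>\<^sup>2 + \<bar>G q \<omega>\<bar>\<^sup>2" by (rule sum_squares_bound)
      moreover have "0 \<le> \<bar>G p \<omega>\<bar> * \<bar>G q \<omega>\<bar>" by simp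
      ultimately have "\<bar>G p \<omega>\<bar> * \<bar>G q \<omega>\<bar> \<le> (G p \<omega>)\<^sup>2 + (G q \<omega>)\<^sup>2"
        unfolding power2_abs by linarith
      then show "norm (G p \<omega> * G q \<omega>) \<le> norm ((G p \<omega>)\<^sup>2 + (G q \<omega>)\<^sup>2)" by (simp add: abs_mult)
    qed
  qed (use iG2 in auto)
  have dd: "integrable M (\<lambda>\<omega>. d p \<omega> * d q \<omega>)" if "p \<in> A" "q \<in> A" for p q
  proof -
    have "integrable M (\<lambda>\<omega>. \<phi> p \<omega> * (\<phi> q \<omega> * (G p \<omega> * G q \<omega>)))"
      using that K by (intro bounded_mult_integrable iGG) auto
    then show ?thesis unfolding d_def by (simp add: mult_ac)
  qed
  have idG: "integrable M (\<lambda>\<omega>. d p \<omega> * \<phi> q \<omega>)" if "p \<in> A" "q \<in> A" for p q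
  proof -
    have "integrable M (\<lambda>\<omega>. \<phi> q \<omega> * (\<phi> p \<omega> * G p \<omega>))"
      using that K by (intro bounded_mult_integrable iG) auto
    then show ?thesis unfolding d_def by (simp add: mult_ac)
  qed
  have orth: "expectation (\<lambda>\<omega>. d p \<omega> * d q \<omega>) = 0" if pq: "p \<in> A" "q \<in> A" "p < q" for p q
  proof -
    have "\<phi> p \<in> borel_measurable (F (u q))"
      using \<phi>[OF pq(1)] monoD[OF u(1), of p q] pq(3) measurable_F_mono by auto
    then have m: "(\<lambda>\<omega>. d p \<omega> * \<phi> q \<omega>) \<in> borel_measurable (F (u q))"
      unfolding d_def using mGF[OF pq(3)] \<phi>[OF pq(2)] by measurable
    have "expectation (\<lambda>\<omega>. (d p \<omega> * \<phi> q \<omega>) * G q \<omega>) =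
      expectation (\<lambda>\<omega>. d p \<omega> * \<phi> q \<omega>) * expectation (G q)"
      unfolding G_def using indep_expectation_mult(2)[OF up us m g idG[OF pq(1,2)]] iG
      unfolding G_def by blast
    moreover have "expectation (G q) = 0" using g0[of q] unfolding G_def .
    ultimately show ?thesis by (simp add: d_def mult_ac)
  qed
  have sq: "expectation (\<lambda>\<omega>. (d q \<omega>)\<^sup>2) = expectation (\<lambda>\<omega>. (\<phi> q \<omega>)\<^sup>2) * expectation (\<lambda>\<omega>. (G q \<omega>)\<^sup>2)"
    if q: "q \<in> A" for q
  proof -
    have "integrable M (\<lambda>\<omega>. \<phi> q \<omega> * (\<phi> q \<omega> * 1))"
      using q K by (intro bounded_mult_integrable) auto
    then have i: "integrable M (\<lambda>\<omega>. (\<phi> q \<omega>)\<^sup>2)" by (simp add: power2_eq_square)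
    have m: "(\<lambda>\<omega>. (\<phi> q \<omega>)\<^sup>2) \<in> borel_measurable (F (u q))" using \<phi>[OF q] by measurable
    have m2: "(\<lambda>x. (g q x)\<^sup>2) \<in> borel_measurable borel" by measurable
    show ?thesis
      using indep_expectation_mult(2)[OF up us m m2 i] g2
      unfolding d_def G_def power_mult_distrib by blast
  qed
  have "integrable M (\<lambda>\<omega>. (\<Sum>q\<in>A. d q \<omega>)\<^sup>2)"
    using dd by (simp add: power2_eq_square sum_product)
  then show "integrable M (\<lambda>\<omega>. (\<Sum>q\<in>A. \<phi> q \<omega> * g q (W (u (Suc q)) \<omega> - W (u q) \<omega>))\<^sup>2)"
    by (simp add: d_def G_def)
  have "expectation (\<lambda>\<omega>. (\<Sum>q\<in>A. d q \<omega>)\<^sup>2) = (\<Sum>q\<in>A. expectation (\<lambda>\<omega>. (d q \<omega>)\<^sup>2))"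
    using dd orth by (intro expectation_sum_square_orthogonal A) auto
  also have "\<dots> = (\<Sum>q\<in>A. expectation (\<lambda>\<omega>. (\<phi> q \<omega>)\<^sup>2) * expectation (\<lambda>\<omega>. (G q \<omega>)\<^sup>2))"
    using sq by (intro sum.cong) auto
  finally show "expectation (\<lambda>\<omega>. (\<Sum>q\<in>A. \<phi> q \<omega> * g q (W (u (Suc q)) \<omega> - W (u q) \<omega>))\<^sup>2) =
      (\<Sum>q\<in>A. expectation (\<lambda>\<omega>. (\<phi> q \<omega>)\<^sup>2) * expectation (\<lambda>\<omega>. (g q (W (u (Suc q)) \<omega> - W (u q) \<omega>))\<^sup>2))"
    by (simp add: d_def G_def)
qed

text \<open>Cutting \<open>\<phi>\<close> off once its accumulated energy exceeds 1 keeps it non-anticipating.\<close>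

lemma lenglart_increments:
  fixes \<phi> :: "nat \<Rightarrow> 'a \<Rightarrow> real" and u :: "nat \<Rightarrow> real"
  assumes u: "mono u" "0 \<le> u 0"
    and \<phi>: "\<And>q. q < n * k \<Longrightarrow> \<phi> q \<in> borel_measurable (F (u q))"
  shows "expectation (\<lambda>\<omega>. min 1 (\<Sum>j<n. (\<Sum>q\<in>{j*k..<j*k+k}. \<phi> q \<omega> * (W (u (Suc q)) \<omega> - W (u q) \<omega>))\<^sup>2))
    \<le> 2 * expectation (\<lambda>\<omega>. min 1 (\<Sum>q<n*k. (\<phi> q \<omega>)\<^sup>2 * (u (Suc q) - u q)))"
proof -
  define \<Delta> where "\<Delta> q \<omega> = W (u (Suc q)) \<omega> - W (u q) \<omega>" for q \<omega>
  define h where "h q = u (Suc q) - u q" for q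
  define V where "V q \<omega> = (\<Sum>l<q. (\<phi> l \<omega>)\<^sup>2 * h l)" for q \<omega>
  define \<psi> where "\<psi> q \<omega> = (if 0 < h q \<and> V (Suc q) \<omega> \<le> 1 then \<phi> q \<omega> else 0)" for q \<omega>
  define N where "N = n * k"
  have up: "0 \<le> u q" for q using u monoD[OF u(1), of 0 q] by simp
  have us: "u q \<le> u (Suc q)" for q using monoD[OF u(1)] by simp
  have h0: "0 \<le> h q" for q using us by (simp add: h_def)
  have m\<Delta>[measurable]: "\<Delta> q \<in> borel_measurable M" for q unfolding \<Delta>_def using up by measurable
  have m\<phi>[measurable]: "q < N \<Longrightarrow> \<phi> q \<in> borel_measurable M" for q
    using \<phi> measurable_F_M unfolding N_def by blast
  have mV: "V q \<in> borel_measurable (F (u p))" if "q \<le> Suc p" "p < N" for p q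
  proof -
    have "\<phi> l \<in> borel_measurable (F (u p))" if "l < q" for l
    proof -
      have "l \<le> p" "l < N" using that \<open>q \<le> Suc p\<close> \<open>p < N\<close> by auto
      then show ?thesis using \<phi>[of l] monoD[OF u(1), of l p] measurable_F_mono unfolding N_def by auto
    qed
    then show ?thesis unfolding V_def by (intro borel_measurable_sum) auto
  qed
  have m\<psi>: "\<psi> q \<in> borel_measurable (F (u q))" if "q < N" for q
    unfolding \<psi>_def using mV[of "Suc q" q] \<phi>[of q] that unfolding N_def by measurable
  have m\<psi>M[measurable]: "q < N \<Longrightarrow> \<psi> q \<in> borel_measurable M" for q
    using m\<psi> measurable_F_M by blast
  have Vmono: "V p \<omega> \<le> V q \<omega>" if "p \<le> q" for p q \<omega>
    unfolding V_def using that h0 by (intro sum_mono2) auto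
  have V0: "0 \<le> V q \<omega>" for q \<omega> unfolding V_def using h0 by (auto intro: sum_nonneg)
  have \<psi>b: "\<bar>\<psi> q \<omega>\<bar> \<le> (if 0 < h q then sqrt (1 / h q) else 0)" for q \<omega>
  proof (cases "0 < h q \<and> V (Suc q) \<omega> \<le> 1")
    case True
    have "(\<phi> q \<omega>)\<^sup>2 * h q \<le> V (Suc q) \<omega>" using V0[of q \<omega>] by (simp add: V_def)
    then have "(\<phi> q \<omega>)\<^sup>2 * h q \<le> 1" using True by simp
    then have "(\<phi> q \<omega>)\<^sup>2 \<le> 1 / h q" using True by (simp add: field_simps)
    then have "\<bar>\<phi> q \<omega>\<bar> \<le> sqrt (1 / h q)" by (rule real_le_rsqrt[of "\<bar>\<phi> q \<omega>\<bar>", simplified])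
    then show ?thesis using True by (simp add: \<psi>_def)
  qed (auto simp: \<psi>_def)
  have iM: "integrable M (\<lambda>\<omega>. (\<Sum>q\<in>A. \<psi> q \<omega> * \<Delta> q \<omega>)\<^sup>2)"
    and eM: "expectation (\<lambda>\<omega>. (\<Sum>q\<in>A. \<psi> q \<omega> * \<Delta> q \<omega>)\<^sup>2) = (\<Sum>q\<in>A. expectation (\<lambda>\<omega>. (\<psi> q \<omega>)\<^sup>2) * h q)"
    if "A \<subseteq> {..<N}" for A
  proof -
    have fin: "finite A" using that finite_subset by blast
    have a: "q \<in> A \<Longrightarrow> \<psi> q \<in> borel_measurable (F (u q))" for q using that m\<psi> by auto
    note * = expectation_weighted_increments[OF u(1,2), of A \<psi> _ "\<lambda>q x. x", OF a \<psi>b _ _ _ fin]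
    have 1: "integrable M (\<lambda>\<omega>. (W (u (Suc q)) \<omega> - W (u q) \<omega>)\<^sup>2)"
       "expectation (\<lambda>\<omega>. W (u (Suc q)) \<omega> - W (u q) \<omega>) = 0"
       "expectation (\<lambda>\<omega>. (W (u (Suc q)) \<omega> - W (u q) \<omega>)\<^sup>2) = h q" for q
      using increment_moments[OF up us] by (auto simp: h_def)
    show "integrable M (\<lambda>\<omega>. (\<Sum>q\<in>A. \<psi> q \<omega> * \<Delta> q \<omega>)\<^sup>2)"
      unfolding \<Delta>_def by (rule *(1)) (use 1 in auto)
    show "expectation (\<lambda>\<omega>. (\<Sum>q\<in>A. \<psi> q \<omega> * \<Delta> q \<omega>)\<^sup>2) = (\<Sum>q\<in>A. expectation (\<lambda>\<omega>. (\<psi> q \<omega>)\<^sup>2) * h q)"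
      unfolding \<Delta>_def by (subst *(2)) (use 1 in auto)
  qed
  \<comment> \<open>\<open>V\<close> is nondecreasing in its index: once it exceeds 1, all later
    \<open>\<psi>\<close> vanish and the truncated energy stays below 1.\<close>
  have V\<psi>: "(\<Sum>q<m. (\<psi> q \<omega>)\<^sup>2 * h q) \<le> min 1 (V m \<omega>)" for m \<omega>
  proof (induction m)
    case 0 then show ?case by (simp add: V_def)
  next
    case (Suc m)
    show ?case
    proof (cases "V (Suc m) \<omega> \<le> 1")
      case True
      have "(\<psi> m \<omega>)\<^sup>2 * h m \<le> (\<phi> m \<omega>)\<^sup>2 * h m" using h0[of m] by (auto simp: \<psi>_def)
      then show ?thesis using Suc True by (simp add: V_def)
    next
      case False
      then show ?thesis using Suc Vmono[of m "Suc m" \<omega>] by (simp add: \<psi>_def)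
    qed
  qed
  define S where "S \<omega> = (\<Sum>j<n. (\<Sum>q\<in>{j*k..<j*k+k}. \<phi> q \<omega> * \<Delta> q \<omega>)\<^sup>2)" for \<omega>
  define S' where "S' \<omega> = (\<Sum>j<n. (\<Sum>q\<in>{j*k..<j*k+k}. \<psi> q \<omega> * \<Delta> q \<omega>)\<^sup>2)" for \<omega>
  have sub: "{j*k..<j*k+k} \<subseteq> {..<N}" if "j < n" for j
  proof -
    have "j*k+k = Suc j * k" by simp
    also have "\<dots> \<le> N" unfolding N_def using that by (intro mult_right_mono) auto
    finally show ?thesis by auto
  qed
  have iV: "integrable M (\<lambda>\<omega>. min 1 (V N \<omega>))"
    using V0 by (intro integrable_const_bound[where B=1]) (auto simp: V_def)
  have eS': "expectation S' = expectation (\<lambda>\<omega>. \<Sum>q<N. (\<psi> q \<omega>)\<^sup>2 * h q)" and iS': "integrable M S'"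
    and i\<psi>: "integrable M (\<lambda>\<omega>. \<Sum>q<N. (\<psi> q \<omega>)\<^sup>2 * h q)"
  proof -
    have i: "integrable M (\<lambda>\<omega>. (\<psi> q \<omega>)\<^sup>2)" if "q < N" for q
      using that \<psi>b[of q] by (intro integrable_const_bound[where B="(if 0 < h q then sqrt (1 / h q) else 0)\<^sup>2"])
        (auto simp: abs_le_square_iff[symmetric])
    then show "integrable M (\<lambda>\<omega>. \<Sum>q<N. (\<psi> q \<omega>)\<^sup>2 * h q)" by auto
    show "integrable M S'" unfolding S'_def using iM sub by auto
    have "expectation S' = (\<Sum>j<n. \<Sum>q\<in>{j*k..<j*k+k}. expectation (\<lambda>\<omega>. (\<psi> q \<omega>)\<^sup>2) * h q)"
      unfolding S'_def using iM eM sub by (simp add: Bochner_Integration.integral_sum)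
    also have "\<dots> = (\<Sum>q<N. expectation (\<lambda>\<omega>. (\<psi> q \<omega>)\<^sup>2) * h q)"
      unfolding N_def by (rule sum.nat_group)
    also have "\<dots> = expectation (\<lambda>\<omega>. \<Sum>q<N. (\<psi> q \<omega>)\<^sup>2 * h q)"
      using i by (simp add: Bochner_Integration.integral_sum)
    finally show "expectation S' = expectation (\<lambda>\<omega>. \<Sum>q<N. (\<psi> q \<omega>)\<^sup>2 * h q)" .
  qed
  \<comment> \<open>Either nothing has been cut off and \<open>S'\<close> equals \<open>S\<close>,
    or the energy exceeds 1 and the second summand is 1. The two summands account for the factor 2
    of the claim.\<close>
  have pt: "min 1 (S \<omega>) \<le> S' \<omega> + min 1 (V N \<omega>)" if "\<omega> \<in> space M" for \<omega>
  proof (cases "V N \<omega> \<le> 1")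
    case True
    have "\<psi> q \<omega> * \<Delta> q \<omega> = \<phi> q \<omega> * \<Delta> q \<omega>" if "q < N" for q
    proof (cases "0 < h q")
      case 1: True
      have "V (Suc q) \<omega> \<le> 1" using Vmono[of "Suc q" N \<omega>] that True by simp
      then show ?thesis using 1 by (simp add: \<psi>_def)
    next
      case False
      then have "u (Suc q) = u q" using us[of q] by (simp add: h_def)
      then show ?thesis by (simp add: \<Delta>_def)
    qed
    then have "(\<Sum>q\<in>{j*k..<j*k+k}. \<psi> q \<omega> * \<Delta> q \<omega>) = (\<Sum>q\<in>{j*k..<j*k+k}. \<phi> q \<omega> * \<Delta> q \<omega>)" if "j < n" for j
      using sub[OF that] by (intro sum.cong) (auto simp: subset_iff)
    then have "S' \<omega> = S \<omega>" unfolding S'_def S_def by simp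
    then show ?thesis using V0[of N \<omega>] by auto
  next
    case False
    moreover have "0 \<le> S' \<omega>" unfolding S'_def by (auto intro: sum_nonneg)
    ultimately show ?thesis by auto
  qed
  have mS: "S \<in> borel_measurable M"
    unfolding S_def using sub
    by (intro borel_measurable_sum borel_measurable_power borel_measurable_times)
      (auto simp: subset_iff)
  have "0 \<le> S \<omega>" for \<omega> unfolding S_def by (auto intro: sum_nonneg)
  then have "integrable M (\<lambda>\<omega>. min 1 (S \<omega>))"
    using mS by (intro integrable_const_bound[where B=1]) auto
  then have "expectation (\<lambda>\<omega>. min 1 (S \<omega>)) \<le> expectation (\<lambda>\<omega>. S' \<omega> + min 1 (V N \<omega>))"
    using pt iS' iV by (intro integral_mono) auto
  also have "\<dots> = expectation (\<lambda>\<omega>. \<Sum>q<N. (\<psi> q \<omega>)\<^sup>2 * h q) + expectation (\<lambda>\<omega>. min 1 (V N \<omega>))"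
    using eS' iS' iV by simp
  also have "\<dots> \<le> 2 * expectation (\<lambda>\<omega>. min 1 (V N \<omega>))"
    using integral_mono[OF i\<psi> iV] V\<psi> by auto
  finally show ?thesis unfolding S_def V_def \<Delta>_def h_def N_def .
qed

end

section \<open>Simple processes and convergence in probability\<close>

lemma tendsto_0_of_min_1:
  fixes f :: "'b \<Rightarrow> real"
  assumes "((\<lambda>x. min 1 \<bar>f x\<bar>) \<longlongrightarrow> 0) G"
  shows "(f \<longlongrightarrow> 0) G"
proof -
  have "\<forall>\<^sub>F x in G. min 1 \<bar>f x\<bar> < 1" using assms by (rule order_tendstoD) simp
  then have "\<forall>\<^sub>F x in G. min 1 \<bar>f x\<bar> = \<bar>f x\<bar>" by eventually_elim linarith
  then have "((\<lambda>x. \<bar>f x\<bar>) \<longlongrightarrow> 0) G" by (rule Lim_transform_eventually[OF assms])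
  then show ?thesis by (rule tendsto_rabs_zero_cancel)
qed

text \<open>\<open>g\<close> agrees almost everywhere with the measurable function
  \<open>lim\<close>, and by completeness a set that differs from a measurable one by a null set is
  measurable. All limits of paths below exist only almost surely.\<close>

lemma (in complete_measure) borel_measurable_AE_limit:
  fixes f :: "nat \<Rightarrow> 'a \<Rightarrow> real"
  assumes [measurable]: "\<And>k. f k \<in> borel_measurable M"
    and lim: "AE x in M. (\<lambda>k. f k x) \<longlonglongrightarrow> g x"
  shows "g \<in> borel_measurable M"
proof -
  define h where "h x = lim (\<lambda>k. f k x)" for x
  have h: "h \<in> borel_measurable M" unfolding h_def by measurable
  have hg: "AE x in M. h x = g x" using lim by eventually_elim (simp add: h_def limI)
  show ?thesis
  proof (rule measurableI)
    fix A :: "real set" assume "A \<in> sets borel"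
    then have hA: "h -` A \<inter> space M \<in> sets M" using h by (auto intro: measurable_sets)
    have *: "AE x in M. x \<in> h -` A \<inter> space M \<longleftrightarrow> x \<in> g -` A \<inter> space M"
      using hg by eventually_elim auto
    show "g -` A \<inter> space M \<in> sets M" by (rule in_sets_AE[OF * hA]) simp
  qed auto
qed

context prob_space
begin

text \<open>The truncation is at most \<open>e\<close> plus the indicator of the event that
  \<open>Y k\<close> exceeds \<open>e\<close>. Truncated expectations are the form in which
  convergence in probability is handled from here on.\<close>

lemma tendsto_0_in_prob_expectation:
  assumes "tendsto_0_in_prob M Y"
  shows "(\<lambda>k. expectation (\<lambda>\<omega>. enn2real (min 1 (Y k \<omega>)))) \<longlonglongrightarrow> 0"
proof -
  have m[measurable]: "Y k \<in> borel_measurable M" for k using assms unfolding tendsto_0_in_prob_def by blast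
  let ?y = "\<lambda>k \<omega>. enn2real (min 1 (Y k \<omega>))"
  have y1: "?y k \<omega> \<le> 1" for k \<omega> by (rule enn2real_leI) auto
  have i: "integrable M (?y k)" for k
    using y1 by (intro integrable_const_bound[where B=1]) auto
  have bound: "expectation (?y k) \<le> e + prob {\<omega> \<in> space M. Y k \<omega> > ennreal e}" if "e > 0" for e k
  proof -
    have "?y k \<omega> \<le> e + indicator {\<omega> \<in> space M. Y k \<omega> > ennreal e} \<omega>" if "\<omega> \<in> space M" for \<omega>
    proof (cases "Y k \<omega> > ennreal e")
      case True
      then show ?thesis using y1[of k \<omega>] \<open>e > 0\<close> that by simp
    next
      case False
      then have "min 1 (Y k \<omega>) \<le> ennreal e" by (simp add: min_le_iff_disj not_less)
      then have "?y k \<omega> \<le> e" using \<open>e > 0\<close> by (intro enn2real_leI) auto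
      then show ?thesis by (simp add: indicator_def)
    qed
    moreover have iA: "integrable M (\<lambda>\<omega>. indicator {\<omega> \<in> space M. Y k \<omega> > ennreal e} \<omega> :: real)"
      by (intro integrable_real_indicator) (auto simp: emeasure_eq_measure)
    ultimately have "expectation (?y k) \<le> expectation (\<lambda>\<omega>. e + indicator {\<omega> \<in> space M. Y k \<omega> > ennreal e} \<omega>)"
      using i by (intro integral_mono) auto
    also have "\<dots> = e + expectation (indicator {\<omega> \<in> space M. Y k \<omega> > ennreal e})"
      using iA by (simp add: prob_space)
    also have "\<dots> = e + prob {\<omega> \<in> space M. Y k \<omega> > ennreal e}"
      by (auto intro!: arg_cong[where f=prob])
    finally show ?thesis .
  qed
  show ?thesis
  proof (rule LIMSEQ_I)
    fix r :: real assume r: "0 < r"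
    have "(\<lambda>k. prob {\<omega> \<in> space M. Y k \<omega> > ennreal (r/2)}) \<longlonglongrightarrow> 0"
      using assms r unfolding tendsto_0_in_prob_def by auto
    then have "\<forall>\<^sub>F k in sequentially. prob {\<omega> \<in> space M. Y k \<omega> > ennreal (r/2)} < r / 2"
      using r by (intro order_tendstoD) auto
    then obtain N where N: "\<And>k. k \<ge> N \<Longrightarrow> prob {\<omega> \<in> space M. Y k \<omega> > ennreal (r/2)} < r / 2"
      unfolding eventually_sequentially by blast
    show "\<exists>N. \<forall>k\<ge>N. norm (expectation (?y k) - 0) < r"
    proof (intro exI allI impI)
      fix k assume "k \<ge> N"
      have "0 \<le> expectation (?y k)" by simp
      then show "norm (expectation (?y k) - 0) < r"
        using bound[of "r/2" k] N[OF \<open>k \<ge> N\<close>] r by simp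
    qed
  qed
qed

lemma integrable_min_1:
  assumes "f \<in> borel_measurable M" "\<And>\<omega>. \<omega> \<in> space M \<Longrightarrow> 0 \<le> f \<omega>"
  shows "integrable M (\<lambda>\<omega>. min 1 (f \<omega>) :: real)"
  using assms by (intro integrable_const_bound[where B=1]) auto

lemma tendsto_expectation_min_1:
  fixes f :: "nat \<Rightarrow> 'a \<Rightarrow> real"
  assumes "\<And>k. f k \<in> borel_measurable M" "g \<in> borel_measurable M"
    "AE \<omega> in M. (\<lambda>k. f k \<omega>) \<longlonglongrightarrow> g \<omega>" "\<And>k \<omega>. 0 \<le> f k \<omega>"
  shows "(\<lambda>k. expectation (\<lambda>\<omega>. min 1 (f k \<omega>))) \<longlonglongrightarrow> expectation (\<lambda>\<omega>. min 1 (g \<omega>))"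
proof (rule integral_dominated_convergence[where w = "\<lambda>_. 1"])
  show "AE \<omega> in M. (\<lambda>k. min 1 (f k \<omega>)) \<longlonglongrightarrow> min 1 (g \<omega>)"
    using assms(3) by eventually_elim (intro tendsto_min tendsto_const)
qed (use assms in auto)

text \<open>Convergence of the truncations in L1 yields an almost surely convergent subsequence, and
  the truncation is harmless for the limit \<open>0\<close>. Subsequences suffice, as the limits are
  identified path by path.\<close>

lemma AE_subseq_of_expectation_min_1:
  fixes f :: "nat \<Rightarrow> 'a \<Rightarrow> real"
  assumes "\<And>k. f k \<in> borel_measurable M" "\<And>k \<omega>. 0 \<le> f k \<omega>"
    and "(\<lambda>k. expectation (\<lambda>\<omega>. min 1 (f k \<omega>))) \<longlonglongrightarrow> 0"
  obtains r :: "nat \<Rightarrow> nat" where "strict_mono r" "AE \<omega> in M. (\<lambda>k. f (r k) \<omega>) \<longlonglongrightarrow> 0"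
proof -
  have "\<exists>r::nat\<Rightarrow>nat. strict_mono r \<and> (AE \<omega> in M. (\<lambda>k. min 1 (f (r k) \<omega>)) \<longlonglongrightarrow> 0)"
    using assms by (intro tendsto_L1_AE_subseq integrable_min_1) auto
  then obtain r :: "nat \<Rightarrow> nat" where r: "strict_mono r" "AE \<omega> in M. (\<lambda>k. min 1 (f (r k) \<omega>)) \<longlonglongrightarrow> 0" by blast
  have "AE \<omega> in M. (\<lambda>k. f (r k) \<omega>) \<longlonglongrightarrow> 0"
    using r(2) by eventually_elim (rule tendsto_0_of_min_1, use assms(2) in simp)
  then show ?thesis using that r(1) by blast
qed

end

lemma indicator_consecutive:
  fixes u :: "nat \<Rightarrow> real"
  assumes "mono u" "s \<in> {u q<..u (Suc q)}"
  shows "indicator {u p<..u (Suc p)} s = (if p = q then 1 else 0 :: 'c::zero_neq_one)"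
proof -
  have "p = q" if "s \<in> {u p<..u (Suc p)}"
  proof (rule ccontr)
    assume "p \<noteq> q"
    then have "Suc p \<le> q \<or> Suc q \<le> p" by auto
    then show False using monoD[OF assms(1)] that assms(2) by fastforce
  qed
  then show ?thesis using assms(2)
    by (cases "p = q") (simp, metis indicator_simps(2))
qed

section \<open>Simple integrals on refined grids\<close>

context brownian_setting
begin

text \<open>Padding with zero coefficients makes the time grid cover \<open>[0,t]\<close>.\<close>

lemma simple_process_cover:
  assumes S: "simple_process M F S"
  obtains k \<sigma> \<kappa> where "0 < k" "mono \<sigma>" "\<sigma> 0 = 0" "t \<le> \<sigma> k"
    "\<And>i. i < k \<Longrightarrow> \<kappa> i \<in> borel_measurable (F (\<sigma> i))"
    "\<And>s \<omega>. simple_val S s \<omega> = (\<Sum>i<k. \<kappa> i \<omega> * indicator {\<sigma> i<..\<sigma> (Suc i)} s)"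
    "\<And>s \<omega>. simple_integral_wrt W S s \<omega> =
        (\<Sum>i<k. \<kappa> i \<omega> * (W (min s (\<sigma> (Suc i))) \<omega> - W (min s (\<sigma> i)) \<omega>))"
proof -
  obtain m \<tau> \<xi> where Seq: "S = (m, \<tau>, \<xi>)" by (cases S)
  from S have \<tau>0: "0 \<le> \<tau> 0" and \<tau>: "\<And>i. i < m \<Longrightarrow> \<tau> i < \<tau> (Suc i)"
    and \<xi>: "\<And>i. i < m \<Longrightarrow> \<xi> i \<in> borel_measurable (F (\<tau> i))"
    unfolding Seq simple_process_def by auto
  define \<sigma> where "\<sigma> i = (if i = 0 then 0 else if i \<le> Suc m then \<tau> (i - 1) else max t (\<tau> m))" for i
  define \<kappa> where "\<kappa> i = (if 1 \<le> i \<and> i \<le> m then \<xi> (i - 1) else (\<lambda>_. 0))" for i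
  have shift: "(\<Sum>i<m. f (Suc i)) = (\<Sum>i<Suc (Suc m). f i)" if "f 0 = 0" "f (Suc m) = 0" for f :: "nat \<Rightarrow> real"
  proof -
    have "(\<Sum>i<Suc (Suc m). f i) = f 0 + (\<Sum>i<Suc m. f (Suc i))" by (rule sum.lessThan_Suc_shift)
    then show ?thesis using that by simp
  qed
  show ?thesis
  proof (rule that[of "Suc (Suc m)" \<sigma> \<kappa>])
    show "mono \<sigma>" unfolding mono_iff_le_Suc
    proof
      fix i
      consider "i = 0" | "1 \<le> i" "i \<le> m" | "i = Suc m" | "i > Suc m" by linarith
      then show "\<sigma> i \<le> \<sigma> (Suc i)"
      proof cases
        case 2
        then have "i - 1 < m" by simp
        from \<tau>[OF this] 2 show ?thesis by (auto simp: \<sigma>_def)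
      qed (use \<tau>0 in \<open>auto simp: \<sigma>_def\<close>)
    qed
    show "\<kappa> i \<in> borel_measurable (F (\<sigma> i))" if "i < Suc (Suc m)" for i
      using \<xi>[of "i - 1"] by (auto simp: \<kappa>_def \<sigma>_def)
    show "simple_val S s \<omega> = (\<Sum>i<Suc (Suc m). \<kappa> i \<omega> * indicator {\<sigma> i<..\<sigma> (Suc i)} s)" for s \<omega>
      by (subst shift[symmetric]) (auto simp: Seq simple_val_def \<kappa>_def \<sigma>_def)
    show "simple_integral_wrt W S s \<omega> =
        (\<Sum>i<Suc (Suc m). \<kappa> i \<omega> * (W (min s (\<sigma> (Suc i))) \<omega> - W (min s (\<sigma> i)) \<omega>))" for s \<omega>
      by (subst shift[symmetric]) (auto simp: Seq simple_integral_wrt_def \<kappa>_def \<sigma>_def)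
  qed (auto simp: \<sigma>_def)
qed

text \<open>A simple integrand and coefficients frozen on a coarse grid are put on a common
  refinement. Every coarse cell receives the same number \<open>k\<close> of subcells, some of them
  empty, so that \<open>q = j * k + i\<close> enumerates them and the blocks have the shape that
  \<open>lenglart_increments\<close> expects. The free \<open>G\<close> in the last conclusion
  allows the simple integrand to be replaced by the limiting one.\<close>

lemma simple_process_refine:
  fixes r :: "nat \<Rightarrow> real" and c e :: "nat \<Rightarrow> 'a \<Rightarrow> real"
  assumes S: "simple_process M F S"
    and r: "mono r" "0 \<le> r 0" "r n \<le> t"
    and ce: "\<And>j. j < n \<Longrightarrow> c j \<in> borel_measurable (F (r j))" "\<And>j. j < n \<Longrightarrow> e j \<in> borel_measurable (F (r j))"
  obtains u \<phi> k where "mono u" "0 \<le> u 0" "\<And>q. q < n * k \<Longrightarrow> \<phi> q \<in> borel_measurable (F (u q))"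
    "\<And>j \<omega>. j < n \<Longrightarrow> (\<Sum>q\<in>{j*k..<j*k+k}. \<phi> q \<omega> * (W (u (Suc q)) \<omega> - W (u q) \<omega>)) =
       c j \<omega> * (simple_integral_wrt W S (r (Suc j)) \<omega> - simple_integral_wrt W S (r j) \<omega>)
       - e j \<omega> * (W (r (Suc j)) \<omega> - W (r j) \<omega>)"
    "\<And>\<omega> G. (\<And>j s. j < n \<Longrightarrow> s \<in> {r j<..r (Suc j)} \<Longrightarrow>
         ennreal ((c j \<omega> * simple_val S s \<omega> - e j \<omega>)\<^sup>2) \<le> G s) \<Longrightarrow>
       ennreal (\<Sum>q<n*k. (\<phi> q \<omega>)\<^sup>2 * (u (Suc q) - u q)) \<le> (\<integral>\<^sup>+s\<in>{0..t}. G s \<partial>lborel)"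
proof -
  obtain k \<sigma> \<kappa> where k: "0 < k" and \<sigma>: "mono \<sigma>" "\<sigma> 0 = 0" "t \<le> \<sigma> k"
    and \<kappa>: "\<And>i. i < k \<Longrightarrow> \<kappa> i \<in> borel_measurable (F (\<sigma> i))"
    and val: "\<And>s \<omega>. simple_val S s \<omega> = (\<Sum>i<k. \<kappa> i \<omega> * indicator {\<sigma> i<..\<sigma> (Suc i)} s)"
    and int: "\<And>s \<omega>. simple_integral_wrt W S s \<omega> =
        (\<Sum>i<k. \<kappa> i \<omega> * (W (min s (\<sigma> (Suc i))) \<omega> - W (min s (\<sigma> i)) \<omega>))"
    by (rule simple_process_cover[OF S, of t], rule that)
  \<comment> \<open>Clips a point of the partition \<open>\<sigma>\<close> to the coarse cell
    \<open>{r j..r (Suc j)}\<close>.\<close>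
  define cl where "cl j x = max (r j) (min (r (Suc j)) x)" for j x
  define u where "u q = cl (q div k) (\<sigma> (q mod k))" for q
  \<comment> \<open>If \<open>\<sigma> i\<close> is not to the left of the end of the coarse cell,
    the subcell is empty, but \<open>\<kappa> i\<close> may become known only after that cell.
    Putting \<open>0\<close> for it keeps \<open>\<phi>\<close> adapted and changes no sum.\<close>
  define \<phi> where "\<phi> q \<omega> = c (q div k) \<omega> * (if \<sigma> (q mod k) < r (Suc (q div k)) then \<kappa> (q mod k) \<omega> else 0) - e (q div k) \<omega>" for q \<omega>
  have r0: "0 \<le> r j" for j using r(2) monoD[OF r(1), of 0 j] by simp
  have rs: "r j \<le> r (Suc j)" for j using monoD[OF r(1)] by simp
  have cl0: "cl j (\<sigma> 0) = r j" for j using r0[of j] \<sigma>(2) rs[of j] by (simp add: cl_def)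
  have clk: "cl j (\<sigma> k) = r (Suc j)" if "j < n" for j
    using rs[of j] \<sigma>(3) r(3) monoD[OF r(1), of "Suc j" n] that by (simp add: cl_def)
  have uSuc: "u (Suc q) = cl (q div k) (\<sigma> (Suc (q mod k)))" if "q < n * k" for q
  proof -
    have "q div k < n" using that by (simp add: less_mult_imp_div_less)
    then show ?thesis using k clk cl0 by (auto simp: u_def div_Suc mod_Suc)
  qed
  have mono_u: "mono u" unfolding mono_iff_le_Suc
  proof
    fix q
    show "u q \<le> u (Suc q)"
    proof (cases "Suc (q mod k) = k")
      case True
      then have "Suc q div k = Suc (q div k)" "Suc q mod k = 0" by (auto simp: div_Suc mod_Suc)
      then have "u (Suc q) = r (Suc (q div k))" by (simp add: u_def cl0)
      then show ?thesis using rs by (simp add: u_def cl_def)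
    next
      case False
      then have "Suc q div k = q div k" "Suc q mod k = Suc (q mod k)" by (auto simp: div_Suc mod_Suc)
      moreover have "\<sigma> (q mod k) \<le> \<sigma> (Suc (q mod k))" using monoD[OF \<sigma>(1)] by simp
      ultimately show ?thesis by (auto simp: u_def cl_def)
    qed
  qed
  have div: "q div k < n" "q mod k < k" if "q < n * k" for q
    using that k by (auto simp: less_mult_imp_div_less)
  have ru: "r (q div k) \<le> u q" for q by (simp add: u_def cl_def)
  have m\<phi>: "\<phi> q \<in> borel_measurable (F (u q))" if "q < n * k" for q
  proof -
    have [measurable]: "c (q div k) \<in> borel_measurable (F (u q))" "e (q div k) \<in> borel_measurable (F (u q))"
      using ce[OF div(1)[OF that]] measurable_F_mono ru by blast+
    show ?thesis
    proof (cases "\<sigma> (q mod k) < r (Suc (q div k))")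
      case True
      then have "\<sigma> (q mod k) \<le> u q" by (simp add: u_def cl_def)
      then have [measurable]: "\<kappa> (q mod k) \<in> borel_measurable (F (u q))"
        using \<kappa>[OF div(2)[OF that]] measurable_F_mono by blast
      have "\<phi> q = (\<lambda>\<omega>. c (q div k) \<omega> * \<kappa> (q mod k) \<omega> - e (q div k) \<omega>)"
        using True by (simp add: \<phi>_def fun_eq_iff)
      then show ?thesis by simp
    next
      case False
      then have "\<phi> q = (\<lambda>\<omega>. - e (q div k) \<omega>)" by (simp add: \<phi>_def fun_eq_iff)
      then show ?thesis by simp
    qed
  qed
  have block: "(\<Sum>q\<in>{j*k..<j*k+k}. \<phi> q \<omega> * (W (u (Suc q)) \<omega> - W (u q) \<omega>)) =
       c j \<omega> * (simple_integral_wrt W S (r (Suc j)) \<omega> - simple_integral_wrt W S (r j) \<omega>)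
       - e j \<omega> * (W (r (Suc j)) \<omega> - W (r j) \<omega>)" if j: "j < n" for j \<omega>
  proof -
    define w where "w i = W (cl j (\<sigma> i)) \<omega>" for i
    have *: "\<phi> (j*k+i) \<omega> * (W (u (Suc (j*k+i))) \<omega> - W (u (j*k+i)) \<omega>) =
       c j \<omega> * (\<kappa> i \<omega> * (w (Suc i) - w i)) - e j \<omega> * (w (Suc i) - w i)" if i: "i < k" for i
    proof -
      have dm: "(j*k+i) div k = j" "(j*k+i) mod k = i" using i by auto
      have "j*k+i < Suc j * k" using i by simp
      also have "\<dots> \<le> n * k" using j by (intro mult_right_mono) auto
      finally have 1: "W (u (Suc (j*k+i))) \<omega> - W (u (j*k+i)) \<omega> = w (Suc i) - w i"
        using uSuc[of "j*k+i"] dm by (simp only: w_def u_def)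
      have 2: "w (Suc i) - w i = 0" if "\<not> \<sigma> i < r (Suc j)"
      proof -
        have "\<sigma> i \<le> \<sigma> (Suc i)" using monoD[OF \<sigma>(1)] by simp
        then have "cl j (\<sigma> (Suc i)) = cl j (\<sigma> i)" using that by (simp add: cl_def)
        then show ?thesis by (simp add: w_def)
      qed
      have 3: "\<phi> (j*k+i) \<omega> = c j \<omega> * (if \<sigma> i < r (Suc j) then \<kappa> i \<omega> else 0) - e j \<omega>"
        unfolding \<phi>_def dm ..
      show ?thesis unfolding 1 3 using 2 by (simp add: left_diff_distrib mult.assoc)
    qed
    have "{j*k..<j*k+k} = {0+j*k..<k+j*k}" by (simp add: add.commute)
    then have "(\<Sum>q\<in>{j*k..<j*k+k}. \<phi> q \<omega> * (W (u (Suc q)) \<omega> - W (u q) \<omega>)) =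
      (\<Sum>i\<in>{0..<k}. \<phi> (i + j*k) \<omega> * (W (u (Suc (i + j*k))) \<omega> - W (u (i + j*k)) \<omega>))"
      by (simp only: sum.shift_bounds_nat_ivl)
    also have "\<dots> = (\<Sum>i<k. c j \<omega> * (\<kappa> i \<omega> * (w (Suc i) - w i)) - e j \<omega> * (w (Suc i) - w i))"
      using * by (intro sum.cong) (auto simp: add.commute)
    also have "\<dots> = c j \<omega> * (\<Sum>i<k. \<kappa> i \<omega> * (w (Suc i) - w i)) - e j \<omega> * (\<Sum>i<k. w (Suc i) - w i)"
      by (subst sum_subtractf) (simp only: sum_distrib_left)
    also have "(\<Sum>i<k. w (Suc i) - w i) = W (r (Suc j)) \<omega> - W (r j) \<omega>"
      unfolding sum_lessThan_telescope by (simp add: w_def clk[OF j] cl0)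
    also have "(\<Sum>i<k. \<kappa> i \<omega> * (w (Suc i) - w i)) =
      simple_integral_wrt W S (r (Suc j)) \<omega> - simple_integral_wrt W S (r j) \<omega>"
    proof -
      \<comment> \<open>The difference of stopping at the two ends of the cell amounts to clipping;
        the constant \<open>W (r j)\<close> drops out of consecutive differences.\<close>
      have "W (min (r (Suc j)) x) \<omega> - W (min (r j) x) \<omega> = W (cl j x) \<omega> - W (r j) \<omega>" for x
        using rs[of j] by (cases "x \<le> r j"; cases "x \<le> r (Suc j)") (auto simp: cl_def min_def max_def)
      then have "W (min (r (Suc j)) x) \<omega> = W (cl j x) \<omega> - W (r j) \<omega> + W (min (r j) x) \<omega>" for x
        by (smt (verit))
      then show ?thesis unfolding int
        by (simp add: w_def sum_subtractf[symmetric] right_diff_distrib[symmetric])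
    qed
    finally show ?thesis .
  qed
  have energy: "ennreal (\<Sum>q<n*k. (\<phi> q \<omega>)\<^sup>2 * (u (Suc q) - u q)) \<le> (\<integral>\<^sup>+s\<in>{0..t}. G s \<partial>lborel)"
    if G: "\<And>j s. j < n \<Longrightarrow> s \<in> {r j<..r (Suc j)} \<Longrightarrow> ennreal ((c j \<omega> * simple_val S s \<omega> - e j \<omega>)\<^sup>2) \<le> G s" for \<omega> G
  proof -
    have us: "u q \<le> u (Suc q)" for q using monoD[OF mono_u] by simp
    have "ennreal (\<Sum>q<n*k. (\<phi> q \<omega>)\<^sup>2 * (u (Suc q) - u q)) =
      (\<Sum>q<n*k. ennreal ((\<phi> q \<omega>)\<^sup>2) * ennreal (u (Suc q) - u q))"
      using us by (subst sum_ennreal[symmetric]) (auto simp: ennreal_mult)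
    also have "\<dots> = (\<Sum>q<n*k. \<integral>\<^sup>+s. ennreal ((\<phi> q \<omega>)\<^sup>2) * indicator {u q<..u (Suc q)} s \<partial>lborel)"
      using us by (intro sum.cong) (auto simp: nn_integral_cmult_indicator)
    also have "\<dots> = (\<integral>\<^sup>+s. (\<Sum>q<n*k. ennreal ((\<phi> q \<omega>)\<^sup>2) * indicator {u q<..u (Suc q)} s) \<partial>lborel)"
      by (rule nn_integral_sum[symmetric]) auto
    also have "\<dots> \<le> (\<integral>\<^sup>+s\<in>{0..t}. G s \<partial>lborel)"
    proof (rule nn_integral_mono)
      fix s
      show "(\<Sum>q<n*k. ennreal ((\<phi> q \<omega>)\<^sup>2) * indicator {u q<..u (Suc q)} s) \<le> G s * indicator {0..t} s"
      proof (cases "\<exists>q<n*k. s \<in> {u q<..u (Suc q)}")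
        case False
        then have "(\<Sum>q<n*k. ennreal ((\<phi> q \<omega>)\<^sup>2) * indicator {u q<..u (Suc q)} s) = 0"
          by (intro sum.neutral) auto
        then show ?thesis by simp
      next
        case True
        then obtain q where q: "q < n * k" "s \<in> {u q<..u (Suc q)}" by blast
        define j i where "j = q div k" and "i = q mod k"
        have ji: "j < n" "i < k" using div[OF q(1)] by (auto simp: j_def i_def)
        have s1: "cl j (\<sigma> i) < s" "s \<le> cl j (\<sigma> (Suc i))"
          using q(2) uSuc[OF q(1)] by (auto simp: u_def j_def i_def)
        have rn: "r (Suc j) \<le> t" using r(3) monoD[OF r(1), of "Suc j" n] ji by simp
        have s2: "r j < s" "s \<le> r (Suc j)" using s1 rs[of j] by (auto simp: cl_def)
        have s3: "s \<in> {\<sigma> i<..\<sigma> (Suc i)}" "\<sigma> i < r (Suc j)" using s1 s2 by (auto simp: cl_def)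
        have "simple_val S s \<omega> = (\<Sum>l<k. if l = i then \<kappa> i \<omega> else 0)"
          unfolding val using indicator_consecutive[OF \<sigma>(1) s3(1), where ?'c = real] by (intro sum.cong) auto
        then have v: "simple_val S s \<omega> = \<kappa> i \<omega>" using ji by simp
        have "(\<Sum>q<n*k. ennreal ((\<phi> q \<omega>)\<^sup>2) * indicator {u q<..u (Suc q)} s) =
          (\<Sum>l<n*k. if l = q then ennreal ((\<phi> q \<omega>)\<^sup>2) else 0)"
          using indicator_consecutive[OF mono_u q(2), where ?'c = ennreal] by (intro sum.cong) auto
        also have "\<dots> = ennreal ((\<phi> q \<omega>)\<^sup>2)" using q(1) by simp
        also have "\<phi> q \<omega> = c j \<omega> * simple_val S s \<omega> - e j \<omega>"
          using s3 v by (simp add: \<phi>_def j_def i_def)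
        also have "ennreal (\<dots>\<^sup>2) \<le> G s" using G[OF ji(1)] s2 by simp
        finally show ?thesis using s2 r0[of j] rn by (simp add: indicator_def)
      qed
    qed
    finally show ?thesis .
  qed
  show ?thesis
    using that[OF mono_u _ m\<phi> block energy] cl0[of 0] r(2) by (simp add: u_def)
qed

end

section \<open>Lenglart bound for the Ito integral\<close>

context brownian_setting
begin

lemma nn_integral_linear:
  fixes a b :: ennreal
  assumes "f \<in> borel_measurable N" "g \<in> borel_measurable N"
  shows "(\<integral>\<^sup>+x. a * f x + b * g x \<partial>N) = a * (\<integral>\<^sup>+x. f x \<partial>N) + b * (\<integral>\<^sup>+x. g x \<partial>N)"
  using assms by (simp add: nn_integral_add nn_integral_cmult)

lemma min_1_add_le: "0 \<le> a \<Longrightarrow> 0 \<le> b \<Longrightarrow> min 1 (a + b) \<le> min 1 a + min 1 (b::real)"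
  by (auto simp: min_def)

text \<open>\<open>lenglart_increments\<close> passes from the approximating simple integrands to
  the limit. One factor 2 is its own, the other comes from
  \<open>(a + b)\<^sup>2 \<le> 2 * a\<^sup>2 + 2 * b\<^sup>2\<close> when the simple integrand is
  replaced by \<open>H\<close>. The two conclusions read the same refined grid as a single block and
  as \<open>n\<close> blocks.\<close>

lemma ito_lenglart:
  fixes r :: "nat \<Rightarrow> real" and c e :: "nat \<Rightarrow> 'a \<Rightarrow> real"
  assumes I: "ito_integral M F W H I"
    and contH: "AE \<omega> in M. continuous_on {0..} (\<lambda>s. H s \<omega>)"
    and r: "mono r" "0 \<le> r 0" "r n \<le> t" "0 < t"
    and ce: "\<And>j. j < n \<Longrightarrow> c j \<in> borel_measurable (F (r j))" "\<And>j. j < n \<Longrightarrow> e j \<in> borel_measurable (F (r j))"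
    and C: "\<And>j \<omega>. j < n \<Longrightarrow> \<bar>c j \<omega>\<bar> \<le> C"
    and V: "V \<in> borel_measurable M" "\<And>\<omega>. 0 \<le> V \<omega>"
    and energy: "AE \<omega> in M. (\<integral>\<^sup>+s. (\<Sum>j<n. ennreal ((c j \<omega> * H s \<omega> - e j \<omega>)\<^sup>2) * indicator {r j<..r (Suc j)} s) \<partial>lborel) \<le> ennreal (V \<omega>)"
  shows "expectation (\<lambda>\<omega>. min 1 ((\<Sum>j<n. c j \<omega> * (I (r (Suc j)) \<omega> - I (r j) \<omega>) - e j \<omega> * (W (r (Suc j)) \<omega> - W (r j) \<omega>))\<^sup>2))
      \<le> 4 * expectation (\<lambda>\<omega>. min 1 (V \<omega>))" (is ?total)
    and "expectation (\<lambda>\<omega>. min 1 (\<Sum>j<n. (c j \<omega> * (I (r (Suc j)) \<omega> - I (r j) \<omega>) - e j \<omega> * (W (r (Suc j)) \<omega> - W (r j) \<omega>))\<^sup>2))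
      \<le> 4 * expectation (\<lambda>\<omega>. min 1 (V \<omega>))" (is ?blocks)
proof -
  from I obtain S where S: "\<And>k. simple_process M F (S k)"
    and US: "tendsto_0_in_prob M (\<lambda>k \<omega>. \<integral>\<^sup>+s\<in>{0..t}. ennreal ((simple_val (S k) s \<omega> - H s \<omega>)\<^sup>2) \<partial>lborel)"
    and ZS: "tendsto_0_in_prob M (\<lambda>k \<omega>. SUP s\<in>{0..t}. ennreal \<bar>simple_integral_wrt W (S k) s \<omega> - I s \<omega>\<bar>)"
    unfolding ito_integral_def using r(4) by blast
  have mI: "0 \<le> s \<Longrightarrow> I s \<in> borel_measurable M" for s
    using I measurable_F_M unfolding ito_integral_def adapted_def by blast
  define U where "U k \<omega> = (\<integral>\<^sup>+s\<in>{0..t}. ennreal ((simple_val (S k) s \<omega> - H s \<omega>)\<^sup>2) \<partial>lborel)" for k \<omega>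
  define Z where "Z k \<omega> = (SUP s\<in>{0..t}. ennreal \<bar>simple_integral_wrt W (S k) s \<omega> - I s \<omega>\<bar>)" for k \<omega>
  have mU[measurable]: "U k \<in> borel_measurable M" and mZ[measurable]: "Z k \<in> borel_measurable M" for k
    using US ZS unfolding tendsto_0_in_prob_def U_def Z_def by blast+
  have r0: "0 \<le> r j" for j using r(2) monoD[OF r(1), of 0 j] by simp
  have rs: "r j \<le> r (Suc j)" for j using monoD[OF r(1)] by simp
  have rt: "j \<le> n \<Longrightarrow> r j \<le> t" for j using r(3) monoD[OF r(1), of j n] by simp
  have mW: "W (r j) \<in> borel_measurable M" for j using r0 W_measurable by blast
  have mce: "j < n \<Longrightarrow> c j \<in> borel_measurable M" "j < n \<Longrightarrow> e j \<in> borel_measurable M" for j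
    using ce measurable_F_M by blast+
  define z where "z k \<omega> = enn2real (min 1 (Z k \<omega>))" for k \<omega>
  have Ez: "(\<lambda>k. expectation (z k)) \<longlonglongrightarrow> 0"
    using tendsto_0_in_prob_expectation[OF ZS] unfolding z_def Z_def .
  \<comment> \<open>Error of the replacement. The \<open>max 1\<close> makes \<open>w\<close> at
    least 1 when \<open>U\<close> is, where the truncated inequality \<open>Ebound\<close> is then
    trivial; otherwise \<open>w\<close> dominates \<open>2 * C\<^sup>2\<close> times
    \<open>U\<close>.\<close>
  define w where "w k \<omega> = max 1 (2 * C\<^sup>2) * enn2real (min 1 (U k \<omega>))" for k \<omega>
  have "(\<lambda>k. max 1 (2 * C\<^sup>2) * expectation (\<lambda>\<omega>. enn2real (min 1 (U k \<omega>)))) \<longlonglongrightarrow> max 1 (2 * C\<^sup>2) * 0"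
    using tendsto_0_in_prob_expectation[OF US] unfolding U_def by (rule tendsto_mult_left)
  then have Ew: "(\<lambda>k. expectation (w k)) \<longlonglongrightarrow> 0" unfolding w_def by simp
  have z1: "0 \<le> z k \<omega>" "z k \<omega> \<le> 1" for k \<omega> unfolding z_def by (auto intro!: enn2real_leI)
  have iw: "integrable M (w k)" for k
    unfolding w_def
    by (intro integrable_mult_right integrable_const_bound[where B=1]) (auto intro!: enn2real_leI)
  have iz: "integrable M (z k)" for k
  proof -
    have "z k \<in> borel_measurable M" unfolding z_def[abs_def] by measurable
    then show ?thesis using z1 by (intro integrable_const_bound[where B=1]) auto
  qed
  obtain \<rho> :: "nat \<Rightarrow> nat" where \<rho>: "strict_mono \<rho>" "AE \<omega> in M. (\<lambda>k. z (\<rho> k) \<omega>) \<longlonglongrightarrow> 0"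
    using tendsto_L1_AE_subseq[of M z] iz Ez z1 by auto
  \<comment> \<open>Bundles the conclusions of the refinement so that \<open>u\<close>,
    \<open>\<phi>\<close> and \<open>l\<close> can be chosen for all \<open>k\<close> at
    once.\<close>
  define R where "R k u \<phi> l \<longleftrightarrow> mono u \<and> 0 \<le> u 0 \<and> (\<forall>q<n*l. \<phi> q \<in> borel_measurable (F (u q))) \<and>
    (\<forall>j \<omega>. j < n \<longrightarrow> (\<Sum>q\<in>{j*l..<j*l+l}. \<phi> q \<omega> * (W (u (Suc q)) \<omega> - W (u q) \<omega>)) =
       c j \<omega> * (simple_integral_wrt W (S k) (r (Suc j)) \<omega> - simple_integral_wrt W (S k) (r j) \<omega>)
       - e j \<omega> * (W (r (Suc j)) \<omega> - W (r j) \<omega>)) \<and>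
    (\<forall>\<omega> G. (\<forall>j s. j < n \<longrightarrow> s \<in> {r j<..r (Suc j)} \<longrightarrow>
         ennreal ((c j \<omega> * simple_val (S k) s \<omega> - e j \<omega>)\<^sup>2) \<le> G s) \<longrightarrow>
       ennreal (\<Sum>q<n*l. (\<phi> q \<omega>)\<^sup>2 * (u (Suc q) - u q)) \<le> (\<integral>\<^sup>+s\<in>{0..t}. G s \<partial>lborel))"
    for k and u :: "nat \<Rightarrow> real" and \<phi> :: "nat \<Rightarrow> 'a \<Rightarrow> real" and l :: nat
  have "\<exists>u \<phi> l. R k u \<phi> l" for k
    unfolding R_def
    by (rule simple_process_refine[OF S[of k] r(1-3) ce], assumption, assumption) blast
  then obtain u \<phi> l where R: "\<And>k. R k (u k) (\<phi> k) (l k)" by metis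
  have u: "\<And>k. mono (u k)" "\<And>k. 0 \<le> u k (0::nat)"
    and \<phi>: "\<And>k q. q < n * l k \<Longrightarrow> \<phi> k q \<in> borel_measurable (F (u k q))"
    and blk: "\<And>k j \<omega>. j < n \<Longrightarrow> (\<Sum>q\<in>{j*l k..<j*l k+l k}. \<phi> k q \<omega> * (W (u k (Suc q)) \<omega> - W (u k q) \<omega>)) =
       c j \<omega> * (simple_integral_wrt W (S k) (r (Suc j)) \<omega> - simple_integral_wrt W (S k) (r j) \<omega>)
       - e j \<omega> * (W (r (Suc j)) \<omega> - W (r j) \<omega>)"
    and en: "\<And>k \<omega> G. (\<And>j s. j < n \<Longrightarrow> s \<in> {r j<..r (Suc j)} \<Longrightarrow>
         ennreal ((c j \<omega> * simple_val (S k) s \<omega> - e j \<omega>)\<^sup>2) \<le> G s) \<Longrightarrow>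
       ennreal (\<Sum>q<n*l k. (\<phi> k q \<omega>)\<^sup>2 * (u k (Suc q) - u k q)) \<le> (\<integral>\<^sup>+s\<in>{0..t}. G s \<partial>lborel)"
    using R unfolding R_def by blast+
  define E where "E k \<omega> = (\<Sum>q<n*l k. (\<phi> k q \<omega>)\<^sup>2 * (u k (Suc q) - u k q))" for k \<omega>
  have us: "u k q \<le> u k (Suc q)" for k q using monoD[OF u(1)] by simp
  have E0: "0 \<le> E k \<omega>" for k \<omega> unfolding E_def using us by (auto intro!: sum_nonneg)
  have m\<phi>: "q < n * l k \<Longrightarrow> \<phi> k q \<in> borel_measurable M" for k q using \<phi> measurable_F_M by blast
  have mE: "E k \<in> borel_measurable M" for k
    unfolding E_def using m\<phi> by (intro borel_measurable_sum borel_measurable_times borel_measurable_power) auto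
  have Ebound: "AE \<omega> in M. min 1 (E k \<omega>) \<le> 2 * min 1 (V \<omega>) + w k \<omega>" for k
    using energy contH
  proof eventually_elim
    fix \<omega> assume en1: "(\<integral>\<^sup>+s. (\<Sum>j<n. ennreal ((c j \<omega> * H s \<omega> - e j \<omega>)\<^sup>2) * indicator {r j<..r (Suc j)} s) \<partial>lborel) \<le> ennreal (V \<omega>)"
      and cont: "continuous_on {0..} (\<lambda>s. H s \<omega>)"
    \<comment> \<open>Continuity of the path is known for non-negative times only; cutting it off
      outside \<open>{0..t}\<close> gives a Borel function on the line, as needed to split the
      integral.\<close>
    have "(\<lambda>s. indicator {0..t} s *\<^sub>R H s \<omega>) \<in> borel_measurable borel"
      using cont by (intro borel_measurable_continuous_on_indicator) (auto intro: continuous_on_subset)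
    then have mH[measurable]: "(\<lambda>s. indicator {0..t} s * H s \<omega>) \<in> borel_measurable borel" by simp
    define G where "G s = 2 * (\<Sum>j<n. ennreal ((c j \<omega> * H s \<omega> - e j \<omega>)\<^sup>2) * indicator {r j<..r (Suc j)} s)
       + ennreal (2 * C\<^sup>2) * ennreal ((simple_val (S k) s \<omega> - H s \<omega>)\<^sup>2)" for s
    have "ennreal (E k \<omega>) \<le> (\<integral>\<^sup>+s\<in>{0..t}. G s \<partial>lborel)"
      unfolding E_def
    proof (rule en)
      fix j s assume j: "j < n" "s \<in> {r j<..r (Suc j)}"
      have ab: "(a + b)\<^sup>2 \<le> 2 * a\<^sup>2 + 2 * b\<^sup>2" for a b :: real
        using sum_squares_bound[of a b] by (simp add: power2_sum)
      have "(c j \<omega>)\<^sup>2 \<le> C\<^sup>2" using C[OF j(1), of \<omega>] by (simp add: power2_le_iff_abs_le order.trans[OF abs_ge_zero])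
      then have "2 * ((c j \<omega>)\<^sup>2 * (simple_val (S k) s \<omega> - H s \<omega>)\<^sup>2) \<le> 2 * C\<^sup>2 * (simple_val (S k) s \<omega> - H s \<omega>)\<^sup>2"
        by (simp add: mult_right_mono)
      note that = this
      have "(c j \<omega> * simple_val (S k) s \<omega> - e j \<omega>)\<^sup>2 \<le>
        2 * (c j \<omega> * H s \<omega> - e j \<omega>)\<^sup>2 + 2 * C\<^sup>2 * (simple_val (S k) s \<omega> - H s \<omega>)\<^sup>2"
      proof -
        have "c j \<omega> * simple_val (S k) s \<omega> - e j \<omega> =
          (c j \<omega> * H s \<omega> - e j \<omega>) + c j \<omega> * (simple_val (S k) s \<omega> - H s \<omega>)"
          by (simp add: algebra_simps)
        then have "(c j \<omega> * simple_val (S k) s \<omega> - e j \<omega>)\<^sup>2 \<le>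
          2 * (c j \<omega> * H s \<omega> - e j \<omega>)\<^sup>2 + 2 * (c j \<omega> * (simple_val (S k) s \<omega> - H s \<omega>))\<^sup>2"
          using ab by presburger
        with that show ?thesis unfolding power_mult_distrib by linarith
      qed
      then have "ennreal ((c j \<omega> * simple_val (S k) s \<omega> - e j \<omega>)\<^sup>2) \<le>
        2 * ennreal ((c j \<omega> * H s \<omega> - e j \<omega>)\<^sup>2) + ennreal (2 * C\<^sup>2) * ennreal ((simple_val (S k) s \<omega> - H s \<omega>)\<^sup>2)"
        by (subst (asm) ennreal_le_iff[symmetric]) (auto simp: ennreal_plus ennreal_mult)
      moreover have "(\<Sum>l<n. ennreal ((c l \<omega> * H s \<omega> - e l \<omega>)\<^sup>2) * indicator {r l<..r (Suc l)} s) =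
        (\<Sum>l<n. if l = j then ennreal ((c j \<omega> * H s \<omega> - e j \<omega>)\<^sup>2) else 0)"
        using indicator_consecutive[OF r(1) j(2), where ?'c = ennreal] by (intro sum.cong) auto
      ultimately show "ennreal ((c j \<omega> * simple_val (S k) s \<omega> - e j \<omega>)\<^sup>2) \<le> G s"
        using j(1) by (simp add: G_def)
    qed
    also have "\<dots> = (\<integral>\<^sup>+s. 2 * (\<Sum>j<n. ennreal ((c j \<omega> * (indicator {0..t} s * H s \<omega>) - e j \<omega>)\<^sup>2) * indicator {r j<..r (Suc j)} s)
       + ennreal (2 * C\<^sup>2) * (ennreal ((simple_val (S k) s \<omega> - indicator {0..t} s * H s \<omega>)\<^sup>2) * indicator {0..t} s) \<partial>lborel)"
    proof (rule nn_integral_cong)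
      fix s
      show "G s * indicator {0..t} s = 2 * (\<Sum>j<n. ennreal ((c j \<omega> * (indicator {0..t} s * H s \<omega>) - e j \<omega>)\<^sup>2) * indicator {r j<..r (Suc j)} s)
       + ennreal (2 * C\<^sup>2) * (ennreal ((simple_val (S k) s \<omega> - indicator {0..t} s * H s \<omega>)\<^sup>2) * indicator {0..t} s)"
      proof (cases "s \<in> {0..t}")
        case False
        have "indicator {r j<..r (Suc j)} s = (0::ennreal)" if "j < n" for j
          using False r0[of j] rt[of "Suc j"] that by (auto simp: indicator_def)
        then show ?thesis using False by simp
      qed (simp add: G_def)
    qed
    also have "\<dots> = 2 * (\<integral>\<^sup>+s. (\<Sum>j<n. ennreal ((c j \<omega> * (indicator {0..t} s * H s \<omega>) - e j \<omega>)\<^sup>2) * indicator {r j<..r (Suc j)} s) \<partial>lborel)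
       + ennreal (2 * C\<^sup>2) * (\<integral>\<^sup>+s. ennreal ((simple_val (S k) s \<omega> - indicator {0..t} s * H s \<omega>)\<^sup>2) * indicator {0..t} s \<partial>lborel)"
    proof -
      have [measurable]: "(\<lambda>s. simple_val (S k) s \<omega>) \<in> borel_measurable borel"
      proof (cases "S k")
        case (fields m \<tau> \<xi>)
        show ?thesis unfolding fields simple_val_def prod.case by measurable
      qed
      show ?thesis by (rule nn_integral_linear) measurable
    qed
    also have "(\<integral>\<^sup>+s. (\<Sum>j<n. ennreal ((c j \<omega> * (indicator {0..t} s * H s \<omega>) - e j \<omega>)\<^sup>2) * indicator {r j<..r (Suc j)} s) \<partial>lborel)
       \<le> ennreal (V \<omega>)"
    proof (rule order.trans[OF nn_integral_mono en1])
      fix s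
      show "(\<Sum>j<n. ennreal ((c j \<omega> * (indicator {0..t} s * H s \<omega>) - e j \<omega>)\<^sup>2) * indicator {r j<..r (Suc j)} s)
        \<le> (\<Sum>j<n. ennreal ((c j \<omega> * H s \<omega> - e j \<omega>)\<^sup>2) * indicator {r j<..r (Suc j)} s)"
      proof (rule sum_mono)
        fix j assume "j \<in> {..<n}"
        then show "ennreal ((c j \<omega> * (indicator {0..t} s * H s \<omega>) - e j \<omega>)\<^sup>2) * indicator {r j<..r (Suc j)} s
          \<le> ennreal ((c j \<omega> * H s \<omega> - e j \<omega>)\<^sup>2) * indicator {r j<..r (Suc j)} s"
          using r0[of j] rt[of "Suc j"] by (cases "s \<in> {r j<..r (Suc j)}") auto
      qed
    qed
    also have "(\<integral>\<^sup>+s. ennreal ((simple_val (S k) s \<omega> - indicator {0..t} s * H s \<omega>)\<^sup>2) * indicator {0..t} s \<partial>lborel) = U k \<omega>"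
      unfolding U_def by (intro nn_integral_cong) (simp split: split_indicator)
    finally have le: "ennreal (E k \<omega>) \<le> 2 * ennreal (V \<omega>) + ennreal (2 * C\<^sup>2) * U k \<omega>"
      by (simp add: add_right_mono mult_left_mono)
    show "min 1 (E k \<omega>) \<le> 2 * min 1 (V \<omega>) + w k \<omega>"
    proof (cases "1 \<le> U k \<omega>")
      case True
      then have "w k \<omega> = max 1 (2 * C\<^sup>2)" by (simp add: w_def min_absorb1)
      then show ?thesis using V(2)[of \<omega>] by simp
    next
      case False
      then obtain y where y: "U k \<omega> = ennreal y" "0 \<le> y" "y < 1"
        by (cases "U k \<omega>") auto
      have "ennreal (E k \<omega>) \<le> ennreal (2 * V \<omega> + 2 * C\<^sup>2 * y)"
        using le y V(2)[of \<omega>] by (simp add: ennreal_mult ennreal_plus)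
      moreover have "0 \<le> 2 * V \<omega> + 2 * C\<^sup>2 * y" using y V(2)[of \<omega>] by simp
      ultimately have "E k \<omega> \<le> 2 * V \<omega> + 2 * C\<^sup>2 * y" by (rule ennreal_le_iff[THEN iffD1, rotated])
      moreover have "2 * C\<^sup>2 * y \<le> max 1 (2 * C\<^sup>2) * y" using y by (intro mult_right_mono) auto
      moreover have "w k \<omega> = max 1 (2 * C\<^sup>2) * y" using y by (simp add: w_def min_absorb2 less_imp_le)
      moreover have "0 \<le> max 1 (2 * C\<^sup>2) * y" using y by simp
      ultimately show ?thesis using V(2)[of \<omega>] by linarith
    qed
  qed
  have EE: "expectation (\<lambda>\<omega>. min 1 (E k \<omega>)) \<le> 2 * expectation (\<lambda>\<omega>. min 1 (V \<omega>)) + expectation (w k)" for k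
  proof -
    have iV: "integrable M (\<lambda>\<omega>. min 1 (V \<omega>))" using integrable_min_1 V by blast
    have "expectation (\<lambda>\<omega>. min 1 (E k \<omega>)) \<le> expectation (\<lambda>\<omega>. 2 * min 1 (V \<omega>) + w k \<omega>)"
      using Ebound iV iw integrable_min_1[OF mE] E0 by (intro integral_mono_AE) auto
    then show ?thesis using iV iw by simp
  qed
  define Q where "Q k j \<omega> = c j \<omega> * (simple_integral_wrt W (S k) (r (Suc j)) \<omega> - simple_integral_wrt W (S k) (r j) \<omega>)
       - e j \<omega> * (W (r (Suc j)) \<omega> - W (r j) \<omega>)" for k j \<omega>
  define P where "P j \<omega> = c j \<omega> * (I (r (Suc j)) \<omega> - I (r j) \<omega>) - e j \<omega> * (W (r (Suc j)) \<omega> - W (r j) \<omega>)" for j \<omega>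
  have mP: "P j \<in> borel_measurable M" if "j < n" for j
    unfolding P_def using mI r0 mW mce that
    by (intro borel_measurable_diff borel_measurable_times) auto
  have mQ: "Q k j \<in> borel_measurable M" if "j < n" for k j
  proof -
    have "{j*l k..<j*l k+l k} \<subseteq> {..<n * l k}"
    proof -
      have "j * l k + l k = Suc j * l k" by simp
      also have "\<dots> \<le> n * l k" using that by (intro mult_right_mono) auto
      finally show ?thesis by auto
    qed
    moreover have "0 \<le> u k q" for q using u(2)[of k] monoD[OF u(1)[of k], of 0 q] by simp
    ultimately have "(\<lambda>\<omega>. \<Sum>q\<in>{j*l k..<j*l k+l k}. \<phi> k q \<omega> * (W (u k (Suc q)) \<omega> - W (u k q) \<omega>)) \<in> borel_measurable M"
      using m\<phi> W_measurable
      by (intro borel_measurable_sum borel_measurable_times borel_measurable_diff) (auto simp: subset_iff)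
    then show ?thesis unfolding Q_def blk[OF that] .
  qed
  \<comment> \<open>\<open>z\<close> dominates the truncated distance of the integrals uniformly on
    \<open>{0..t}\<close>, so one null set serves all grid times.\<close>
  have SI: "AE \<omega> in M. \<forall>s\<in>{0..t}. (\<lambda>k. simple_integral_wrt W (S (\<rho> k)) s \<omega>) \<longlonglongrightarrow> I s \<omega>"
    using \<rho>(2)
  proof eventually_elim
    fix \<omega> assume z: "(\<lambda>k. z (\<rho> k) \<omega>) \<longlonglongrightarrow> 0"
    show "\<forall>s\<in>{0..t}. (\<lambda>k. simple_integral_wrt W (S (\<rho> k)) s \<omega>) \<longlonglongrightarrow> I s \<omega>"
    proof
      fix s assume s: "s \<in> {0..t}"
      have le: "min 1 \<bar>simple_integral_wrt W (S k) s \<omega> - I s \<omega>\<bar> \<le> z k \<omega>" for k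
      proof -
        have "ennreal \<bar>simple_integral_wrt W (S k) s \<omega> - I s \<omega>\<bar> \<le> Z k \<omega>"
          unfolding Z_def using s by (intro SUP_upper) auto
        then have "min 1 (ennreal \<bar>simple_integral_wrt W (S k) s \<omega> - I s \<omega>\<bar>) \<le> min 1 (Z k \<omega>)"
          by (intro min.mono) auto
        moreover have "min 1 (ennreal \<bar>simple_integral_wrt W (S k) s \<omega> - I s \<omega>\<bar>) = ennreal (min 1 \<bar>simple_integral_wrt W (S k) s \<omega> - I s \<omega>\<bar>)"
          using min_of_mono[of ennreal 1] by (auto simp: monoI ennreal_leI)
        ultimately have "ennreal (min 1 \<bar>simple_integral_wrt W (S k) s \<omega> - I s \<omega>\<bar>) \<le> min 1 (Z k \<omega>)" by simp
        from enn2real_mono[OF this] show ?thesis unfolding z_def by (simp add: min_less_iff_disj)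
      qed
      have "(\<lambda>k. min 1 \<bar>simple_integral_wrt W (S (\<rho> k)) s \<omega> - I s \<omega>\<bar>) \<longlonglongrightarrow> 0"
        by (rule tendsto_sandwich[OF _ _ tendsto_const z]) (auto simp: le)
      then have "(\<lambda>k. simple_integral_wrt W (S (\<rho> k)) s \<omega> - I s \<omega>) \<longlonglongrightarrow> 0"
        by (rule tendsto_0_of_min_1)
      then show "(\<lambda>k. simple_integral_wrt W (S (\<rho> k)) s \<omega>) \<longlonglongrightarrow> I s \<omega>"
        by (simp add: LIM_zero_iff)
    qed
  qed
  then have QP: "AE \<omega> in M. \<forall>j<n. (\<lambda>k. Q (\<rho> k) j \<omega>) \<longlonglongrightarrow> P j \<omega>"
  proof eventually_elim
    fix \<omega> assume *: "\<forall>s\<in>{0..t}. (\<lambda>k. simple_integral_wrt W (S (\<rho> k)) s \<omega>) \<longlonglongrightarrow> I s \<omega>"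
    show "\<forall>j<n. (\<lambda>k. Q (\<rho> k) j \<omega>) \<longlonglongrightarrow> P j \<omega>"
    proof (intro allI impI)
      fix j assume "j < n"
      then have "r j \<in> {0..t}" "r (Suc j) \<in> {0..t}" using r0 rt by auto
      with * have "(\<lambda>k. simple_integral_wrt W (S (\<rho> k)) (r j) \<omega>) \<longlonglongrightarrow> I (r j) \<omega>"
        "(\<lambda>k. simple_integral_wrt W (S (\<rho> k)) (r (Suc j)) \<omega>) \<longlonglongrightarrow> I (r (Suc j)) \<omega>" by blast+
      then show "(\<lambda>k. Q (\<rho> k) j \<omega>) \<longlonglongrightarrow> P j \<omega>" unfolding Q_def P_def by (intro tendsto_intros)
    qed
  qed
  have lim: "(\<lambda>k. 2 * (2 * expectation (\<lambda>\<omega>. min 1 (V \<omega>)) + expectation (w (\<rho> k)))) \<longlonglongrightarrow> 2 * (2 * expectation (\<lambda>\<omega>. min 1 (V \<omega>)) + 0)"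
    by (intro tendsto_intros LIMSEQ_subseq_LIMSEQ[OF Ew \<rho>(1), unfolded comp_def])
  show ?total
  proof -
    have limP: "(\<lambda>k. expectation (\<lambda>\<omega>. min 1 ((\<Sum>j<n. Q (\<rho> k) j \<omega>)\<^sup>2))) \<longlonglongrightarrow> expectation (\<lambda>\<omega>. min 1 ((\<Sum>j<n. P j \<omega>)\<^sup>2))"
    proof (rule tendsto_expectation_min_1)
      show "AE \<omega> in M. (\<lambda>k. (\<Sum>j<n. Q (\<rho> k) j \<omega>)\<^sup>2) \<longlonglongrightarrow> (\<Sum>j<n. P j \<omega>)\<^sup>2"
        using QP by eventually_elim (intro tendsto_power tendsto_sum, auto)
    qed (use mP mQ in \<open>auto intro!: borel_measurable_power borel_measurable_sum\<close>)
    have le: "expectation (\<lambda>\<omega>. min 1 ((\<Sum>j<n. Q k j \<omega>)\<^sup>2)) \<le> 2 * (2 * expectation (\<lambda>\<omega>. min 1 (V \<omega>)) + expectation (w k))" for k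
    proof -
      \<comment> \<open>For the total sum, \<open>lenglart_increments\<close> is used with one block
        of length \<open>n * l k\<close>.\<close>
      have "(\<Sum>j<n. Q k j \<omega>) = (\<Sum>q<n * l k. \<phi> k q \<omega> * (W (u k (Suc q)) \<omega> - W (u k q) \<omega>))" for \<omega>
        unfolding sum.nat_group[symmetric] using blk by (simp add: Q_def)
      then have "expectation (\<lambda>\<omega>. min 1 ((\<Sum>j<n. Q k j \<omega>)\<^sup>2)) \<le> 2 * expectation (\<lambda>\<omega>. min 1 (E k \<omega>))"
        using lenglart_increments[OF u(1,2)[of k], of 1 "n * l k" "\<phi> k"] \<phi>[of _ k]
        unfolding E_def by (simp add: lessThan_atLeast0)
      also have "\<dots> \<le> 2 * (2 * expectation (\<lambda>\<omega>. min 1 (V \<omega>)) + expectation (w k))"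
        using EE[of k] by (intro mult_left_mono) auto
      finally show ?thesis .
    qed
    have "expectation (\<lambda>\<omega>. min 1 ((\<Sum>j<n. P j \<omega>)\<^sup>2)) \<le> 2 * (2 * expectation (\<lambda>\<omega>. min 1 (V \<omega>)) + 0)"
      by (rule LIMSEQ_le[OF limP lim]) (use le in blast)
    then show ?thesis by (simp add: P_def)
  qed
  show ?blocks
  proof -
    have limP: "(\<lambda>k. expectation (\<lambda>\<omega>. min 1 (\<Sum>j<n. (Q (\<rho> k) j \<omega>)\<^sup>2))) \<longlonglongrightarrow> expectation (\<lambda>\<omega>. min 1 (\<Sum>j<n. (P j \<omega>)\<^sup>2))"
    proof (rule tendsto_expectation_min_1)
      show "AE \<omega> in M. (\<lambda>k. \<Sum>j<n. (Q (\<rho> k) j \<omega>)\<^sup>2) \<longlonglongrightarrow> (\<Sum>j<n. (P j \<omega>)\<^sup>2)"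
        using QP by eventually_elim (intro tendsto_power tendsto_sum, auto)
    qed (use mP mQ in \<open>auto intro!: borel_measurable_power borel_measurable_sum sum_nonneg\<close>)
    have le: "expectation (\<lambda>\<omega>. min 1 (\<Sum>j<n. (Q k j \<omega>)\<^sup>2)) \<le> 2 * (2 * expectation (\<lambda>\<omega>. min 1 (V \<omega>)) + expectation (w k))" for k
    proof -
      have "(\<Sum>j<n. (Q k j \<omega>)\<^sup>2) = (\<Sum>j<n. (\<Sum>q\<in>{j*l k..<j*l k+l k}. \<phi> k q \<omega> * (W (u k (Suc q)) \<omega> - W (u k q) \<omega>))\<^sup>2)" for \<omega>
        using blk by (simp add: Q_def)
      then have "expectation (\<lambda>\<omega>. min 1 (\<Sum>j<n. (Q k j \<omega>)\<^sup>2)) \<le> 2 * expectation (\<lambda>\<omega>. min 1 (E k \<omega>))"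
        using lenglart_increments[OF u(1,2)[of k], of n "l k" "\<phi> k"] \<phi>[of _ k]
        unfolding E_def by simp
      also have "\<dots> \<le> 2 * (2 * expectation (\<lambda>\<omega>. min 1 (V \<omega>)) + expectation (w k))"
        using EE[of k] by (intro mult_left_mono) auto
      finally show ?thesis .
    qed
    have "expectation (\<lambda>\<omega>. min 1 (\<Sum>j<n. (P j \<omega>)\<^sup>2)) \<le> 2 * (2 * expectation (\<lambda>\<omega>. min 1 (V \<omega>)) + 0)"
      by (rule LIMSEQ_le[OF limP lim]) (use le in blast)
    then show ?thesis by (simp add: P_def)
  qed
qed

end

section \<open>Discrete Ito formula for the smoothed square root\<close>

lemma sum_integral_grid:
  fixes f :: "real \<Rightarrow> real" and r :: "nat \<Rightarrow> real"
  assumes "mono r" "f integrable_on {r 0..r m}"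
  shows "(\<Sum>j<m. integral {r j..r (Suc j)} f) = integral {r 0..r m} f"
  using assms(2)
proof (induction m)
  case (Suc m)
  have le: "r 0 \<le> r m" "r m \<le> r (Suc m)" using monoD[OF assms(1)] by simp_all
  have "f integrable_on {r 0..r m}"
    using Suc.prems le by (rule_tac integrable_on_subinterval) auto
  then show ?case using Suc.IH Henstock_Kurzweil_Integration.integral_combine[OF le Suc.prems] by simp
qed simp

text \<open>The first argument is frozen at the left grid point, the second is integrated exactly;
  uniform continuity on the square unfreezes the first. This covers frozen coefficients in front of
  drift or energy integrals as well as plain left Riemann sums.\<close>

lemma riemann_two_point:
  fixes g :: "real \<Rightarrow> real \<Rightarrow> real"
  assumes t: "0 \<le> t" and cont: "continuous_on ({0..t} \<times> {0..t}) (\<lambda>(x, y). g x y)"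
  shows "(\<lambda>N. \<Sum>j<N. integral {real j * t / real N..real (Suc j) * t / real N} (g (real j * t / real N)))
    \<longlonglongrightarrow> integral {0..t} (\<lambda>r. g r r)"
proof (rule LIMSEQ_I)
  fix e :: real assume e: "0 < e"
  define e' where "e' = e / (t + 1)"
  have e': "0 < e'" "e' * t < e" using e t by (auto simp: e'_def field_simps)
  have "uniformly_continuous_on ({0..t} \<times> {0..t}) (\<lambda>(x, y). g x y)"
    using cont by (intro compact_uniformly_continuous compact_Times) auto
  then obtain d where d: "0 < d" "\<And>p p'. p \<in> {0..t} \<times> {0..t} \<Longrightarrow> p' \<in> {0..t} \<times> {0..t} \<Longrightarrow> dist p' p < d \<Longrightarrow>
      dist ((\<lambda>(x, y). g x y) p') ((\<lambda>(x, y). g x y) p) < e'"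
    unfolding uniformly_continuous_on_def using e'(1) by metis
  obtain N0 where N0: "t / d < real N0" using reals_Archimedean2 by blast
  have "continuous_on {0..t} (\<lambda>r. (\<lambda>(x, y). g x y) (r, r))"
    by (rule continuous_on_compose2[OF cont]) (auto intro!: continuous_intros)
  then have diag: "continuous_on {0..t} (\<lambda>r. g r r)" by simp
  have sect: "continuous_on {0..t} (g x)" if "x \<in> {0..t}" for x
  proof -
    have "continuous_on {0..t} (\<lambda>r. (\<lambda>(x, y). g x y) (x, r))"
      by (rule continuous_on_compose2[OF cont]) (use that in \<open>auto intro!: continuous_intros\<close>)
    then show ?thesis by simp
  qed
  have "norm ((\<Sum>j<N. integral {real j * t / real N..real (Suc j) * t / real N} (g (real j * t / real N))) -
     integral {0..t} (\<lambda>r. g r r)) < e" if N: "N > N0" for N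
  proof -
    define r where "r j = real j * t / real N" for j
    have N1: "0 < real N" using N by simp
    have mr: "mono r" unfolding r_def by (intro monoI divide_right_mono mult_right_mono) (use t in auto)
    have rN: "r 0 = 0" "r N = t" using N1 by (auto simp: r_def)
    have step: "r (Suc j) - r j = t / real N" for j by (simp add: r_def distrib_right add_divide_distrib)
    have r01: "r j \<in> {0..t}" if "j \<le> N" for j
      using monoD[OF mr that] monoD[OF mr, of 0 j] rN by simp
    have tN: "t / real N < d"
    proof -
      have "t / d < real N" using N0 N by linarith
      then show ?thesis using d(1) N1 by (simp add: field_simps)
    qed
    have sub: "{r j..r (Suc j)} \<subseteq> {0..t}" if "j < N" for j
      using r01[of j] r01[of "Suc j"] that by auto
    have piece: "\<bar>integral {r j..r (Suc j)} (g (r j)) - integral {r j..r (Suc j)} (\<lambda>s. g s s)\<bar> \<le> e' * (t / real N)"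
      if j: "j < N" for j
    proof -
      have i1: "g (r j) integrable_on {r j..r (Suc j)}"
        using sect[of "r j"] r01[of j] sub[OF j] j
        by (intro integrable_continuous_interval) (auto intro: continuous_on_subset)
      have i2: "(\<lambda>s. g s s) integrable_on {r j..r (Suc j)}"
        using diag sub[OF j] by (intro integrable_continuous_interval) (auto intro: continuous_on_subset)
      have c: "continuous_on {r j..r (Suc j)} (\<lambda>s. g (r j) s - g s s)"
        using sect[of "r j"] r01[of j] sub[OF j] j diag
        by (intro continuous_intros) (auto intro: continuous_on_subset)
      have "norm (integral {r j..r (Suc j)} (\<lambda>s. g (r j) s - g s s)) \<le> e' * (r (Suc j) - r j)"
      proof (rule integral_bound[OF _ c])
        show "r j \<le> r (Suc j)" using monoD[OF mr] by simp
        fix s assume s: "s \<in> {r j..r (Suc j)}"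
        have "dist (r j, s) (s, s) < d"
          using s step[of j] tN by (simp add: dist_Pair_Pair dist_real_def)
        then have "dist (g (r j) s) (g s s) < e'"
          using d(2)[of "(s, s)" "(r j, s)"] s sub[OF j] r01[of j] j by auto
        then show "norm (g (r j) s - g s s) \<le> e'" by (simp add: dist_norm)
      qed
      then show ?thesis using i1 i2 by (simp add: Henstock_Kurzweil_Integration.integral_diff step)
    qed
    have "integral {0..t} (\<lambda>r. g r r) = (\<Sum>j<N. integral {r j..r (Suc j)} (\<lambda>s. g s s))"
      using sum_integral_grid[OF mr, of "\<lambda>s. g s s" N] diag rN by (simp add: integrable_continuous_interval)
    then have "\<bar>(\<Sum>j<N. integral {r j..r (Suc j)} (g (r j))) - integral {0..t} (\<lambda>r. g r r)\<bar> =
      \<bar>\<Sum>j<N. integral {r j..r (Suc j)} (g (r j)) - integral {r j..r (Suc j)} (\<lambda>s. g s s)\<bar>"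
      by (simp add: sum_subtractf)
    also have "\<dots> \<le> (\<Sum>j<N. e' * (t / real N))"
      using piece by (intro order.trans[OF sum_abs] sum_mono) auto
    also have "\<dots> = e' * t" using N1 by simp
    finally show ?thesis using e' by (simp add: r_def)
  qed
  then show "\<exists>N0. \<forall>N\<ge>N0. norm ((\<Sum>j<N. integral {real j * t / real N..real (Suc j) * t / real N} (g (real j * t / real N))) -
     integral {0..t} (\<lambda>r. g r r)) < e" by (intro exI[of _ "Suc N0"]) auto
qed

lemma riemann_left_sum:
  fixes h :: "real \<Rightarrow> real"
  assumes "0 \<le> t" "continuous_on {0..t} h"
  shows "(\<lambda>N. \<Sum>j<N. h (real j * t / real N) * (t / real N)) \<longlonglongrightarrow> integral {0..t} h"
proof -
  have "continuous_on ({0..t} \<times> {0..t}) (\<lambda>(x, y). h x)"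
    unfolding case_prod_beta
    by (rule continuous_on_compose2[OF assms(2)]) (auto intro!: continuous_intros)
  from riemann_two_point[OF assms(1), of "\<lambda>x y. h x", OF this]
  have "(\<lambda>N. \<Sum>j<N. integral {real j * t / real N..real (Suc j) * t / real N} (\<lambda>_. h (real j * t / real N))) \<longlonglongrightarrow> integral {0..t} h" .
  moreover have "integral {real j * t / real N..real (Suc j) * t / real N} (\<lambda>_. h (real j * t / real N)) = h (real j * t / real N) * (t / real N)" for j N
  proof -
    have "real j * t / real N \<le> real (Suc j) * t / real N" using assms by (intro divide_right_mono mult_right_mono) auto
    moreover have "real (Suc j) * t / real N - real j * t / real N = t / real N"
      by (simp add: distrib_right add_divide_distrib)
    ultimately show ?thesis by simp
  qed
  ultimately show ?thesis by simp
qed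

text \<open>The remainder is computed exactly: it is
  \<open>(a' - a) ^ 3 * (3 * a + a') / (8 * a ^ 3)\<close>, and \<open>a' - a = d / (a + a')\<close>
  with \<open>a + a' \<ge> a\<close>. For
  \<open>a = sqrt (X + \<epsilon>) \<ge> sqrt \<epsilon>\<close> the constant is uniform along the
  path.\<close>

lemma sqrt_taylor2:
  fixes a a' :: real
  assumes a: "0 < a" "0 < a'" and d: "d = a'\<^sup>2 - a\<^sup>2"
  shows "\<bar>a' - a - d / (2 * a) + d\<^sup>2 / (8 * a ^ 3)\<bar> \<le> 3 / (8 * a ^ 5) * \<bar>d\<bar> ^ 3"
proof -
  define s where "s = a + a'"
  have s: "0 < s" "a \<le> s" using a by (auto simp: s_def)
  have ds: "d = (a' - a) * s" by (simp add: d s_def power2_eq_square algebra_simps)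
  have "a' - a - d / (2 * a) + d\<^sup>2 / (8 * a ^ 3) = (a' - a) ^ 3 * (3 * a + a') / (8 * a ^ 3)"
    unfolding d using a by (simp add: field_simps power2_eq_square power3_eq_cube)
  moreover have "(3 * a + a') \<le> 3 * s" using a by (simp add: s_def)
  then have "\<bar>a' - a\<bar> ^ 3 * (3 * a + a') / (8 * a ^ 3) \<le> \<bar>a' - a\<bar> ^ 3 * (3 * s) / (8 * a ^ 3)"
    using a by (intro divide_right_mono mult_left_mono) auto
  moreover have "\<bar>a' - a\<bar> ^ 3 * (3 * s) / (8 * a ^ 3) = 3 / (8 * a ^ 3 * s\<^sup>2) * \<bar>d\<bar> ^ 3"
  proof -
    have "\<bar>d\<bar> ^ 3 = \<bar>a' - a\<bar> ^ 3 * s ^ 3" using s by (simp add: ds abs_mult power_mult_distrib)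
    moreover have "u * (3 * s) / (8 * a ^ 3) = 3 / (8 * a ^ 3 * s\<^sup>2) * (u * s ^ 3)" for u
      using s a by (simp add: field_simps power2_eq_square power3_eq_cube)
    ultimately show ?thesis by simp
  qed
  moreover have "3 / (8 * a ^ 3 * s\<^sup>2) * \<bar>d\<bar> ^ 3 \<le> 3 / (8 * a ^ 5) * \<bar>d\<bar> ^ 3"
  proof -
    have "8 * a ^ 5 = 8 * a ^ 3 * a\<^sup>2" by (simp add: power2_eq_square power3_eq_cube numeral_eq_Suc)
    also have "\<dots> \<le> 8 * a ^ 3 * s\<^sup>2" using s a by (intro mult_left_mono power_mono) auto
    finally have "3 / (8 * a ^ 3 * s\<^sup>2) \<le> 3 / (8 * a ^ 5)" using a s by (intro divide_left_mono mult_pos_pos) auto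
    then show ?thesis by (intro mult_right_mono) auto
  qed
  ultimately show ?thesis using a by (simp add: abs_mult power_abs)
qed

text \<open>A deterministic Ito formula: all the probability is in the vanishing sums
  \<open>\<Delta>\<close>, \<open>Q\<close> and \<open>Q'\<close>, which are later available almost
  surely along a subsequence \<open>N\<close> of grid sizes. The last integral is the second-order
  term: half of the second derivative of \<open>sqrt (x + \<epsilon>)\<close> times the quadratic
  variation density \<open>4 * X\<close>, with reversed sign because the formula is solved for the
  stochastic sum.\<close>

lemma ito_sqrt_path:
  fixes X I W :: "real \<Rightarrow> real" and N :: "nat \<Rightarrow> nat" and t \<epsilon> b :: real
  defines "r \<equiv> \<lambda>l j. real j * t / real (N l)"
  assumes t: "0 < t" and \<epsilon>: "0 < \<epsilon>"
    and contX: "continuous_on {0..t} X" and X0: "\<And>s. s \<in> {0..t} \<Longrightarrow> 0 \<le> X s"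
    and eq: "\<And>s. s \<in> {0..t} \<Longrightarrow> X s = X 0 + integral {0..s} (\<lambda>u. 1 - b * X u) + I s"
    and N: "filterlim N at_top sequentially"
    and \<Delta>: "(\<lambda>l. \<Sum>j<N l. (I (r l (Suc j)) - I (r l j) - 2 * sqrt (X (r l j)) * (W (r l (Suc j)) - W (r l j)))\<^sup>2) \<longlonglongrightarrow> 0"
    and Q: "(\<lambda>l. \<Sum>j<N l. X (r l j) / sqrt (X (r l j) + \<epsilon>) ^ 3 * ((W (r l (Suc j)) - W (r l j))\<^sup>2 - t / real (N l))) \<longlonglongrightarrow> 0"
    and Q': "(\<lambda>l. \<Sum>j<N l. (W (r l (Suc j)) - W (r l j))\<^sup>2 - t / real (N l)) \<longlonglongrightarrow> 0"
  shows "(\<lambda>l. \<Sum>j<N l. 1 / (2 * sqrt (X (r l j) + \<epsilon>)) * (I (r l (Suc j)) - I (r l j)))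
    \<longlonglongrightarrow> sqrt (X t + \<epsilon>) - sqrt (X 0 + \<epsilon>)
      - integral {0..t} (\<lambda>s. (1 - b * X s) / (2 * sqrt (X s + \<epsilon>)))
      + integral {0..t} (\<lambda>s. X s / (2 * sqrt (X s + \<epsilon>) ^ 3))"
proof -
  have t0: "0 \<le> t" using t by simp
  define a where "a s = sqrt (X s + \<epsilon>)" for s
  define e0 where "e0 = sqrt \<epsilon>"
  have e0: "0 < e0" using \<epsilon> by (simp add: e0_def)
  have a0: "e0 \<le> a s" "0 < a s" "(a s)\<^sup>2 = X s + \<epsilon>" if "s \<in> {0..t}" for s
    using X0[OF that] \<epsilon> by (auto simp: a_def e0_def)
  have conta: "continuous_on {0..t} a" unfolding a_def using contX by (intro continuous_intros)
  have mr: "mono (r l)" for l unfolding r_def by (intro monoI divide_right_mono mult_right_mono) (use t in auto)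
  have rN: "r l 0 = 0" "0 < N l \<Longrightarrow> r l (N l) = t" for l by (auto simp: r_def)
  have step: "r l (Suc j) - r l j = t / real (N l)" for l j by (simp add: r_def distrib_right add_divide_distrib)
  have rt: "r l j \<in> {0..t}" if "j \<le> N l" for l j
  proof (cases "0 < N l")
    case True
    then show ?thesis using monoD[OF mr[of l] that] monoD[OF mr[of l], of 0 j] rN[of l] by simp
  qed (use t in \<open>simp add: r_def\<close>)
  have Npos: "\<forall>\<^sub>F l in sequentially. 0 < N l"
    using N[unfolded filterlim_at_top, rule_format, of 1] by eventually_elim simp
  have tN: "(\<lambda>l. t / real (N l)) \<longlonglongrightarrow> 0"
    by (intro tendsto_divide_0[OF tendsto_const] filterlim_at_top_imp_at_infinity
          filterlim_compose[OF filterlim_real_sequentially N])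
  define h where "h l = t / real (N l)" for l
  have h0: "0 \<le> h l" for l using t by (simp add: h_def)
  have Nh: "0 < N l \<Longrightarrow> real (N l) * h l = t" for l by (simp add: h_def)
  define dW where "dW l j = W (r l (Suc j)) - W (r l j)" for l j
  define dI where "dI l j = I (r l (Suc j)) - I (r l j)" for l j
  define dX where "dX l j = X (r l (Suc j)) - X (r l j)" for l j
  define dA where "dA l j = integral {r l j..r l (Suc j)} (\<lambda>u. 1 - b * X u)" for l j
  \<comment> \<open>Euler increment of \<open>X\<close> without drift. \<open>E\<close> will measure
    its distance to the true increments, \<open>Y\<close> its discrete quadratic variation.\<close>
  define y where "y l j = 2 * sqrt (X (r l j)) * dW l j" for l j
  obtain CX where CX: "\<And>s. s \<in> {0..t} \<Longrightarrow> X s \<le> CX"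
    using continuous_attains_sup[OF compact_Icc _ contX] t by force
  have CX0: "0 \<le> CX" using CX[of 0] X0[of 0] t by simp
  define CD where "CD = 1 + \<bar>b\<bar> * CX"
  have drift: "\<bar>dA l j\<bar> \<le> CD * h l" if "j < N l" for l j
  proof -
    have sub: "{r l j..r l (Suc j)} \<subseteq> {0..t}" using rt[of j l] rt[of "Suc j" l] that by auto
    have "norm (dA l j) \<le> CD * (r l (Suc j) - r l j)" unfolding dA_def
    proof (rule integral_bound)
      show "r l j \<le> r l (Suc j)" using monoD[OF mr] by simp
      show "continuous_on {r l j..r l (Suc j)} (\<lambda>u. 1 - b * X u)"
        using contX sub by (intro continuous_intros) (auto intro: continuous_on_subset)
      fix u assume "u \<in> {r l j..r l (Suc j)}"
      then have "u \<in> {0..t}" using sub by blast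
      then have "\<bar>b\<bar> * X u \<le> \<bar>b\<bar> * CX" "0 \<le> X u" using CX X0 by (auto intro: mult_left_mono)
      then have "\<bar>b * X u\<bar> \<le> \<bar>b\<bar> * CX" by (simp add: abs_mult)
      then show "norm (1 - b * X u) \<le> CD" by (simp add: CD_def)
    qed
    then show ?thesis by (simp add: step h_def)
  qed
  have incX: "dX l j = dA l j + dI l j" if j: "j < N l" for l j
  proof -
    have "integral {0..r l (Suc j)} (\<lambda>u. 1 - b * X u) = integral {0..r l j} (\<lambda>u. 1 - b * X u) + dA l j"
      unfolding dA_def
    proof (rule Henstock_Kurzweil_Integration.integral_combine[symmetric])
      show "0 \<le> r l j" "r l j \<le> r l (Suc j)" using rt[of j l] j monoD[OF mr] by auto
      show "(\<lambda>u. 1 - b * X u) integrable_on {0..r l (Suc j)}"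
        using contX rt[of "Suc j" l] j
        by (intro integrable_continuous_interval continuous_intros) (auto intro: continuous_on_subset)
    qed
    then show ?thesis
      using eq[of "r l (Suc j)"] eq[of "r l j"] rt[of j l] rt[of "Suc j" l] j by (simp add: dX_def dI_def)
  qed
  define E where "E l = (\<Sum>j<N l. (dX l j - y l j)\<^sup>2)" for l
  define Y where "Y l = (\<Sum>j<N l. (y l j)\<^sup>2)" for l
  have E0: "0 \<le> E l" and Y0: "0 \<le> Y l" for l unfolding E_def Y_def by (auto intro: sum_nonneg)
  have ab: "(x + z)\<^sup>2 \<le> 2 * x\<^sup>2 + 2 * z\<^sup>2" for x z :: real
    using sum_squares_bound[of x z] by (simp add: power2_sum)
  \<comment> \<open>The squared drift increments sum up to order \<open>h\<close>; what remains is
    \<open>\<Delta>\<close>.\<close>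
  have Elim: "E \<longlonglongrightarrow> 0"
  proof (rule tendsto_sandwich[OF always_eventually _ tendsto_const])
    show "\<forall>l. 0 \<le> E l" using E0 by simp
    show "\<forall>\<^sub>F l in sequentially. E l \<le> 2 * (CD\<^sup>2 * t * h l) + 2 * (\<Sum>j<N l. (dI l j - y l j)\<^sup>2)"
      using Npos
    proof eventually_elim
      fix l assume N0: "0 < N l"
      have "E l \<le> (\<Sum>j<N l. 2 * (CD * h l)\<^sup>2 + 2 * (dI l j - y l j)\<^sup>2)"
        unfolding E_def
      proof (rule sum_mono)
        fix j assume j: "j \<in> {..<N l}"
        have "(dA l j)\<^sup>2 \<le> (CD * h l)\<^sup>2" using drift[of j l] j by (simp add: abs_le_square_iff[symmetric])
        moreover have *: "dX l j - y l j = dA l j + (dI l j - y l j)" using incX[of j l] j by simp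
        ultimately show "(dX l j - y l j)\<^sup>2 \<le> 2 * (CD * h l)\<^sup>2 + 2 * (dI l j - y l j)\<^sup>2"
          unfolding * using ab[of "dA l j" "dI l j - y l j"] by linarith
      qed
      also have "\<dots> = 2 * (CD\<^sup>2 * (real (N l) * h l) * h l) + 2 * (\<Sum>j<N l. (dI l j - y l j)\<^sup>2)"
        by (simp add: sum.distrib sum_distrib_left power2_eq_square)
      finally show "E l \<le> 2 * (CD\<^sup>2 * t * h l) + 2 * (\<Sum>j<N l. (dI l j - y l j)\<^sup>2)"
        unfolding Nh[OF N0] .
    qed
    have "(\<lambda>l. \<Sum>j<N l. (dI l j - y l j)\<^sup>2) \<longlonglongrightarrow> 0"
      using \<Delta> by (simp add: dI_def y_def dW_def)
    then have "(\<lambda>l. 2 * (CD\<^sup>2 * t * h l) + 2 * (\<Sum>j<N l. (dI l j - y l j)\<^sup>2)) \<longlonglongrightarrow> 2 * (CD\<^sup>2 * t * 0) + 2 * 0"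
      using tN unfolding h_def by (intro tendsto_intros)
    then show "(\<lambda>l. 2 * (CD\<^sup>2 * t * h l) + 2 * (\<Sum>j<N l. (dI l j - y l j)\<^sup>2)) \<longlonglongrightarrow> 0" by simp
  qed
  \<comment> \<open>By \<open>Q'\<close> the squared increments of \<open>W\<close> eventually sum
    up to less than \<open>t + 1\<close>, and the square of \<open>y\<close> is \<open>4 * X\<close>
    times that of \<open>dW\<close>.\<close>
  define CY where "CY = 4 * CX * (t + 1)"
  have CY0: "0 \<le> CY" using CX0 t by (simp add: CY_def)
  have Ybound: "\<forall>\<^sub>F l in sequentially. Y l \<le> CY"
  proof -
    have "\<forall>\<^sub>F l in sequentially. (\<Sum>j<N l. (dW l j)\<^sup>2 - h l) < 1"
      using Q' by (intro order_tendstoD) (auto simp: dW_def h_def)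
    then show ?thesis using Npos
    proof eventually_elim
      fix l assume 1: "(\<Sum>j<N l. (dW l j)\<^sup>2 - h l) < 1" and N0: "0 < N l"
      have "Y l \<le> (\<Sum>j<N l. 4 * CX * (dW l j)\<^sup>2)"
        unfolding Y_def
      proof (rule sum_mono)
        fix j assume "j \<in> {..<N l}"
        then have s: "r l j \<in> {0..t}" using rt[of j l] by simp
        have "(y l j)\<^sup>2 = 4 * X (r l j) * (dW l j)\<^sup>2"
          using X0[OF s] by (simp add: y_def power_mult_distrib)
        also have "\<dots> \<le> 4 * CX * (dW l j)\<^sup>2" using CX[OF s] by (intro mult_right_mono) auto
        finally show "(y l j)\<^sup>2 \<le> 4 * CX * (dW l j)\<^sup>2" .
      qed
      also have "\<dots> = 4 * CX * (\<Sum>j<N l. (dW l j)\<^sup>2)" by (simp add: sum_distrib_left)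
      also have "\<dots> \<le> CY" unfolding CY_def
        using 1 Nh[OF N0] CX0 by (intro mult_left_mono) (auto simp: sum_subtractf)
      finally show "Y l \<le> CY" .
    qed
  qed
  have dXbound: "\<forall>\<^sub>F l in sequentially. (\<Sum>j<N l. (dX l j)\<^sup>2) \<le> 2 * 1 + 2 * CY"
  proof -
    have "\<forall>\<^sub>F l in sequentially. E l < 1" using Elim by (intro order_tendstoD) auto
    then show ?thesis using Ybound
    proof eventually_elim
      fix l assume 1: "E l < 1" "Y l \<le> CY"
      have "(\<Sum>j<N l. (dX l j)\<^sup>2) \<le> (\<Sum>j<N l. 2 * (dX l j - y l j)\<^sup>2 + 2 * (y l j)\<^sup>2)"
      proof (rule sum_mono)
        fix j show "(dX l j)\<^sup>2 \<le> 2 * (dX l j - y l j)\<^sup>2 + 2 * (y l j)\<^sup>2"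
          using ab[of "dX l j - y l j" "y l j"] by simp
      qed
      also have "\<dots> = 2 * E l + 2 * Y l" by (simp add: E_def Y_def sum.distrib sum_distrib_left)
      finally show "(\<Sum>j<N l. (dX l j)\<^sup>2) \<le> 2 * 1 + 2 * CY" using 1 by linarith
    qed
  qed
  have osc: "\<forall>\<^sub>F l in sequentially. \<forall>j<N l. \<bar>dX l j\<bar> \<le> e" if e: "0 < e" for e
  proof -
    have "uniformly_continuous_on {0..t} X" using contX by (intro compact_uniformly_continuous) auto
    then obtain d where d: "0 < d" "\<And>x x'. x \<in> {0..t} \<Longrightarrow> x' \<in> {0..t} \<Longrightarrow> dist x' x < d \<Longrightarrow> dist (X x') (X x) < e"
      unfolding uniformly_continuous_on_def using e by metis
    have "\<forall>\<^sub>F l in sequentially. t / real (N l) < d" using tN d(1) by (rule order_tendstoD)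
    then show ?thesis
    proof (eventually_elim, intro allI impI)
      fix l j assume "t / real (N l) < d" "j < N l"
      then have "dist (r l (Suc j)) (r l j) < d" using step[of l j] t by (simp add: dist_real_def)
      then have "dist (X (r l (Suc j))) (X (r l j)) < e"
        using d(2) rt[of j l] rt[of "Suc j" l] \<open>j < N l\<close> by simp
      then show "\<bar>dX l j\<bar> \<le> e" by (simp add: dX_def dist_real_def)
    qed
  qed
  define R where "R l j = a (r l (Suc j)) - a (r l j) - dX l j / (2 * a (r l j)) + (dX l j)\<^sup>2 / (8 * a (r l j) ^ 3)" for l j
  define K where "K = 3 / (8 * e0 ^ 5)"
  have K0: "0 < K" using e0 by (simp add: K_def)
  have Rbound: "\<bar>R l j\<bar> \<le> K * \<bar>dX l j\<bar> ^ 3" if j: "j < N l" for l j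
  proof -
    have s: "r l j \<in> {0..t}" "r l (Suc j) \<in> {0..t}" using rt[of j l] rt[of "Suc j" l] j by auto
    have "\<bar>R l j\<bar> \<le> 3 / (8 * a (r l j) ^ 5) * \<bar>dX l j\<bar> ^ 3"
      unfolding R_def using a0[OF s(1)] a0[OF s(2)] by (intro sqrt_taylor2) (auto simp: dX_def)
    also have "\<dots> \<le> K * \<bar>dX l j\<bar> ^ 3"
      unfolding K_def using e0 a0[OF s(1)]
      by (intro mult_right_mono divide_left_mono mult_left_mono power_mono) auto
    finally show ?thesis .
  qed
  \<comment> \<open>Cubes are bounded by the largest increment, which vanishes by uniform
    continuity, times the bounded sum of squares.\<close>
  have Rlim: "(\<lambda>l. \<Sum>j<N l. R l j) \<longlonglongrightarrow> 0"
  proof (rule tendstoI)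
    fix e :: real assume e: "0 < e"
    define e' where "e' = e / (K * (2 * 1 + 2 * CY) + 1)"
    have p: "0 < K * (2 * 1 + 2 * CY) + 1" using K0 CY0 by (intro add_nonneg_pos mult_nonneg_nonneg) auto
    have e': "0 < e'" using e p by (simp add: e'_def)
    have e'2: "K * (e' * (2 * 1 + 2 * CY)) < e"
    proof -
      have "e' * (K * (2 * 1 + 2 * CY) + 1) = e" using p by (simp add: e'_def)
      then show ?thesis using e' by (simp add: algebra_simps)
    qed
    show "\<forall>\<^sub>F l in sequentially. dist (\<Sum>j<N l. R l j) 0 < e"
      using osc[OF e'] dXbound
    proof eventually_elim
      fix l assume 1: "\<forall>j<N l. \<bar>dX l j\<bar> \<le> e'" and 2: "(\<Sum>j<N l. (dX l j)\<^sup>2) \<le> 2 * 1 + 2 * CY"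
      have "\<bar>\<Sum>j<N l. R l j\<bar> \<le> (\<Sum>j<N l. \<bar>R l j\<bar>)" by (rule sum_abs)
      also have "\<dots> \<le> (\<Sum>j<N l. K * (e' * (dX l j)\<^sup>2))"
      proof (rule sum_mono)
        fix j assume j: "j \<in> {..<N l}"
        have "\<bar>dX l j\<bar> ^ 3 = \<bar>dX l j\<bar> * (dX l j)\<^sup>2" by (simp add: power3_eq_cube power2_eq_square flip: abs_mult)
        also have "\<dots> \<le> e' * (dX l j)\<^sup>2" using 1 j by (intro mult_right_mono) auto
        finally have "K * \<bar>dX l j\<bar> ^ 3 \<le> K * (e' * (dX l j)\<^sup>2)" using K0 by (intro mult_left_mono) auto
        then show "\<bar>R l j\<bar> \<le> K * (e' * (dX l j)\<^sup>2)" using Rbound[of j l] j by simp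
      qed
      also have "\<dots> = K * (e' * (\<Sum>j<N l. (dX l j)\<^sup>2))" by (simp add: sum_distrib_left)
      also have "\<dots> \<le> K * (e' * (2 * 1 + 2 * CY))" using 2 K0 e' by (intro mult_left_mono) auto
      finally show "dist (\<Sum>j<N l. R l j) 0 < e" using e'2 by (simp add: dist_real_def)
    qed
  qed
  define K2 where "K2 = 1 / (8 * e0 ^ 3)"
  have k2: "0 \<le> 1 / (8 * a s ^ 3)" "1 / (8 * a s ^ 3) \<le> K2" if "s \<in> {0..t}" for s
    unfolding K2_def using a0[OF that] e0 by (auto intro!: divide_left_mono power_mono)
  have K20: "0 \<le> K2" using e0 by (simp add: K2_def)
  \<comment> \<open>A difference of squares is the square of the difference plus twice the
    difference times \<open>y\<close>; Cauchy-Schwarz bounds the mixed sum by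
    \<open>sqrt (E l) * sqrt CY\<close>.\<close>
  have cross: "(\<lambda>l. \<Sum>j<N l. ((dX l j)\<^sup>2 - (y l j)\<^sup>2) / (8 * a (r l j) ^ 3)) \<longlonglongrightarrow> 0"
  proof (rule Lim_null_comparison)
    show "\<forall>\<^sub>F l in sequentially. norm (\<Sum>j<N l. ((dX l j)\<^sup>2 - (y l j)\<^sup>2) / (8 * a (r l j) ^ 3)) \<le>
      K2 * (E l + 2 * (sqrt (E l) * sqrt CY))"
      using Ybound
    proof eventually_elim
      fix l assume Yl: "Y l \<le> CY"
      have "norm (\<Sum>j<N l. ((dX l j)\<^sup>2 - (y l j)\<^sup>2) / (8 * a (r l j) ^ 3)) \<le>
        (\<Sum>j<N l. K2 * ((dX l j - y l j)\<^sup>2 + 2 * (\<bar>dX l j - y l j\<bar> * \<bar>y l j\<bar>)))"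
      proof (rule order.trans[OF norm_sum sum_mono])
        fix j assume "j \<in> {..<N l}"
        then have s: "r l j \<in> {0..t}" using rt[of j l] by simp
        have "(dX l j)\<^sup>2 - (y l j)\<^sup>2 = (dX l j - y l j)\<^sup>2 + 2 * ((dX l j - y l j) * y l j)"
          by (simp add: power2_eq_square algebra_simps)
        then have "\<bar>(dX l j)\<^sup>2 - (y l j)\<^sup>2\<bar> \<le> (dX l j - y l j)\<^sup>2 + 2 * (\<bar>dX l j - y l j\<bar> * \<bar>y l j\<bar>)"
          using abs_triangle_ineq[of "(dX l j - y l j)\<^sup>2" "2 * ((dX l j - y l j) * y l j)"] by (simp add: abs_mult)
        then have "1 / (8 * a (r l j) ^ 3) * \<bar>(dX l j)\<^sup>2 - (y l j)\<^sup>2\<bar> \<le> K2 * ((dX l j - y l j)\<^sup>2 + 2 * (\<bar>dX l j - y l j\<bar> * \<bar>y l j\<bar>))"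
          using k2[OF s] K20 by (intro mult_mono) auto
        then show "norm (((dX l j)\<^sup>2 - (y l j)\<^sup>2) / (8 * a (r l j) ^ 3)) \<le> K2 * ((dX l j - y l j)\<^sup>2 + 2 * (\<bar>dX l j - y l j\<bar> * \<bar>y l j\<bar>))"
          using a0[OF s] by (simp add: abs_divide)
      qed
      also have "\<dots> = K2 * (E l + 2 * (\<Sum>j<N l. \<bar>dX l j - y l j\<bar> * \<bar>y l j\<bar>))"
        by (simp only: E_def sum.distrib sum_distrib_left[symmetric])
      also have "\<dots> \<le> K2 * (E l + 2 * (sqrt (E l) * sqrt CY))"
      proof -
        have "(\<Sum>j<N l. \<bar>dX l j - y l j\<bar> * \<bar>y l j\<bar>) \<le> L2_set (\<lambda>j. dX l j - y l j) {..<N l} * L2_set (y l) {..<N l}"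
          by (rule L2_set_mult_ineq)
        also have "\<dots> = sqrt (E l) * sqrt (Y l)" by (simp add: L2_set_def E_def Y_def)
        also have "\<dots> \<le> sqrt (E l) * sqrt CY" using Yl E0 by (intro mult_left_mono) auto
        finally show ?thesis using K20 by (intro mult_left_mono) auto
      qed
      finally show "norm (\<Sum>j<N l. ((dX l j)\<^sup>2 - (y l j)\<^sup>2) / (8 * a (r l j) ^ 3)) \<le> K2 * (E l + 2 * (sqrt (E l) * sqrt CY))" .
    qed
    have "(\<lambda>l. K2 * (E l + 2 * (sqrt (E l) * sqrt CY))) \<longlonglongrightarrow> K2 * (0 + 2 * (sqrt 0 * sqrt CY))"
      using Elim by (intro tendsto_intros)
    then show "(\<lambda>l. K2 * (E l + 2 * (sqrt (E l) * sqrt CY))) \<longlonglongrightarrow> 0" by simp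
  qed
  define J2 where "J2 = integral {0..t} (\<lambda>s. X s / (2 * a s ^ 3))"
  \<comment> \<open>\<open>Q\<close> replaces the squared increments of \<open>W\<close> by the cell
    length, which leaves a left Riemann sum.\<close>
  have ylim: "(\<lambda>l. \<Sum>j<N l. (y l j)\<^sup>2 / (8 * a (r l j) ^ 3)) \<longlonglongrightarrow> J2"
  proof -
    have "continuous_on {0..t} (\<lambda>s. X s / (2 * a s ^ 3))"
      using contX conta a0 by (intro continuous_intros) (auto simp: less_le)
    from filterlim_compose[OF riemann_left_sum[OF t0 this] N]
    have 1: "(\<lambda>l. \<Sum>j<N l. X (r l j) / (2 * a (r l j) ^ 3) * h l) \<longlonglongrightarrow> J2"
      by (simp add: J2_def r_def h_def)
    have 2: "(\<lambda>l. 1 / 2 * (\<Sum>j<N l. X (r l j) / a (r l j) ^ 3 * ((dW l j)\<^sup>2 - h l))) \<longlonglongrightarrow> 1 / 2 * 0"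
      using Q unfolding a_def dW_def h_def by (intro tendsto_intros)
    have "(\<Sum>j<N l. (y l j)\<^sup>2 / (8 * a (r l j) ^ 3)) =
      1 / 2 * (\<Sum>j<N l. X (r l j) / a (r l j) ^ 3 * ((dW l j)\<^sup>2 - h l)) + (\<Sum>j<N l. X (r l j) / (2 * a (r l j) ^ 3) * h l)" for l
      unfolding sum_distrib_left sum.distrib[symmetric]
    proof (rule sum.cong[OF refl])
      fix j assume "j \<in> {..<N l}"
      then have s: "r l j \<in> {0..t}" using rt[of j l] by simp
      have "(y l j)\<^sup>2 = 4 * X (r l j) * (dW l j)\<^sup>2" using X0[OF s] by (simp add: y_def power_mult_distrib)
      then show "(y l j)\<^sup>2 / (8 * a (r l j) ^ 3) = 1 / 2 * (X (r l j) / a (r l j) ^ 3 * ((dW l j)\<^sup>2 - h l)) + X (r l j) / (2 * a (r l j) ^ 3) * h l"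
        using a0[OF s] by (simp add: field_simps)
    qed
    then show ?thesis using tendsto_add[OF 2 1] by simp
  qed
  define J1 where "J1 = integral {0..t} (\<lambda>s. (1 - b * X s) / (2 * a s))"
  have driftlim: "(\<lambda>l. \<Sum>j<N l. dA l j / (2 * a (r l j))) \<longlonglongrightarrow> J1"
  proof -
    have "continuous_on ({0..t} \<times> {0..t}) (\<lambda>p. (1 - b * X (snd p)) / (2 * a (fst p)))"
    proof -
      have "continuous_on ({0..t} \<times> {0..t}) (\<lambda>p. X (snd p))"
        by (rule continuous_on_compose2[OF contX]) (auto intro!: continuous_intros)
      moreover have "continuous_on ({0..t} \<times> {0..t}) (\<lambda>p. a (fst p))"
        by (rule continuous_on_compose2[OF conta]) (auto intro!: continuous_intros)
      ultimately show ?thesis using a0 by (intro continuous_intros) (auto simp: less_le)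
    qed
    then have "continuous_on ({0..t} \<times> {0..t}) (\<lambda>(x, s). (1 - b * X s) / (2 * a x))"
      by (simp add: case_prod_beta)
    from filterlim_compose[OF riemann_two_point[OF t0 this] N]
    show ?thesis by (simp add: J1_def r_def dA_def)
  qed
  have tele: "(\<Sum>j<N l. a (r l (Suc j)) - a (r l j)) = a t - a 0" if "0 < N l" for l
    using sum_lessThan_telescope[of "\<lambda>j. a (r l j)" "N l"] rN[of l] that by simp
  have decomp: "(\<Sum>j<N l. dI l j / (2 * a (r l j))) = a t - a 0 - (\<Sum>j<N l. R l j)
     + (\<Sum>j<N l. ((dX l j)\<^sup>2 - (y l j)\<^sup>2) / (8 * a (r l j) ^ 3)) + (\<Sum>j<N l. (y l j)\<^sup>2 / (8 * a (r l j) ^ 3))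
     - (\<Sum>j<N l. dA l j / (2 * a (r l j)))" if "0 < N l" for l
  proof -
    have "dI l j / (2 * a (r l j)) = (a (r l (Suc j)) - a (r l j)) - R l j
      + ((dX l j)\<^sup>2 - (y l j)\<^sup>2) / (8 * a (r l j) ^ 3) + (y l j)\<^sup>2 / (8 * a (r l j) ^ 3) - dA l j / (2 * a (r l j))"
      if "j < N l" for j
    proof -
      have "dI l j = dX l j - dA l j" using incX[OF that] by simp
      then show ?thesis by (simp add: R_def diff_divide_distrib)
    qed
    then have "(\<Sum>j<N l. dI l j / (2 * a (r l j))) = (\<Sum>j<N l. (a (r l (Suc j)) - a (r l j)) - R l j
      + ((dX l j)\<^sup>2 - (y l j)\<^sup>2) / (8 * a (r l j) ^ 3) + (y l j)\<^sup>2 / (8 * a (r l j) ^ 3) - dA l j / (2 * a (r l j)))"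
      by simp
    also have "\<dots> = (\<Sum>j<N l. a (r l (Suc j)) - a (r l j)) - (\<Sum>j<N l. R l j)
     + (\<Sum>j<N l. ((dX l j)\<^sup>2 - (y l j)\<^sup>2) / (8 * a (r l j) ^ 3)) + (\<Sum>j<N l. (y l j)\<^sup>2 / (8 * a (r l j) ^ 3))
     - (\<Sum>j<N l. dA l j / (2 * a (r l j)))"
      by (simp only: sum.distrib sum_subtractf)
    finally show ?thesis unfolding tele[OF that] .
  qed
  have "(\<lambda>l. a t - a 0 - (\<Sum>j<N l. R l j)
     + (\<Sum>j<N l. ((dX l j)\<^sup>2 - (y l j)\<^sup>2) / (8 * a (r l j) ^ 3)) + (\<Sum>j<N l. (y l j)\<^sup>2 / (8 * a (r l j) ^ 3))
     - (\<Sum>j<N l. dA l j / (2 * a (r l j)))) \<longlonglongrightarrow> a t - a 0 - 0 + 0 + J2 - J1"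
    using Rlim cross ylim driftlim by (intro tendsto_intros)
  moreover have "\<forall>\<^sub>F l in sequentially. a t - a 0 - (\<Sum>j<N l. R l j)
     + (\<Sum>j<N l. ((dX l j)\<^sup>2 - (y l j)\<^sup>2) / (8 * a (r l j) ^ 3)) + (\<Sum>j<N l. (y l j)\<^sup>2 / (8 * a (r l j) ^ 3))
     - (\<Sum>j<N l. dA l j / (2 * a (r l j))) = (\<Sum>j<N l. dI l j / (2 * a (r l j)))"
    using Npos by eventually_elim (simp only: decomp)
  ultimately have "(\<lambda>l. \<Sum>j<N l. dI l j / (2 * a (r l j))) \<longlonglongrightarrow> a t - a 0 - 0 + 0 + J2 - J1"
    by (rule Lim_transform_eventually)
  then show ?thesis by (simp add: dI_def a_def J1_def J2_def algebra_simps)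
qed

section \<open>The square root of the solution is a reflected path\<close>

text \<open>The integral is an almost sure limit of left Riemann sums, whose summands are
  measurable.\<close>

lemma (in complete_measure) borel_measurable_integral:
  fixes h :: "real \<Rightarrow> 'a \<Rightarrow> real"
  assumes h: "\<And>s. 0 \<le> s \<Longrightarrow> h s \<in> borel_measurable M"
    and cont: "AE \<omega> in M. continuous_on {0..} (\<lambda>s. h s \<omega>)" and uv: "0 \<le> u" "u \<le> v"
  shows "(\<lambda>\<omega>. integral {u..v} (\<lambda>s. h s \<omega>)) \<in> borel_measurable M"
proof -
  have 0: "(\<lambda>\<omega>. integral {0..t} (\<lambda>s. h s \<omega>)) \<in> borel_measurable M" if t: "0 \<le> t" for t
  proof (rule borel_measurable_AE_limit)
    show "(\<lambda>\<omega>. \<Sum>j<N. h (real j * t / real N) \<omega> * (t / real N)) \<in> borel_measurable M" for N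
      using h t by (intro borel_measurable_sum borel_measurable_times) auto
    show "AE \<omega> in M. (\<lambda>N. \<Sum>j<N. h (real j * t / real N) \<omega> * (t / real N)) \<longlonglongrightarrow> integral {0..t} (\<lambda>s. h s \<omega>)"
      using cont
    proof eventually_elim
      fix \<omega> assume "continuous_on {0..} (\<lambda>s. h s \<omega>)"
      then have "continuous_on {0..t} (\<lambda>s. h s \<omega>)" by (rule continuous_on_subset) auto
      from riemann_left_sum[OF t this]
      show "(\<lambda>N. \<Sum>j<N. h (real j * t / real N) \<omega> * (t / real N)) \<longlonglongrightarrow> integral {0..t} (\<lambda>s. h s \<omega>)" .
    qed
  qed
  show ?thesis
  \<comment> \<open>Applied to a constant sequence, the limit lemma transfers measurability across
    an almost sure equality.\<close>
  proof (rule borel_measurable_AE_limit)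
    show "(\<lambda>\<omega>. integral {0..v} (\<lambda>s. h s \<omega>) - integral {0..u} (\<lambda>s. h s \<omega>)) \<in> borel_measurable M" for k :: nat
      using uv by (intro borel_measurable_diff 0) auto
    show "AE \<omega> in M. (\<lambda>k::nat. integral {0..v} (\<lambda>s. h s \<omega>) - integral {0..u} (\<lambda>s. h s \<omega>)) \<longlonglongrightarrow> integral {u..v} (\<lambda>s. h s \<omega>)"
      using cont
    proof eventually_elim
      fix \<omega> assume "continuous_on {0..} (\<lambda>s. h s \<omega>)"
      then have "(\<lambda>s. h s \<omega>) integrable_on {0..v}"
        by (intro integrable_continuous_interval) (auto intro: continuous_on_subset)
      from Henstock_Kurzweil_Integration.integral_combine[OF uv this]
      have "integral {0..v} (\<lambda>s. h s \<omega>) - integral {0..u} (\<lambda>s. h s \<omega>) = integral {u..v} (\<lambda>s. h s \<omega>)" by simp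
      then show "(\<lambda>k::nat. integral {0..v} (\<lambda>s. h s \<omega>) - integral {0..u} (\<lambda>s. h s \<omega>)) \<longlonglongrightarrow> integral {u..v} (\<lambda>s. h s \<omega>)"
        by simp
    qed
  qed
qed

text \<open>The integral of a non-integrable function is \<open>0\<close> by convention. Energies
  are thereby non-negative on exceptional paths too.\<close>

lemma integral_nonneg_real:
  fixes f :: "real \<Rightarrow> real"
  assumes "\<And>x. x \<in> S \<Longrightarrow> 0 \<le> f x"
  shows "0 \<le> integral S f"
proof (cases "f integrable_on S")
  case True
  then show ?thesis using assms by (rule Henstock_Kurzweil_Integration.integral_nonneg)
qed (simp add: not_integrable_integral)

section \<open>Stochastic sums on uniform grids\<close>

context brownian_setting
begin

text \<open>Writes the energy as a sum of integrals over cells with frozen coefficients, the form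
  whose limit under refinement \<open>riemann_two_point\<close> computes.\<close>

lemma ito_lenglart_uniform:
  fixes H :: "real \<Rightarrow> 'a \<Rightarrow> real" and c e :: "nat \<Rightarrow> 'a \<Rightarrow> real" and t :: real and N :: nat
  defines "r \<equiv> \<lambda>j. real j * t / real N"
  defines "V \<equiv> \<lambda>\<omega>. \<Sum>j<N. integral {r j..r (Suc j)} (\<lambda>s. (c j \<omega> * H s \<omega> - e j \<omega>)\<^sup>2)"
  assumes I: "ito_integral M F W H I" and t: "0 < t" and N: "0 < N"
    and mH: "\<And>s. 0 \<le> s \<Longrightarrow> H s \<in> borel_measurable M"
    and contH: "AE \<omega> in M. continuous_on {0..} (\<lambda>s. H s \<omega>)"
    and ce: "\<And>j. j < N \<Longrightarrow> c j \<in> borel_measurable (F (r j))" "\<And>j. j < N \<Longrightarrow> e j \<in> borel_measurable (F (r j))"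
    and C: "\<And>j \<omega>. j < N \<Longrightarrow> \<bar>c j \<omega>\<bar> \<le> C"
  shows "V \<in> borel_measurable M"
    and "expectation (\<lambda>\<omega>. min 1 ((\<Sum>j<N. c j \<omega> * (I (r (Suc j)) \<omega> - I (r j) \<omega>) - e j \<omega> * (W (r (Suc j)) \<omega> - W (r j) \<omega>))\<^sup>2))
      \<le> 4 * expectation (\<lambda>\<omega>. min 1 (V \<omega>))"
    and "expectation (\<lambda>\<omega>. min 1 (\<Sum>j<N. (c j \<omega> * (I (r (Suc j)) \<omega> - I (r j) \<omega>) - e j \<omega> * (W (r (Suc j)) \<omega> - W (r j) \<omega>))\<^sup>2))
      \<le> 4 * expectation (\<lambda>\<omega>. min 1 (V \<omega>))"
proof -
  have mr: "mono r" unfolding r_def by (intro monoI divide_right_mono mult_right_mono) (use t in auto)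
  have r0: "0 \<le> r j" for j using t by (simp add: r_def)
  have rs: "r j \<le> r (Suc j)" for j using monoD[OF mr] by simp
  have rN: "r N \<le> t" using N by (simp add: r_def)
  have mce: "j < N \<Longrightarrow> c j \<in> borel_measurable M" "j < N \<Longrightarrow> e j \<in> borel_measurable M" for j
    using ce measurable_F_M by blast+
  show mV: "V \<in> borel_measurable M"
    unfolding V_def
  proof (rule borel_measurable_sum)
    fix j assume "j \<in> {..<N}"
    then have j: "j < N" by simp
    show "(\<lambda>\<omega>. integral {r j..r (Suc j)} (\<lambda>s. (c j \<omega> * H s \<omega> - e j \<omega>)\<^sup>2)) \<in> borel_measurable M"
    proof (rule borel_measurable_integral[OF _ _ r0 rs])
      show "(\<lambda>\<omega>. (c j \<omega> * H s \<omega> - e j \<omega>)\<^sup>2) \<in> borel_measurable M" if "0 \<le> s" for s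
        using mH[OF that] mce[OF j] by simp
      show "AE \<omega> in M. continuous_on {0..} (\<lambda>s. (c j \<omega> * H s \<omega> - e j \<omega>)\<^sup>2)"
        using contH by eventually_elim (intro continuous_intros)
    qed
  qed
  have V0: "0 \<le> V \<omega>" for \<omega> unfolding V_def by (intro sum_nonneg integral_nonneg_real) simp
  have "AE \<omega> in M. (\<integral>\<^sup>+s. (\<Sum>j<N. ennreal ((c j \<omega> * H s \<omega> - e j \<omega>)\<^sup>2) * indicator {r j<..r (Suc j)} s) \<partial>lborel) \<le> ennreal (V \<omega>)"
    using contH
  proof eventually_elim
    fix \<omega> assume cont: "continuous_on {0..} (\<lambda>s. H s \<omega>)"
    define f where "f j s = (c j \<omega> * H s \<omega> - e j \<omega>)\<^sup>2" for j s
    have cf: "continuous_on {r j..r (Suc j)} (f j)" for j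
      unfolding f_def using cont r0[of j] by (intro continuous_intros) (auto intro: continuous_on_subset)
    have "(\<integral>\<^sup>+s. (\<Sum>j<N. ennreal (f j s) * indicator {r j<..r (Suc j)} s) \<partial>lborel) \<le>
      (\<integral>\<^sup>+s. (\<Sum>j<N. ennreal (f j s) * indicator {r j..r (Suc j)} s) \<partial>lborel)"
      by (intro nn_integral_mono sum_mono mult_left_mono) (auto simp: indicator_def)
    also have "\<dots> = (\<Sum>j<N. \<integral>\<^sup>+s. ennreal (f j s) * indicator {r j..r (Suc j)} s \<partial>lborel)"
    proof (rule nn_integral_sum)
      fix j
      have "(\<lambda>s. indicator {r j..r (Suc j)} s *\<^sub>R f j s) \<in> borel_measurable borel"
        by (rule borel_measurable_continuous_on_indicator) (auto intro: cf)
      then have "(\<lambda>s. ennreal (indicator {r j..r (Suc j)} s *\<^sub>R f j s)) \<in> borel_measurable lborel" by simp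
      also have "(\<lambda>s. ennreal (indicator {r j..r (Suc j)} s *\<^sub>R f j s)) = (\<lambda>s. ennreal (f j s) * indicator {r j..r (Suc j)} s)"
        by (auto simp: indicator_def)
      finally show "(\<lambda>s. ennreal (f j s) * indicator {r j..r (Suc j)} s) \<in> borel_measurable lborel" .
    qed
    also have "\<dots> = (\<Sum>j<N. ennreal (integral {r j..r (Suc j)} (f j)))"
    proof (rule sum.cong[OF refl], rule nn_integral_has_integral_lebesgue')
      fix j
      show "(f j has_integral integral {r j..r (Suc j)} (f j)) {r j..r (Suc j)}"
        using integrable_continuous_interval[OF cf] by (rule integrable_integral)
    qed (simp add: f_def)
    also have "\<dots> = ennreal (V \<omega>)"
      unfolding V_def f_def by (intro sum_ennreal integral_nonneg_real) simp
    finally show "(\<integral>\<^sup>+s. (\<Sum>j<N. ennreal ((c j \<omega> * H s \<omega> - e j \<omega>)\<^sup>2) * indicator {r j<..r (Suc j)} s) \<partial>lborel) \<le> ennreal (V \<omega>)"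
      by (simp only: f_def)
  qed
  note * = ito_lenglart[OF I contH mr r0 rN t ce C mV V0 this]
  show "expectation (\<lambda>\<omega>. min 1 ((\<Sum>j<N. c j \<omega> * (I (r (Suc j)) \<omega> - I (r j) \<omega>) - e j \<omega> * (W (r (Suc j)) \<omega> - W (r j) \<omega>))\<^sup>2))
      \<le> 4 * expectation (\<lambda>\<omega>. min 1 (V \<omega>))" by (rule *(1))
  show "expectation (\<lambda>\<omega>. min 1 (\<Sum>j<N. (c j \<omega> * (I (r (Suc j)) \<omega> - I (r j) \<omega>) - e j \<omega> * (W (r (Suc j)) \<omega> - W (r j) \<omega>))\<^sup>2))
      \<le> 4 * expectation (\<lambda>\<omega>. min 1 (V \<omega>))" by (rule *(2))
qed

text \<open>The isometry for \<open>x\<^sup>2 - h\<close> with \<open>h = t / N\<close>: there are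
  \<open>N\<close> terms, each at most \<open>K\<^sup>2 * (2 * h\<^sup>2)\<close>, so the sum
  vanishes in L2 as the grid is refined.\<close>

lemma weighted_quadratic_variation:
  fixes \<phi> :: "nat \<Rightarrow> 'a \<Rightarrow> real" and t :: real and N :: nat
  defines "r \<equiv> \<lambda>j. real j * t / real N"
  assumes t: "0 < t" and N: "0 < N"
    and \<phi>: "\<And>j. j < N \<Longrightarrow> \<phi> j \<in> borel_measurable (F (r j))"
    and K: "\<And>j \<omega>. j < N \<Longrightarrow> \<bar>\<phi> j \<omega>\<bar> \<le> K"
  shows "integrable M (\<lambda>\<omega>. (\<Sum>j<N. \<phi> j \<omega> * ((W (r (Suc j)) \<omega> - W (r j) \<omega>)\<^sup>2 - t / real N))\<^sup>2)"
    and "expectation (\<lambda>\<omega>. (\<Sum>j<N. \<phi> j \<omega> * ((W (r (Suc j)) \<omega> - W (r j) \<omega>)\<^sup>2 - t / real N))\<^sup>2) \<le> 2 * K\<^sup>2 * t\<^sup>2 / real N"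
proof -
  define h where "h = t / real N"
  define g where "g x = x\<^sup>2 - h" for x :: real
  have mr: "mono r" unfolding r_def by (intro monoI divide_right_mono mult_right_mono) (use t in auto)
  have r0: "0 \<le> r j" for j using t by (simp add: r_def)
  have rs: "r j \<le> r (Suc j)" for j using monoD[OF mr] by simp
  have step: "r (Suc j) - r j = h" for j by (simp add: r_def h_def distrib_right add_divide_distrib)
  note mom = increment_moments[OF r0 rs, unfolded step]
  have i: "integrable M (\<lambda>\<omega>. (g (W (r (Suc q)) \<omega> - W (r q) \<omega>))\<^sup>2)" for q
  proof -
    have "(\<lambda>\<omega>. (g (W (r (Suc q)) \<omega> - W (r q) \<omega>))\<^sup>2) =
      (\<lambda>\<omega>. (W (r (Suc q)) \<omega> - W (r q) \<omega>) ^ 4 - 2 * h * (W (r (Suc q)) \<omega> - W (r q) \<omega>)\<^sup>2 + h\<^sup>2)"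
      by (auto simp: g_def power2_eq_square power4_eq_xxxx algebra_simps)
    then show ?thesis using mom(1)[of q 4] mom(1)[of q 2] by simp
  qed
  have e0: "expectation (\<lambda>\<omega>. g (W (r (Suc q)) \<omega> - W (r q) \<omega>)) = 0" for q
    using mom(1)[of q 2] mom(3)[of q] by (simp add: g_def prob_space)
  have gm: "g \<in> borel_measurable borel" unfolding g_def by measurable
  have \<phi>2: "expectation (\<lambda>\<omega>. (\<phi> j \<omega>)\<^sup>2) \<le> K\<^sup>2" if "j < N" for j
  proof -
    have K2: "(\<phi> j \<omega>)\<^sup>2 \<le> K\<^sup>2" for \<omega> using K[OF that, of \<omega>] by (rule abs_le_square_iff[THEN iffD1, OF order.trans[OF _ abs_ge_self]])
    have [measurable]: "\<phi> j \<in> borel_measurable M" using \<phi>[OF that] measurable_F_M by blast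
    have "expectation (\<lambda>\<omega>. (\<phi> j \<omega>)\<^sup>2) \<le> expectation (\<lambda>_. K\<^sup>2)"
      using K2 by (intro integral_mono integrable_const_bound[where B="K\<^sup>2"]) auto
    then show ?thesis by (simp add: prob_space)
  qed
  note * = expectation_weighted_increments[OF mr r0, of "{..<N}" \<phi> "\<lambda>_. K" "\<lambda>_. g"]
  show "integrable M (\<lambda>\<omega>. (\<Sum>j<N. \<phi> j \<omega> * ((W (r (Suc j)) \<omega> - W (r j) \<omega>)\<^sup>2 - t / real N))\<^sup>2)"
    using *(1) \<phi> K gm i e0 by (simp add: g_def h_def)
  have "expectation (\<lambda>\<omega>. (\<Sum>j<N. \<phi> j \<omega> * g (W (r (Suc j)) \<omega> - W (r j) \<omega>))\<^sup>2) =
    (\<Sum>j<N. expectation (\<lambda>\<omega>. (\<phi> j \<omega>)\<^sup>2) * expectation (\<lambda>\<omega>. (g (W (r (Suc j)) \<omega> - W (r j) \<omega>))\<^sup>2))"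
    using \<phi> K gm i e0 by (intro *(2)) auto
  also have "\<dots> \<le> (\<Sum>j<N. K\<^sup>2 * (2 * h\<^sup>2))"
    using \<phi>2 mom(4) by (intro sum_mono mult_mono) (auto simp: g_def)
  also have "\<dots> = 2 * K\<^sup>2 * t\<^sup>2 / real N"
    using N by (simp add: h_def power2_eq_square)
  finally show "expectation (\<lambda>\<omega>. (\<Sum>j<N. \<phi> j \<omega> * ((W (r (Suc j)) \<omega> - W (r j) \<omega>)\<^sup>2 - t / real N))\<^sup>2) \<le> 2 * K\<^sup>2 * t\<^sup>2 / real N"
    by (simp add: g_def h_def)
qed

end

section \<open>The smoothed square root of the solution\<close>

locale cir_setting = brownian_setting M F W
  for M :: "'a measure" and F W +
  fixes X I :: "real \<Rightarrow> 'a \<Rightarrow> real" and b x0 :: real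
  assumes x0: "0 \<le> x0" and adapted_X: "adapted F X" and cont_X: "continuous_paths M X"
    and X_0: "AE \<omega> in M. X 0 \<omega> = x0" and X_nonneg: "AE \<omega> in M. \<forall>t\<ge>0. 0 \<le> X t \<omega>"
    and ito_I: "ito_integral M F W (\<lambda>t \<omega>. 2 * sqrt (X t \<omega>)) I"
    and X_eq: "AE \<omega> in M. \<forall>t\<ge>0. X t \<omega> = x0 + integral {0..t} (\<lambda>s. 1 - b * X s \<omega>) + I t \<omega>"
begin

lemma X_measurable_F: "0 \<le> t \<Longrightarrow> X t \<in> borel_measurable (F t)"
  using adapted_X by (auto simp: adapted_def)

lemma X_measurable: "0 \<le> t \<Longrightarrow> X t \<in> borel_measurable M"
  using X_measurable_F measurable_F_M by blast

lemma I_measurable: "0 \<le> t \<Longrightarrow> I t \<in> borel_measurable M"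
  using ito_I measurable_F_M unfolding ito_integral_def adapted_def by blast

lemma W_0: "AE \<omega> in M. W 0 \<omega> = 0" and cont_W: "AE \<omega> in M. continuous_on {0..} (\<lambda>t. W t \<omega>)"
  using brownian_motion_W by (auto simp: brownian_motion_def continuous_paths_def)

lemma X_cont: "AE \<omega> in M. continuous_on {0..} (\<lambda>t. X t \<omega>)"
  using cont_X by (simp add: continuous_paths_def)

lemma H_cont: "AE \<omega> in M. continuous_on {0..} (\<lambda>t. 2 * sqrt (X t \<omega>))"
  using X_cont by eventually_elim (intro continuous_intros)

text \<open>By Ito's formula this is the stochastic integral of
  \<open>sqrt X / sqrt (X + \<epsilon>) - 1\<close> with respect to \<open>W\<close>, expressed
  through the path so that it is defined for every outcome.\<close>

definition D :: "real \<Rightarrow> real \<Rightarrow> 'a \<Rightarrow> real" where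
  "D \<epsilon> t \<omega> = sqrt (X t \<omega> + \<epsilon>) - sqrt (X 0 \<omega> + \<epsilon>)
      - integral {0..t} (\<lambda>s. (1 - b * X s \<omega>) / (2 * sqrt (X s \<omega> + \<epsilon>)))
      + integral {0..t} (\<lambda>s. X s \<omega> / (2 * sqrt (X s \<omega> + \<epsilon>) ^ 3)) - W t \<omega>"

text \<open>Quadratic variation of the martingale \<open>D\<close>.\<close>

definition V :: "real \<Rightarrow> real \<Rightarrow> 'a \<Rightarrow> real" where
  "V \<epsilon> t \<omega> = integral {0..t} (\<lambda>s. (sqrt (X s \<omega>) / sqrt (X s \<omega> + \<epsilon>) - 1)\<^sup>2)"

text \<open>The hypotheses of \<open>ito_sqrt_path\<close> hold in probability on uniform grids,
  hence almost surely along a subsequence, on which the discretised martingale part minus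
  \<open>W\<close> tends to \<open>D\<close>. The Lenglart bound for the discretisation then passes
  to the limit. The scale \<open>\<eta>\<close> is free: 1 when \<open>V\<close> is known to vanish,
  a small factor when it is only known to be bounded.\<close>

lemma smoothed_sqrt_estimate:
  assumes t: "0 < t" and \<epsilon>: "0 < \<epsilon>"
  shows "D \<epsilon> t \<in> borel_measurable M" "V \<epsilon> t \<in> borel_measurable M"
    and "\<And>\<eta>. expectation (\<lambda>\<omega>. min 1 ((\<eta> * D \<epsilon> t \<omega>)\<^sup>2)) \<le> 4 * expectation (\<lambda>\<omega>. min 1 (\<eta>\<^sup>2 * V \<epsilon> t \<omega>))"
proof -
  define r where "r N j = real j * t / real N" for N j :: nat
  define H where "H s \<omega> = 2 * sqrt (X s \<omega>)" for s \<omega>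
  \<comment> \<open>The positive part equals \<open>X\<close> almost surely, but bounds the
    coefficients \<open>c\<close> and \<open>B\<close> for every outcome, as the stochastic
    estimates demand.\<close>
  define P where "P s \<omega> = max 0 (X s \<omega>)" for s \<omega>
  have I: "ito_integral M F W H I" using ito_I by (simp add: H_def[abs_def])
  have mH: "0 \<le> s \<Longrightarrow> H s \<in> borel_measurable M" for s
    unfolding H_def using X_measurable by (intro borel_measurable_times borel_measurable_const borel_measurable_sqrt) auto
  have cH: "AE \<omega> in M. continuous_on {0..} (\<lambda>s. H s \<omega>)" using H_cont by (simp add: H_def)
  have r0: "0 \<le> r N j" for N j using t by (simp add: r_def)
  have mXr: "X (r N j) \<in> borel_measurable (F (r N j))" for N j using X_measurable_F r0 by blast
  have mHr: "H (r N j) \<in> borel_measurable (F (r N j))" for N j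
    unfolding H_def using mXr by measurable
  define c where "c N j \<omega> = 1 / (2 * sqrt (P (r N j) \<omega> + \<epsilon>))" for N j \<omega>
  have mc: "c N j \<in> borel_measurable (F (r N j))" for N j
    unfolding c_def P_def using mXr by measurable
  have cC: "\<bar>c N j \<omega>\<bar> \<le> 1 / (2 * sqrt \<epsilon>)" for N j \<omega>
  proof -
    have "2 * sqrt \<epsilon> \<le> 2 * sqrt (P (r N j) \<omega> + \<epsilon>)" "0 < sqrt \<epsilon>" using \<epsilon> by (auto simp: P_def)
    moreover have "0 < sqrt (P (r N j) \<omega> + \<epsilon>)" using \<epsilon> by (auto simp: P_def add_nonneg_pos)
    ultimately show ?thesis unfolding c_def by (auto intro!: divide_left_mono mult_pos_pos)
  qed
  define B where "B N j \<omega> = P (r N j) \<omega> / sqrt (P (r N j) \<omega> + \<epsilon>) ^ 3" for N j \<omega>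
  have mB: "B N j \<in> borel_measurable (F (r N j))" for N j
    unfolding B_def P_def using mXr by measurable
  have BC: "\<bar>B N j \<omega>\<bar> \<le> 1 / sqrt \<epsilon>" for N j \<omega>
  proof -
    define x where "x = P (r N j) \<omega>"
    have x: "0 \<le> x" by (simp add: x_def P_def)
    have s: "0 < sqrt (x + \<epsilon>)" "(sqrt (x + \<epsilon>))\<^sup>2 = x + \<epsilon>" "sqrt \<epsilon> \<le> sqrt (x + \<epsilon>)" "0 < sqrt \<epsilon>" using x \<epsilon> by auto
    have "x / sqrt (x + \<epsilon>) ^ 3 \<le> (sqrt (x + \<epsilon>))\<^sup>2 / sqrt (x + \<epsilon>) ^ 3"
      using x \<epsilon> s by (intro divide_right_mono) auto
    also have "\<dots> = 1 / sqrt (x + \<epsilon>)" using s(1) by (simp add: power2_eq_square power3_eq_cube)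
    also have "\<dots> \<le> 1 / sqrt \<epsilon>" using s by (intro divide_left_mono mult_pos_pos) auto
    finally show ?thesis using x s(1) by (simp add: B_def x_def)
  qed
  define dW where "dW N j \<omega> = W (r N (Suc j)) \<omega> - W (r N j) \<omega>" for N j \<omega>
  define dI where "dI N j \<omega> = I (r N (Suc j)) \<omega> - I (r N j) \<omega>" for N j \<omega>
  have mdW: "dW N j \<in> borel_measurable M" and mdI: "dI N j \<in> borel_measurable M" for N j
    unfolding dW_def dI_def using r0 W_measurable I_measurable by (auto intro!: borel_measurable_diff)
  define S1 where "S1 N \<omega> = (\<Sum>j<N. (1 * dI N j \<omega> - H (r N j) \<omega> * dW N j \<omega>)\<^sup>2)" for N \<omega>
  define S2 where "S2 N \<omega> = (\<Sum>j<N. B N j \<omega> * ((dW N j \<omega>)\<^sup>2 - t / real N))\<^sup>2" for N \<omega>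
  define S3 where "S3 N \<omega> = (\<Sum>j<N. 1 * ((dW N j \<omega>)\<^sup>2 - t / real N))\<^sup>2" for N \<omega>
  have mBM: "B N j \<in> borel_measurable M" and mHM: "H (r N j) \<in> borel_measurable M" and mcM: "c N j \<in> borel_measurable M" for N j
    using mB mHr mc measurable_F_M by blast+
  have mS: "S1 N \<in> borel_measurable M" "S2 N \<in> borel_measurable M" "S3 N \<in> borel_measurable M" for N
    unfolding S1_def S2_def S3_def using mdW mdI mBM mHM
    by (auto intro!: borel_measurable_sum borel_measurable_power borel_measurable_times borel_measurable_diff)
  have S0: "0 \<le> S1 N \<omega>" "0 \<le> S2 N \<omega>" "0 \<le> S3 N \<omega>" for N \<omega>
    unfolding S1_def S2_def S3_def by (auto intro: sum_nonneg)
  have contXt: "continuous_on {0..t} (\<lambda>s. X s \<omega>)" if "continuous_on {0..} (\<lambda>s. X s \<omega>)" for \<omega>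
    using that by (rule continuous_on_subset) auto
  have cfst: "continuous_on ({0..t} \<times> {0..t}) (\<lambda>p. X (fst p) \<omega>)" "continuous_on ({0..t} \<times> {0..t}) (\<lambda>p. X (snd p) \<omega>)"
    if "continuous_on {0..} (\<lambda>s. X s \<omega>)" for \<omega>
    by (rule continuous_on_compose2[OF contXt[OF that]]; auto intro!: continuous_intros)+
  define V1 where "V1 N \<omega> = (\<Sum>j<N. integral {r N j..r N (Suc j)} (\<lambda>s. (1 * H s \<omega> - H (r N j) \<omega>)\<^sup>2))" for N \<omega>
  have V1: "V1 N \<in> borel_measurable M" "expectation (\<lambda>\<omega>. min 1 (S1 N \<omega>)) \<le> 4 * expectation (\<lambda>\<omega>. min 1 (V1 N \<omega>))"
    if N: "0 < N" for N
    unfolding V1_def S1_def dI_def dW_def r_def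
    by (rule ito_lenglart_uniform(1)[OF I t N mH cH, where C = 1] ito_lenglart_uniform(3)[OF I t N mH cH, where C = 1];
        use mHr[of N] in \<open>simp add: r_def\<close>)+
  have V1lim: "AE \<omega> in M. (\<lambda>N. V1 N \<omega>) \<longlonglongrightarrow> 0"
    using X_cont
  proof eventually_elim
    fix \<omega> assume cont: "continuous_on {0..} (\<lambda>s. X s \<omega>)"
    have "continuous_on ({0..t} \<times> {0..t}) (\<lambda>(x, y). (1 * H y \<omega> - H x \<omega>)\<^sup>2)"
      unfolding case_prod_beta H_def by (intro continuous_intros cfst[OF cont])
    from riemann_two_point[OF less_imp_le[OF t] this]
    show "(\<lambda>N. V1 N \<omega>) \<longlonglongrightarrow> 0" by (simp add: V1_def r_def)
  qed
  have ev: "\<forall>\<^sub>F N in sequentially. 0 < (N::nat)" by (rule eventually_gt_at_top)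
  have V10: "0 \<le> V1 N \<omega>" for N \<omega> unfolding V1_def by (intro sum_nonneg integral_nonneg_real) simp
  have E1: "(\<lambda>N. expectation (\<lambda>\<omega>. min 1 (S1 N \<omega>))) \<longlonglongrightarrow> 0"
  proof (rule tendsto_sandwich[OF _ _ tendsto_const])
    \<comment> \<open>Shifted because measurability of \<open>V1\<close> is established for a
      positive number of cells.\<close>
    have "(\<lambda>N. expectation (\<lambda>\<omega>. min 1 (V1 (Suc N) \<omega>))) \<longlonglongrightarrow> expectation (\<lambda>\<omega>. min 1 0)"
      using V1lim by (intro tendsto_expectation_min_1 V1 V10) (auto elim!: eventually_mono intro: LIMSEQ_Suc)
    then have "(\<lambda>N. expectation (\<lambda>\<omega>. min 1 (V1 N \<omega>))) \<longlonglongrightarrow> 0" by (subst (asm) filterlim_sequentially_Suc) simp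
    then show "(\<lambda>N. 4 * expectation (\<lambda>\<omega>. min 1 (V1 N \<omega>))) \<longlonglongrightarrow> 0" by (rule tendsto_mult_right_zero)
    show "\<forall>\<^sub>F N in sequentially. expectation (\<lambda>\<omega>. min 1 (S1 N \<omega>)) \<le> 4 * expectation (\<lambda>\<omega>. min 1 (V1 N \<omega>))"
      using ev by eventually_elim (rule V1(2))
    show "\<forall>\<^sub>F N in sequentially. 0 \<le> expectation (\<lambda>\<omega>. min 1 (S1 N \<omega>))" using S0 by (simp add: always_eventually)
  qed
  have QV: "(\<lambda>N. expectation (\<lambda>\<omega>. min 1 ((\<Sum>j<N. \<phi> N j \<omega> * ((dW N j \<omega>)\<^sup>2 - t / real N))\<^sup>2))) \<longlonglongrightarrow> 0"
    if \<phi>: "\<And>N j. \<phi> N j \<in> borel_measurable (F (r N j))" "\<And>N j \<omega>. \<bar>\<phi> N j \<omega>\<bar> \<le> K" for \<phi> :: "nat \<Rightarrow> nat \<Rightarrow> 'a \<Rightarrow> real" and K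
  proof (rule tendsto_sandwich[OF _ _ tendsto_const])
    show "(\<lambda>N. 2 * K\<^sup>2 * t\<^sup>2 / real N) \<longlonglongrightarrow> 0"
      by (intro tendsto_divide_0[OF tendsto_const] filterlim_at_top_imp_at_infinity filterlim_real_sequentially)
    show "\<forall>\<^sub>F N in sequentially. expectation (\<lambda>\<omega>. min 1 ((\<Sum>j<N. \<phi> N j \<omega> * ((dW N j \<omega>)\<^sup>2 - t / real N))\<^sup>2)) \<le> 2 * K\<^sup>2 * t\<^sup>2 / real N"
      using ev
    proof eventually_elim
      fix N :: nat assume N: "0 < N"
      let ?S = "\<lambda>\<omega>. (\<Sum>j<N. \<phi> N j \<omega> * ((dW N j \<omega>)\<^sup>2 - t / real N))\<^sup>2"
      have i: "integrable M ?S" and e: "expectation ?S \<le> 2 * K\<^sup>2 * t\<^sup>2 / real N"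
        unfolding dW_def r_def
        using \<phi>[of N, unfolded r_def]
        by (auto intro!: weighted_quadratic_variation[OF t N, of "\<phi> N" K] simp del: of_nat_Suc)
      have "expectation (\<lambda>\<omega>. min 1 (?S \<omega>)) \<le> expectation ?S"
        using i by (intro integral_mono integrable_min_1) auto
      then show "expectation (\<lambda>\<omega>. min 1 (?S \<omega>)) \<le> 2 * K\<^sup>2 * t\<^sup>2 / real N" using e by linarith
    qed
    show "\<forall>\<^sub>F N in sequentially. 0 \<le> expectation (\<lambda>\<omega>. min 1 ((\<Sum>j<N. \<phi> N j \<omega> * ((dW N j \<omega>)\<^sup>2 - t / real N))\<^sup>2))"
      by (simp add: always_eventually)
  qed
  have E2: "(\<lambda>N. expectation (\<lambda>\<omega>. min 1 (S2 N \<omega>))) \<longlonglongrightarrow> 0"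
    unfolding S2_def by (rule QV[of B, OF mB BC])
  have E3: "(\<lambda>N. expectation (\<lambda>\<omega>. min 1 (S3 N \<omega>))) \<longlonglongrightarrow> 0"
    unfolding S3_def by (rule QV[of "\<lambda>_ _ _. 1" 1]) auto
  \<comment> \<open>\<open>S1\<close>, \<open>S2\<close> and \<open>S3\<close> correspond to
    \<open>\<Delta>\<close>, \<open>Q\<close> and \<open>Q'\<close> of \<open>ito_sqrt_path\<close>;
    adding them yields one subsequence for all three.\<close>
  have "(\<lambda>N. expectation (\<lambda>\<omega>. min 1 (S1 N \<omega> + S2 N \<omega> + S3 N \<omega>))) \<longlonglongrightarrow> 0"
  proof (rule tendsto_sandwich[OF _ _ tendsto_const])
    show "(\<lambda>N. expectation (\<lambda>\<omega>. min 1 (S1 N \<omega>)) + expectation (\<lambda>\<omega>. min 1 (S2 N \<omega>)) + expectation (\<lambda>\<omega>. min 1 (S3 N \<omega>))) \<longlonglongrightarrow> 0"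
      using tendsto_add[OF tendsto_add[OF E1 E2] E3] by simp
    have i: "integrable M (\<lambda>\<omega>. min 1 (S1 N \<omega>))" "integrable M (\<lambda>\<omega>. min 1 (S2 N \<omega>))" "integrable M (\<lambda>\<omega>. min 1 (S3 N \<omega>))" for N
      by (intro integrable_min_1 mS S0)+
    have "expectation (\<lambda>\<omega>. min 1 (S1 N \<omega> + S2 N \<omega> + S3 N \<omega>)) \<le> expectation (\<lambda>\<omega>. min 1 (S1 N \<omega>) + min 1 (S2 N \<omega>) + min 1 (S3 N \<omega>))" for N
    proof (rule integral_mono)
      show "integrable M (\<lambda>\<omega>. min 1 (S1 N \<omega> + S2 N \<omega> + S3 N \<omega>))"
        using mS S0 by (intro integrable_min_1) auto
      fix \<omega> show "min 1 (S1 N \<omega> + S2 N \<omega> + S3 N \<omega>) \<le> min 1 (S1 N \<omega>) + min 1 (S2 N \<omega>) + min 1 (S3 N \<omega>)"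
        using S0[of N \<omega>] by linarith
    qed (use i in auto)
    then show "\<forall>\<^sub>F N in sequentially. expectation (\<lambda>\<omega>. min 1 (S1 N \<omega> + S2 N \<omega> + S3 N \<omega>)) \<le>
       expectation (\<lambda>\<omega>. min 1 (S1 N \<omega>)) + expectation (\<lambda>\<omega>. min 1 (S2 N \<omega>)) + expectation (\<lambda>\<omega>. min 1 (S3 N \<omega>))"
      using i by (simp add: always_eventually)
    show "\<forall>\<^sub>F N in sequentially. 0 \<le> expectation (\<lambda>\<omega>. min 1 (S1 N \<omega> + S2 N \<omega> + S3 N \<omega>))"
      using S0 by (simp add: always_eventually add_nonneg_nonneg)
  qed
  then obtain \<rho> :: "nat \<Rightarrow> nat" where \<rho>: "strict_mono \<rho>"
    and lim: "AE \<omega> in M. (\<lambda>l. S1 (\<rho> l) \<omega> + S2 (\<rho> l) \<omega> + S3 (\<rho> l) \<omega>) \<longlonglongrightarrow> 0"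
  proof (rule AE_subseq_of_expectation_min_1[rotated 2])
    show "(\<lambda>\<omega>. S1 N \<omega> + S2 N \<omega> + S3 N \<omega>) \<in> borel_measurable M" for N using mS by simp
    show "0 \<le> S1 N \<omega> + S2 N \<omega> + S3 N \<omega>" for N \<omega> using S0 by (simp add: add_nonneg_nonneg)
  qed (rule that)
  \<comment> \<open>Discretised martingale part of \<open>sqrt (X + \<epsilon>)\<close> minus
    \<open>W\<close>; the increments \<open>dW\<close> telescope to \<open>W t\<close> since
    \<open>W\<close> starts at \<open>0\<close>.\<close>
  define Mg where "Mg N \<omega> = (\<Sum>j<N. c N j \<omega> * dI N j \<omega> - 1 * dW N j \<omega>)" for N \<omega>
  have \<rho>top: "filterlim \<rho> at_top sequentially" using \<rho> by (rule filterlim_subseq)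
  have \<rho>pos: "\<forall>\<^sub>F l in sequentially. 0 < \<rho> l"
    using \<rho>top[unfolded filterlim_at_top, rule_format, of 1] by eventually_elim simp
  have MD: "AE \<omega> in M. (\<lambda>l. Mg (\<rho> l) \<omega>) \<longlonglongrightarrow> D \<epsilon> t \<omega>"
    using lim X_cont X_nonneg X_eq X_0 W_0
  proof eventually_elim
    fix \<omega> assume lim: "(\<lambda>l. S1 (\<rho> l) \<omega> + S2 (\<rho> l) \<omega> + S3 (\<rho> l) \<omega>) \<longlonglongrightarrow> 0"
      and cont: "continuous_on {0..} (\<lambda>s. X s \<omega>)" and nn: "\<forall>t\<ge>0. 0 \<le> X t \<omega>"
      and eq: "\<forall>t\<ge>0. X t \<omega> = x0 + integral {0..t} (\<lambda>s. 1 - b * X s \<omega>) + I t \<omega>"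
      and X0: "X 0 \<omega> = x0" and W0: "W 0 \<omega> = 0"
    have P: "P (r N j) \<omega> = X (r N j) \<omega>" for N j using nn r0 by (simp add: P_def max_def)
    have S1l: "(\<lambda>l. S1 (\<rho> l) \<omega>) \<longlonglongrightarrow> 0" and S2l: "(\<lambda>l. S2 (\<rho> l) \<omega>) \<longlonglongrightarrow> 0" and S3l: "(\<lambda>l. S3 (\<rho> l) \<omega>) \<longlonglongrightarrow> 0"
      by (rule tendsto_sandwich[OF _ _ tendsto_const lim]; use S0 in \<open>simp add: always_eventually add_nonneg_nonneg\<close>)+
    have "(\<lambda>l. \<Sum>j<\<rho> l. 1 / (2 * sqrt (X (real j * t / real (\<rho> l)) \<omega> + \<epsilon>)) * (I (real (Suc j) * t / real (\<rho> l)) \<omega> - I (real j * t / real (\<rho> l)) \<omega>))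
      \<longlonglongrightarrow> sqrt (X t \<omega> + \<epsilon>) - sqrt (X 0 \<omega> + \<epsilon>)
      - integral {0..t} (\<lambda>s. (1 - b * X s \<omega>) / (2 * sqrt (X s \<omega> + \<epsilon>)))
      + integral {0..t} (\<lambda>s. X s \<omega> / (2 * sqrt (X s \<omega> + \<epsilon>) ^ 3))"
    proof (rule ito_sqrt_path[OF t \<epsilon> contXt[OF cont] _ _ \<rho>top, where W = "\<lambda>s. W s \<omega>"])
      show "0 \<le> X s \<omega>" if "s \<in> {0..t}" for s using nn that by simp
      show "X s \<omega> = X 0 \<omega> + integral {0..s} (\<lambda>u. 1 - b * X u \<omega>) + I s \<omega>" if "s \<in> {0..t}" for s
        using eq X0 that by simp
      show "(\<lambda>l. \<Sum>j<\<rho> l. (I (real (Suc j) * t / real (\<rho> l)) \<omega> - I (real j * t / real (\<rho> l)) \<omega> -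
          2 * sqrt (X (real j * t / real (\<rho> l)) \<omega>) * (W (real (Suc j) * t / real (\<rho> l)) \<omega> - W (real j * t / real (\<rho> l)) \<omega>))\<^sup>2) \<longlonglongrightarrow> 0"
        using S1l by (simp add: S1_def dI_def dW_def H_def r_def)
      have "(\<lambda>l. \<Sum>j<\<rho> l. B (\<rho> l) j \<omega> * ((dW (\<rho> l) j \<omega>)\<^sup>2 - t / real (\<rho> l))) \<longlonglongrightarrow> 0"
        using S2l unfolding S2_def by (simp add: power_tendsto_0_iff)
      then show "(\<lambda>l. \<Sum>j<\<rho> l. X (real j * t / real (\<rho> l)) \<omega> / sqrt (X (real j * t / real (\<rho> l)) \<omega> + \<epsilon>) ^ 3 *
          ((W (real (Suc j) * t / real (\<rho> l)) \<omega> - W (real j * t / real (\<rho> l)) \<omega>)\<^sup>2 - t / real (\<rho> l))) \<longlonglongrightarrow> 0"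
        unfolding B_def P by (simp add: dW_def r_def)
      show "(\<lambda>l. \<Sum>j<\<rho> l. (W (real (Suc j) * t / real (\<rho> l)) \<omega> - W (real j * t / real (\<rho> l)) \<omega>)\<^sup>2 - t / real (\<rho> l)) \<longlonglongrightarrow> 0"
        using S3l unfolding S3_def by (simp add: dW_def r_def power_tendsto_0_iff)
    qed
    then have 1: "(\<lambda>l. (\<Sum>j<\<rho> l. c (\<rho> l) j \<omega> * dI (\<rho> l) j \<omega>) - W t \<omega>) \<longlonglongrightarrow> D \<epsilon> t \<omega>"
      unfolding D_def c_def P dI_def unfolding r_def by (intro tendsto_diff tendsto_const)
    have "\<forall>\<^sub>F l in sequentially. (\<Sum>j<\<rho> l. c (\<rho> l) j \<omega> * dI (\<rho> l) j \<omega>) - W t \<omega> = Mg (\<rho> l) \<omega>"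
      using \<rho>pos
    proof eventually_elim
      fix l assume "0 < \<rho> l"
      then have "(\<Sum>j<\<rho> l. dW (\<rho> l) j \<omega>) = W t \<omega>"
        using sum_lessThan_telescope[of "\<lambda>j. W (r (\<rho> l) j) \<omega>" "\<rho> l"] W0 by (simp add: dW_def r_def)
      then show "(\<Sum>j<\<rho> l. c (\<rho> l) j \<omega> * dI (\<rho> l) j \<omega>) - W t \<omega> = Mg (\<rho> l) \<omega>"
        by (simp add: Mg_def sum_subtractf)
    qed
    with 1 show "(\<lambda>l. Mg (\<rho> l) \<omega>) \<longlonglongrightarrow> D \<epsilon> t \<omega>" by (rule Lim_transform_eventually)
  qed
  have mMg: "Mg N \<in> borel_measurable M" for N
    unfolding Mg_def using mcM mdI mdW by (intro borel_measurable_sum borel_measurable_diff borel_measurable_times) auto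
  show mD: "D \<epsilon> t \<in> borel_measurable M" by (rule borel_measurable_AE_limit[OF mMg MD])
  have pos\<epsilon>: "0 < P s \<omega> + \<epsilon>" for s \<omega> using \<epsilon> by (simp add: P_def add_nonneg_pos)
  show mV: "V \<epsilon> t \<in> borel_measurable M"
    unfolding V_def
  proof (rule borel_measurable_integral)
    show "(\<lambda>\<omega>. (sqrt (X s \<omega>) / sqrt (X s \<omega> + \<epsilon>) - 1)\<^sup>2) \<in> borel_measurable M" if "0 \<le> s" for s
      using X_measurable[OF that] by measurable
    show "AE \<omega> in M. continuous_on {0..} (\<lambda>s. (sqrt (X s \<omega>) / sqrt (X s \<omega> + \<epsilon>) - 1)\<^sup>2)"
      using X_cont X_nonneg
    proof eventually_elim
      fix \<omega> assume "continuous_on {0..} (\<lambda>s. X s \<omega>)" "\<forall>t\<ge>0. 0 \<le> X t \<omega>"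
      moreover from this(2) \<epsilon> have "X s \<omega> + \<epsilon> \<noteq> 0" if "0 \<le> s" for s using that by (smt (verit))
      ultimately show "continuous_on {0..} (\<lambda>s. (sqrt (X s \<omega>) / sqrt (X s \<omega> + \<epsilon>) - 1)\<^sup>2)"
        by (intro continuous_intros) auto
    qed
  qed (use t in auto)
  have V0: "0 \<le> V \<epsilon> t \<omega>" for \<omega> unfolding V_def by (rule integral_nonneg_real) simp
  fix \<eta> :: real
  define VN where "VN N \<omega> = (\<Sum>j<N. integral {r N j..r N (Suc j)} (\<lambda>s. (\<eta> * c N j \<omega> * H s \<omega> - \<eta>)\<^sup>2))" for N \<omega>
  have c\<eta>: "\<bar>\<eta> * c N j \<omega>\<bar> \<le> \<bar>\<eta>\<bar> * (1 / (2 * sqrt \<epsilon>))" for N j \<omega>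
    unfolding abs_mult using cC by (intro mult_left_mono) auto
  have mc\<eta>: "(\<lambda>\<omega>. \<eta> * c N j \<omega>) \<in> borel_measurable (F (r N j))" for N j using mc by measurable
  have VN: "VN N \<in> borel_measurable M"
    "expectation (\<lambda>\<omega>. min 1 ((\<Sum>j<N. \<eta> * c N j \<omega> * dI N j \<omega> - \<eta> * dW N j \<omega>)\<^sup>2)) \<le> 4 * expectation (\<lambda>\<omega>. min 1 (VN N \<omega>))"
    if N: "0 < N" for N
    unfolding VN_def dI_def dW_def r_def
    by (rule ito_lenglart_uniform(1)[OF I t N mH cH, where C = "\<bar>\<eta>\<bar> * (1 / (2 * sqrt \<epsilon>))"]
          ito_lenglart_uniform(2)[OF I t N mH cH, where C = "\<bar>\<eta>\<bar> * (1 / (2 * sqrt \<epsilon>))"];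
        (rule c\<eta> | use mc\<eta>[of N] in \<open>simp add: r_def\<close>))+
  have VN0: "0 \<le> VN N \<omega>" for N \<omega> unfolding VN_def by (intro sum_nonneg integral_nonneg_real) simp
  have VNlim: "AE \<omega> in M. (\<lambda>N. VN N \<omega>) \<longlonglongrightarrow> \<eta>\<^sup>2 * V \<epsilon> t \<omega>"
    using X_cont X_nonneg
  proof eventually_elim
    fix \<omega> assume cont: "continuous_on {0..} (\<lambda>s. X s \<omega>)" and nn: "\<forall>t\<ge>0. 0 \<le> X t \<omega>"
    have P: "P s \<omega> = X s \<omega>" if "0 \<le> s" for s using nn that by (simp add: P_def max_def)
    have "continuous_on ({0..t} \<times> {0..t}) (\<lambda>(x, y). (\<eta> * (1 / (2 * sqrt (P x \<omega> + \<epsilon>))) * H y \<omega> - \<eta>)\<^sup>2)"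
      unfolding case_prod_beta H_def P_def
      using pos\<epsilon>[unfolded P_def] by (intro continuous_intros cfst[OF cont]) (auto simp: less_le)
    from riemann_two_point[OF less_imp_le[OF t] this]
    have "(\<lambda>N. VN N \<omega>) \<longlonglongrightarrow> integral {0..t} (\<lambda>s. (\<eta> * (1 / (2 * sqrt (P s \<omega> + \<epsilon>))) * H s \<omega> - \<eta>)\<^sup>2)"
      by (simp add: VN_def r_def c_def)
    also have "integral {0..t} (\<lambda>s. (\<eta> * (1 / (2 * sqrt (P s \<omega> + \<epsilon>))) * H s \<omega> - \<eta>)\<^sup>2) =
      integral {0..t} (\<lambda>s. \<eta>\<^sup>2 * (sqrt (X s \<omega>) / sqrt (X s \<omega> + \<epsilon>) - 1)\<^sup>2)"
    proof (rule Henstock_Kurzweil_Integration.integral_cong)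
      fix s assume s: "s \<in> {0..t}"
      have "\<eta> * (1 / (2 * sqrt (P s \<omega> + \<epsilon>))) * H s \<omega> - \<eta> = \<eta> * (sqrt (X s \<omega>) / sqrt (X s \<omega> + \<epsilon>) - 1)"
        using P[of s] s by (simp add: H_def algebra_simps)
      then show "(\<eta> * (1 / (2 * sqrt (P s \<omega> + \<epsilon>))) * H s \<omega> - \<eta>)\<^sup>2 = \<eta>\<^sup>2 * (sqrt (X s \<omega>) / sqrt (X s \<omega> + \<epsilon>) - 1)\<^sup>2"
        by (simp only: power_mult_distrib)
    qed
    also have "\<dots> = \<eta>\<^sup>2 * V \<epsilon> t \<omega>" by (simp add: V_def)
    finally show "(\<lambda>N. VN N \<omega>) \<longlonglongrightarrow> \<eta>\<^sup>2 * V \<epsilon> t \<omega>" .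
  qed
  \<comment> \<open>\<open>\<rho> 0\<close> may be \<open>0\<close>; the shifted subsequence has
    positive grid sizes throughout.\<close>
  have \<rho>S: "filterlim (\<lambda>l. \<rho> (Suc l)) sequentially sequentially"
    using \<rho>top by (simp add: filterlim_sequentially_Suc)
  have \<rho>Spos: "0 < \<rho> (Suc l)" for l using seq_suble[OF \<rho>, of "Suc l"] by simp
  have eqM: "(\<Sum>j<N. \<eta> * c N j \<omega> * dI N j \<omega> - \<eta> * dW N j \<omega>) = \<eta> * Mg N \<omega>" for N \<omega>
    by (simp add: Mg_def sum_distrib_left right_diff_distrib mult.assoc)
  have L1: "(\<lambda>l. expectation (\<lambda>\<omega>. min 1 ((\<eta> * Mg (\<rho> (Suc l)) \<omega>)\<^sup>2))) \<longlonglongrightarrow> expectation (\<lambda>\<omega>. min 1 ((\<eta> * D \<epsilon> t \<omega>)\<^sup>2))"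
  proof (rule tendsto_expectation_min_1)
    show "AE \<omega> in M. (\<lambda>l. (\<eta> * Mg (\<rho> (Suc l)) \<omega>)\<^sup>2) \<longlonglongrightarrow> (\<eta> * D \<epsilon> t \<omega>)\<^sup>2"
      using MD by eventually_elim (intro tendsto_intros LIMSEQ_Suc)
  qed (use mMg mD in auto)
  have L2: "(\<lambda>l. 4 * expectation (\<lambda>\<omega>. min 1 (VN (\<rho> (Suc l)) \<omega>))) \<longlonglongrightarrow> 4 * expectation (\<lambda>\<omega>. min 1 (\<eta>\<^sup>2 * V \<epsilon> t \<omega>))"
  proof (intro tendsto_mult_left tendsto_expectation_min_1)
    show "AE \<omega> in M. (\<lambda>l. VN (\<rho> (Suc l)) \<omega>) \<longlonglongrightarrow> \<eta>\<^sup>2 * V \<epsilon> t \<omega>"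
      using VNlim by eventually_elim (rule filterlim_compose[OF _ \<rho>S])
  qed (use mV VN(1)[OF \<rho>Spos] VN0 in auto)
  show "expectation (\<lambda>\<omega>. min 1 ((\<eta> * D \<epsilon> t \<omega>)\<^sup>2)) \<le> 4 * expectation (\<lambda>\<omega>. min 1 (\<eta>\<^sup>2 * V \<epsilon> t \<omega>))"
    by (rule LIMSEQ_le[OF L1 L2]) (use VN(2)[OF \<rho>Spos] in \<open>simp add: eqM\<close>)
qed

end

text \<open>By continuity the values near \<open>s\<close> stay below \<open>c\<close> and those
  near \<open>t\<close> above it. This carries a violated inequality between real times to rational
  times strictly inside.\<close>

lemma continuous_rational_between:
  fixes \<Phi> :: "real \<Rightarrow> real"
  assumes cont: "continuous_on {s..t} \<Phi>" and st: "s < t" and c: "\<Phi> s < c" "c < \<Phi> t"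
  obtains s' t' where "s' \<in> \<rat>" "t' \<in> \<rat>" "s < s'" "s' < t'" "t' < t" "\<Phi> s' < \<Phi> t'"
proof -
  define m where "m = (s + t) / 2"
  have m: "s < m" "m < t" using st by (auto simp: m_def)
  have "(\<Phi> \<longlongrightarrow> \<Phi> s) (at_right s)"
    using cont st by (metis at_within_Icc_at_right atLeastAtMost_iff continuous_on_def less_imp_le order_refl)
  then have "\<forall>\<^sub>F x in at_right s. \<Phi> x < c" using c(1) by (rule order_tendstoD)
  then obtain d where d: "s < d" "\<And>y. s < y \<Longrightarrow> y < d \<Longrightarrow> \<Phi> y < c"
    unfolding eventually_at_right_field by blast
  obtain s' where s': "s' \<in> \<rat>" "s < s'" "s' < min d m"
    using Rats_dense_in_real[of s "min d m"] d m by auto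
  have "(\<Phi> \<longlongrightarrow> \<Phi> t) (at_left t)"
    using cont st by (metis at_within_Icc_at_left atLeastAtMost_iff continuous_on_def less_imp_le order_refl)
  then have "\<forall>\<^sub>F x in at_left t. c < \<Phi> x" using c(2) by (rule order_tendstoD)
  then obtain e where e: "e < t" "\<And>y. e < y \<Longrightarrow> y < t \<Longrightarrow> c < \<Phi> y"
    unfolding eventually_at_left_field by blast
  obtain t' where t': "t' \<in> \<rat>" "max e m < t'" "t' < t"
    using Rats_dense_in_real[of "max e m" t] e m by auto
  show ?thesis
    using that[of s' t'] s' t' d(2)[of s'] e(2)[of t'] by force
qed

lemma tendsto_divide_sqrt_add:
  assumes "0 \<le> (x::real)" "\<And>l. 0 < e l" "e \<longlonglongrightarrow> 0"
  shows "(\<lambda>l. x / sqrt (x + e l)) \<longlonglongrightarrow> sqrt x"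
proof (cases "x = 0")
  case False
  then have "(\<lambda>l. x / sqrt (x + e l)) \<longlonglongrightarrow> x / sqrt (x + 0)"
    using assms by (intro tendsto_intros) auto
  then show ?thesis using assms(1) by (simp add: real_div_sqrt)
qed simp

text \<open>With \<open>\<epsilon> = smoothing l ^ 4\<close>, both \<open>sqrt \<epsilon>\<close>
  and the scale \<open>\<epsilon> powr (1/4)\<close> are integer powers of
  \<open>smoothing l\<close>.\<close>

definition smoothing :: "nat \<Rightarrow> real" where "smoothing l = 1 / (real l + 1)"

lemma smoothing_pos: "0 < smoothing l" "smoothing l \<le> 1" "0 < smoothing l ^ 4"
  and sqrt_smoothing: "sqrt (smoothing l ^ 4) = (smoothing l)\<^sup>2"
proof -
  show 1: "0 < smoothing l" "smoothing l \<le> 1" by (simp_all add: smoothing_def)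
  then show "0 < smoothing l ^ 4" by simp
  have "smoothing l ^ 4 = ((smoothing l)\<^sup>2)\<^sup>2" by simp
  then show "sqrt (smoothing l ^ 4) = (smoothing l)\<^sup>2"
    using 1 by (intro real_sqrt_unique) simp_all
qed

lemma smoothing_lim: "smoothing \<longlonglongrightarrow> 0"
  using LIMSEQ_inverse_real_of_nat unfolding smoothing_def by (simp add: inverse_eq_divide add.commute)

lemma smoothing_lim4: "(\<lambda>l. smoothing l ^ 4) \<longlonglongrightarrow> 0"
  using tendsto_power[OF smoothing_lim, of 4] by simp

section \<open>Removing the smoothing: the reflection term\<close>

context cir_setting
begin

text \<open>Smoothed reflection term: on paths with \<open>X \<ge> 0\<close> it is nondecreasing in
  time, and its integrand fades as \<epsilon> tends to \<open>0\<close> wherever \<open>X\<close> is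
  positive.\<close>

definition L :: "real \<Rightarrow> real \<Rightarrow> 'a \<Rightarrow> real" where
  "L \<epsilon> t \<omega> = integral {0..t} (\<lambda>s. \<epsilon> / (2 * sqrt (X s \<omega> + \<epsilon>) ^ 3))"

definition G :: "real \<Rightarrow> real \<Rightarrow> 'a \<Rightarrow> real" where
  "G \<epsilon> t \<omega> = sqrt (X t \<omega> + \<epsilon>) - sqrt (X 0 \<omega> + \<epsilon>)
     + b / 2 * integral {0..t} (\<lambda>s. X s \<omega> / sqrt (X s \<omega> + \<epsilon>)) - W t \<omega>"

text \<open>The reflection term, defined as what remains of \<open>sqrt X\<close> after removing
  drift and noise. It is the limit of \<open>G\<close>, and once \<open>D\<close> vanishes also that
  of \<open>L\<close>.\<close>

definition \<Phi> :: "real \<Rightarrow> 'a \<Rightarrow> real" where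
  "\<Phi> t \<omega> = sqrt (X t \<omega>) - sqrt (X 0 \<omega>) + b / 2 * integral {0..t} (\<lambda>s. sqrt (X s \<omega>)) - W t \<omega>"

definition regular :: "'a \<Rightarrow> bool" where
  "regular \<omega> \<longleftrightarrow> continuous_on {0..} (\<lambda>t. X t \<omega>) \<and> continuous_on {0..} (\<lambda>t. W t \<omega>) \<and>
     (\<forall>t\<ge>0. 0 \<le> X t \<omega>) \<and> X 0 \<omega> = x0 \<and> W 0 \<omega> = 0"

lemma AE_regular: "AE \<omega> in M. regular \<omega>"
  unfolding regular_def using X_cont cont_W X_nonneg X_0 W_0 by eventually_elim blast

lemma regular_X:
  assumes "regular \<omega>"
  shows "0 \<le> s \<Longrightarrow> 0 \<le> X s \<omega>" "0 \<le> u \<Longrightarrow> continuous_on {u..v} (\<lambda>s. X s \<omega>)"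
    "0 < \<epsilon> \<Longrightarrow> 0 \<le> s \<Longrightarrow> 0 < X s \<omega> + \<epsilon>"
  using assms unfolding regular_def by (auto intro: continuous_on_subset add_nonneg_pos)

lemma L_integrable:
  assumes "regular \<omega>" "0 < \<epsilon>" "0 \<le> u"
  shows "(\<lambda>s. \<epsilon> / (2 * sqrt (X s \<omega> + \<epsilon>) ^ 3)) integrable_on {u..v}"
  using regular_X[OF assms(1)] assms(2,3)
  by (intro integrable_continuous_interval continuous_intros) (force simp: less_le)+

text \<open>With \<open>q = sqrt (X + \<epsilon>)\<close> and
  \<open>X = q\<^sup>2 - \<epsilon>\<close>, the correction \<open>X / (2 * q ^ 3)\<close> is
  \<open>1 / (2 * q) - \<epsilon> / (2 * q ^ 3)\<close>, and its singular part cancels against the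
  constant drift.\<close>

lemma D_eq:
  assumes \<omega>: "regular \<omega>" and \<epsilon>: "0 < \<epsilon>" and t: "0 \<le> t"
  shows "D \<epsilon> t \<omega> = G \<epsilon> t \<omega> - L \<epsilon> t \<omega>"
proof -
  note X = regular_X[OF \<omega>]
  have nz: "X s \<omega> + \<epsilon> \<noteq> 0" if "0 \<le> s" for s using X(3)[OF \<epsilon> that] by simp
  have i1: "(\<lambda>s. (1 - b * X s \<omega>) / (2 * sqrt (X s \<omega> + \<epsilon>))) integrable_on {0..t}"
    and i2: "(\<lambda>s. X s \<omega> / (2 * sqrt (X s \<omega> + \<epsilon>) ^ 3)) integrable_on {0..t}"
    and i3: "(\<lambda>s. X s \<omega> / sqrt (X s \<omega> + \<epsilon>)) integrable_on {0..t}"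
    using X(2)[of 0 t] nz by (auto intro!: integrable_continuous_interval continuous_intros)
  have "integral {0..t} (\<lambda>s. X s \<omega> / (2 * sqrt (X s \<omega> + \<epsilon>) ^ 3)) - integral {0..t} (\<lambda>s. (1 - b * X s \<omega>) / (2 * sqrt (X s \<omega> + \<epsilon>)))
    = integral {0..t} (\<lambda>s. X s \<omega> / (2 * sqrt (X s \<omega> + \<epsilon>) ^ 3) - (1 - b * X s \<omega>) / (2 * sqrt (X s \<omega> + \<epsilon>)))"
    using i1 i2 by (simp add: Henstock_Kurzweil_Integration.integral_diff)
  also have "\<dots> = integral {0..t} (\<lambda>s. b / 2 * (X s \<omega> / sqrt (X s \<omega> + \<epsilon>)) - \<epsilon> / (2 * sqrt (X s \<omega> + \<epsilon>) ^ 3))"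
  proof (rule Henstock_Kurzweil_Integration.integral_cong)
    fix s assume "s \<in> {0..t}"
    define q where "q = sqrt (X s \<omega> + \<epsilon>)"
    have q: "0 < q" "X s \<omega> = q\<^sup>2 - \<epsilon>" using X(3)[OF \<epsilon>, of s] \<open>s \<in> _\<close> by (auto simp: q_def)
    show "X s \<omega> / (2 * sqrt (X s \<omega> + \<epsilon>) ^ 3) - (1 - b * X s \<omega>) / (2 * sqrt (X s \<omega> + \<epsilon>)) =
      b / 2 * (X s \<omega> / sqrt (X s \<omega> + \<epsilon>)) - \<epsilon> / (2 * sqrt (X s \<omega> + \<epsilon>) ^ 3)"
      unfolding q_def[symmetric] unfolding q(2) using q(1)
      by (simp add: field_simps power2_eq_square power3_eq_cube)
  qed
  also have "\<dots> = b / 2 * integral {0..t} (\<lambda>s. X s \<omega> / sqrt (X s \<omega> + \<epsilon>)) - L \<epsilon> t \<omega>"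
  proof -
    have i4: "(\<lambda>s. b / 2 * (X s \<omega> / sqrt (X s \<omega> + \<epsilon>))) integrable_on {0..t}"
      using integrable_cmul[OF i3, of "b / 2"] by (simp only: real_scaleR_def)
    show ?thesis
      unfolding L_def Henstock_Kurzweil_Integration.integral_diff[OF i4 L_integrable[OF \<omega> \<epsilon> order_refl]]
      by (simp only: Henstock_Kurzweil_Integration.integral_mult_right)
  qed
  finally show ?thesis unfolding D_def G_def by linarith
qed

text \<open>\<open>X / sqrt (X + \<epsilon>)\<close> is dominated by \<open>sqrt X\<close>, so the
  limit exists on each regular path without any knowledge of the time spent at
  \<open>0\<close>.\<close>

lemma G_lim:
  assumes \<omega>: "regular \<omega>" and t: "0 \<le> t"
  shows "(\<lambda>l. G (smoothing l ^ 4) t \<omega>) \<longlonglongrightarrow> \<Phi> t \<omega>"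
proof -
  note X = regular_X[OF \<omega>]
  have nz: "X s \<omega> + smoothing l ^ 4 \<noteq> 0" if "0 \<le> s" for s l using X(3)[OF smoothing_pos(3) that, of l] by simp
  have "(\<lambda>l. integral {0..t} (\<lambda>s. X s \<omega> / sqrt (X s \<omega> + smoothing l ^ 4))) \<longlonglongrightarrow> integral {0..t} (\<lambda>s. sqrt (X s \<omega>))"
  proof (rule dominated_convergence(2))
    show "(\<lambda>s. X s \<omega> / sqrt (X s \<omega> + smoothing l ^ 4)) integrable_on {0..t}" for l
      using X(2)[of 0 t] nz by (auto intro!: integrable_continuous_interval continuous_intros)
    show "(\<lambda>s. sqrt (X s \<omega>)) integrable_on {0..t}"
      using X(2)[of 0 t] by (auto intro!: integrable_continuous_interval continuous_intros)
    fix l s assume s: "s \<in> {0..t}"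
    then have x0: "0 \<le> X s \<omega>" using X(1) by simp
    have "X s \<omega> / sqrt (X s \<omega> + smoothing l ^ 4) \<le> sqrt (X s \<omega>)"
    proof (cases "X s \<omega> = 0")
      case False
      then have "X s \<omega> / sqrt (X s \<omega> + smoothing l ^ 4) \<le> X s \<omega> / sqrt (X s \<omega>)"
        using x0 smoothing_pos(3)[of l] X(3)[OF smoothing_pos(3)[of l], of s] s
        by (intro divide_left_mono mult_pos_pos) auto
      then show ?thesis using x0 by (simp add: real_div_sqrt)
    qed simp
    then show "norm (X s \<omega> / sqrt (X s \<omega> + smoothing l ^ 4)) \<le> sqrt (X s \<omega>)"
      using x0 smoothing_pos(3)[of l] by simp
    show "(\<lambda>l. X s \<omega> / sqrt (X s \<omega> + smoothing l ^ 4)) \<longlonglongrightarrow> sqrt (X s \<omega>)"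
      using x0 smoothing_pos(3) smoothing_lim4 by (rule tendsto_divide_sqrt_add)
  qed
  then have "(\<lambda>l. G (smoothing l ^ 4) t \<omega>) \<longlonglongrightarrow> sqrt (X t \<omega> + 0) - sqrt (X 0 \<omega> + 0) + b / 2 * integral {0..t} (\<lambda>s. sqrt (X s \<omega>)) - W t \<omega>"
    unfolding G_def by (intro tendsto_intros smoothing_lim4)
  then show ?thesis by (simp add: \<Phi>_def)
qed

lemma V_bound:
  assumes \<omega>: "regular \<omega>" and \<epsilon>: "0 < \<epsilon>" and s: "0 \<le> s"
  shows "(sqrt (X s \<omega>) / sqrt (X s \<omega> + \<epsilon>) - 1)\<^sup>2 \<le> 1"
proof -
  have "0 \<le> sqrt (X s \<omega>) / sqrt (X s \<omega> + \<epsilon>)" "sqrt (X s \<omega>) / sqrt (X s \<omega> + \<epsilon>) \<le> 1"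
    using regular_X(1)[OF \<omega> s] regular_X(3)[OF \<omega> \<epsilon> s] \<epsilon> by (auto simp: divide_le_eq)
  then have "\<bar>sqrt (X s \<omega>) / sqrt (X s \<omega> + \<epsilon>) - 1\<bar> \<le> 1" by simp
  then show ?thesis by (simp add: abs_square_le_1)
qed

lemma V_integrable:
  assumes \<omega>: "regular \<omega>" and \<epsilon>: "0 < \<epsilon>"
  shows "(\<lambda>s. (sqrt (X s \<omega>) / sqrt (X s \<omega> + \<epsilon>) - 1)\<^sup>2) integrable_on {0..t}"
proof -
  have "X s \<omega> + \<epsilon> \<noteq> 0" if "0 \<le> s" for s using regular_X(3)[OF \<omega> \<epsilon> that] by simp
  then show ?thesis
    using regular_X(2)[OF \<omega>, of 0 t] by (auto intro!: integrable_continuous_interval continuous_intros)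
qed

text \<open>
  With \<open>\<eta> = \<epsilon> powr (1/4)\<close> both sides of the smoothed estimate vanish in the limit, although
  \<open>\<eta> * L \<epsilon> t\<close> would blow up if \<open>X\<close> spent positive time at \<open>0\<close>.
\<close>

lemma V_lim:
  assumes t: "0 < t"
  obtains \<rho> :: "nat \<Rightarrow> nat" where "strict_mono \<rho>" "AE \<omega> in M. (\<lambda>l. V (smoothing (\<rho> l) ^ 4) t \<omega>) \<longlonglongrightarrow> 0"
proof -
  let ?\<epsilon> = "\<lambda>l. smoothing l ^ 4"
  define f where "f l \<omega> = (smoothing l * D (?\<epsilon> l) t \<omega>)\<^sup>2" for l \<omega>
  note est = smoothed_sqrt_estimate[OF t smoothing_pos(3)]
  have Vt: "AE \<omega> in M. 0 \<le> V (?\<epsilon> l) t \<omega> \<and> V (?\<epsilon> l) t \<omega> \<le> t" for l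
    using AE_regular
  proof eventually_elim
    fix \<omega> assume \<omega>: "regular \<omega>"
    have "V (?\<epsilon> l) t \<omega> \<le> integral {0..t} (\<lambda>_. 1)"
      unfolding V_def using V_bound[OF \<omega> smoothing_pos(3)] V_integrable[OF \<omega> smoothing_pos(3)]
      by (intro integral_le) auto
    then show "0 \<le> V (?\<epsilon> l) t \<omega> \<and> V (?\<epsilon> l) t \<omega> \<le> t"
      using t unfolding V_def by (simp add: integral_nonneg_real)
  qed
  have "(\<lambda>l. expectation (\<lambda>\<omega>. min 1 (f l \<omega>))) \<longlonglongrightarrow> 0"
  proof (rule tendsto_sandwich[OF _ _ tendsto_const])
    show "(\<lambda>l. 4 * ((smoothing l)\<^sup>2 * t)) \<longlonglongrightarrow> 0"
      using tendsto_mult[OF tendsto_const[of 4] tendsto_mult[OF tendsto_power[OF smoothing_lim, of 2] tendsto_const[of t]]] by simp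
    \<comment> \<open>Only the trivial bound \<open>V \<le> t\<close> enters; the small scale
      \<open>\<eta> = smoothing l\<close> does the rest.\<close>
    have "expectation (\<lambda>\<omega>. min 1 ((smoothing l)\<^sup>2 * V (?\<epsilon> l) t \<omega>)) \<le> expectation (\<lambda>_. (smoothing l)\<^sup>2 * t)" for l
    proof (rule integral_mono_AE')
      show "AE \<omega> in M. min 1 ((smoothing l)\<^sup>2 * V (?\<epsilon> l) t \<omega>) \<le> (smoothing l)\<^sup>2 * t"
        using Vt[of l] by eventually_elim (simp add: min_le_iff_disj mult_left_mono)
      show "AE \<omega> in M. 0 \<le> (smoothing l)\<^sup>2 * t" using t by simp
    qed simp
    then have le: "expectation (\<lambda>\<omega>. min 1 ((smoothing l)\<^sup>2 * V (?\<epsilon> l) t \<omega>)) \<le> (smoothing l)\<^sup>2 * t" for l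
      by (simp add: prob_space)
    have "expectation (\<lambda>\<omega>. min 1 (f l \<omega>)) \<le> 4 * ((smoothing l)\<^sup>2 * t)" for l
    proof -
      have "expectation (\<lambda>\<omega>. min 1 (f l \<omega>)) \<le> 4 * expectation (\<lambda>\<omega>. min 1 ((smoothing l)\<^sup>2 * V (?\<epsilon> l) t \<omega>))"
        unfolding f_def by (rule est(3))
      also have "\<dots> \<le> 4 * ((smoothing l)\<^sup>2 * t)" using le[of l] by (rule mult_left_mono) simp
      finally show ?thesis .
    qed
    then show "\<forall>\<^sub>F l in sequentially. expectation (\<lambda>\<omega>. min 1 (f l \<omega>)) \<le> 4 * ((smoothing l)\<^sup>2 * t)" by simp
    show "\<forall>\<^sub>F l in sequentially. 0 \<le> expectation (\<lambda>\<omega>. min 1 (f l \<omega>))" by (simp add: f_def)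
  qed
  then obtain \<rho> :: "nat \<Rightarrow> nat" where \<rho>: "strict_mono \<rho>" and lim: "AE \<omega> in M. (\<lambda>l. f (\<rho> l) \<omega>) \<longlonglongrightarrow> 0"
  proof (rule AE_subseq_of_expectation_min_1[rotated 2])
    show "f l \<in> borel_measurable M" for l unfolding f_def using est(1)[of l] by simp
    show "0 \<le> f l \<omega>" for l \<omega> by (simp add: f_def)
  qed (rule that)
  have "AE \<omega> in M. (\<lambda>l. V (?\<epsilon> (\<rho> l)) t \<omega>) \<longlonglongrightarrow> 0"
    using lim AE_regular
  proof eventually_elim
    fix \<omega> assume lim: "(\<lambda>l. f (\<rho> l) \<omega>) \<longlonglongrightarrow> 0" and \<omega>: "regular \<omega>"
    note X = regular_X[OF \<omega>]
    \<comment> \<open>Indicator of the zero set of the path and pointwise limit of the integrands of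
      \<open>V\<close>: the limit of \<open>V\<close> is the time that \<open>X\<close> spends at
      \<open>0\<close>.\<close>
    define z where "z s = (if X s \<omega> = 0 then 1 else 0 :: real)" for s
    have dc: "z integrable_on {0..t}" "(\<lambda>l. integral {0..t} (\<lambda>s. (sqrt (X s \<omega>) / sqrt (X s \<omega> + ?\<epsilon> l) - 1)\<^sup>2)) \<longlonglongrightarrow> integral {0..t} z"
    proof -
      have 1: "(\<lambda>_. 1::real) integrable_on {0..t}" by (simp add: integrable_const_ivl)
      have 2: "norm ((sqrt (X s \<omega>) / sqrt (X s \<omega> + ?\<epsilon> l) - 1)\<^sup>2) \<le> 1" if "s \<in> {0..t}" for l s
        using V_bound[OF \<omega> smoothing_pos(3), of s l] that by simp
      have 3: "(\<lambda>l. (sqrt (X s \<omega>) / sqrt (X s \<omega> + ?\<epsilon> l) - 1)\<^sup>2) \<longlonglongrightarrow> z s" if "s \<in> {0..t}" for s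
      proof (cases "X s \<omega> = 0")
        case False
        then have "(\<lambda>l. (sqrt (X s \<omega>) / sqrt (X s \<omega> + ?\<epsilon> l) - 1)\<^sup>2) \<longlonglongrightarrow> (sqrt (X s \<omega>) / sqrt (X s \<omega> + 0) - 1)\<^sup>2"
          by (intro tendsto_intros smoothing_lim4) auto
        then show ?thesis using False by (simp add: z_def)
      qed (simp add: z_def)
      show "z integrable_on {0..t}" "(\<lambda>l. integral {0..t} (\<lambda>s. (sqrt (X s \<omega>) / sqrt (X s \<omega> + ?\<epsilon> l) - 1)\<^sup>2)) \<longlonglongrightarrow> integral {0..t} z"
        using dominated_convergence[OF V_integrable[OF \<omega> smoothing_pos(3)] 1 2 3] by blast+
    qed
    \<comment> \<open>Where \<open>X\<close> is \<open>0\<close>, the integrand of \<open>L\<close>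
      is \<open>1 / (2 * (smoothing l)\<^sup>2)\<close>; multiplied by
      \<open>2 * smoothing l\<close> it is at least 1. The scaled \<open>L\<close> thus dominates
      the time spent at \<open>0\<close>.\<close>
    have zL: "integral {0..t} z \<le> 2 * (smoothing l * L (?\<epsilon> l) t \<omega>)" for l
    proof -
      have "integral {0..t} z \<le> integral {0..t} (\<lambda>s. 2 * smoothing l * (?\<epsilon> l / (2 * sqrt (X s \<omega> + ?\<epsilon> l) ^ 3)))"
      proof (rule integral_le[OF dc(1)])
        show "(\<lambda>s. 2 * smoothing l * (?\<epsilon> l / (2 * sqrt (X s \<omega> + ?\<epsilon> l) ^ 3))) integrable_on {0..t}"
          using integrable_cmul[OF L_integrable[OF \<omega> smoothing_pos(3)[of l] order_refl, of t], of "2 * smoothing l"] by simp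
        fix s assume s: "s \<in> {0..t}"
        show "z s \<le> 2 * smoothing l * (?\<epsilon> l / (2 * sqrt (X s \<omega> + ?\<epsilon> l) ^ 3))"
        proof (cases "X s \<omega> = 0")
          case True
          have "2 * smoothing l * (?\<epsilon> l / (2 * sqrt (X s \<omega> + ?\<epsilon> l) ^ 3)) = 1 / smoothing l"
            using smoothing_pos(1)[of l] unfolding True add_0_left sqrt_smoothing
            by (simp add: field_simps power2_eq_square power3_eq_cube power4_eq_xxxx)
          then show ?thesis using smoothing_pos[of l] True by (simp add: z_def)
        next
          case False
          then show ?thesis using smoothing_pos[of l] X(3)[OF smoothing_pos(3)[of l], of s] s by (simp add: z_def)
        qed
      qed
      then show ?thesis
        unfolding L_def Henstock_Kurzweil_Integration.integral_mult_right by (simp only: mult.assoc)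
    qed
    \<comment> \<open>The scaled \<open>D\<close> vanishes by the estimate, the scaled
      \<open>G\<close> because \<open>G\<close> converges. So does their difference, the scaled
      \<open>L\<close>, which leaves no time at \<open>0\<close>.\<close>
    have "(\<lambda>l. smoothing (\<rho> l) * D (?\<epsilon> (\<rho> l)) t \<omega>) \<longlonglongrightarrow> 0"
      using lim by (simp add: f_def power_tendsto_0_iff)
    moreover have "(\<lambda>l. smoothing (\<rho> l) * G (?\<epsilon> (\<rho> l)) t \<omega>) \<longlonglongrightarrow> 0 * \<Phi> t \<omega>"
      using LIMSEQ_subseq_LIMSEQ[OF tendsto_mult[OF smoothing_lim G_lim[OF \<omega>]] \<rho>] t by (simp add: comp_def)
    ultimately have "(\<lambda>l. smoothing (\<rho> l) * G (?\<epsilon> (\<rho> l)) t \<omega> - smoothing (\<rho> l) * D (?\<epsilon> (\<rho> l)) t \<omega>) \<longlonglongrightarrow> 0 * \<Phi> t \<omega> - 0"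
      by (intro tendsto_diff)
    then have "(\<lambda>l. smoothing (\<rho> l) * L (?\<epsilon> (\<rho> l)) t \<omega>) \<longlonglongrightarrow> 0"
      using D_eq[OF \<omega> smoothing_pos(3), of t] t by (simp add: right_diff_distrib[symmetric])
    then have "(\<lambda>l. 2 * (smoothing (\<rho> l) * L (?\<epsilon> (\<rho> l)) t \<omega>)) \<longlonglongrightarrow> 0" by (rule tendsto_mult_right_zero)
    then have "integral {0..t} z \<le> 0" by (rule LIMSEQ_le_const) (use zL in blast)
    moreover have "0 \<le> integral {0..t} z" by (rule integral_nonneg_real) (simp add: z_def)
    ultimately have "integral {0..t} z = 0" by simp
    then show "(\<lambda>l. V (?\<epsilon> (\<rho> l)) t \<omega>) \<longlonglongrightarrow> 0"
      using LIMSEQ_subseq_LIMSEQ[OF dc(2) \<rho>] by (simp add: V_def comp_def)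
  qed
  with \<rho> show ?thesis by (rule that)
qed

lemma V_mono:
  assumes \<omega>: "regular \<omega>" and st: "0 \<le> s" "s \<le> t" and \<epsilon>: "0 < \<epsilon>"
  shows "V \<epsilon> s \<omega> \<le> V \<epsilon> t \<omega>"
  unfolding V_def using st V_integrable[OF \<omega> \<epsilon>] by (intro integral_subset_le) auto

text \<open>Since \<open>V\<close> vanishes, so does \<open>D\<close> along a subsequence, and the
  increments of \<open>L = G - D\<close> tend to those of \<open>\<Phi>\<close>. They are
  non-negative, and they vanish in the limit if \<open>X\<close> is bounded away from
  \<open>0\<close> on the interval. The exceptional null set depends on the pair of times.\<close>

lemma reflection_pair:
  assumes st: "0 < s" "s < t"
  shows "AE \<omega> in M. \<Phi> s \<omega> \<le> \<Phi> t \<omega> \<and> ((\<forall>q\<in>{s..t}. 0 < X q \<omega>) \<longrightarrow> \<Phi> s \<omega> = \<Phi> t \<omega>)"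
proof -
  let ?\<epsilon> = "\<lambda>l. smoothing l ^ 4"
  have t: "0 < t" using st by simp
  obtain \<rho> where \<rho>: "strict_mono \<rho>" and V0: "AE \<omega> in M. (\<lambda>l. V (?\<epsilon> (\<rho> l)) t \<omega>) \<longlonglongrightarrow> 0"
    by (rule V_lim[OF t])
  note estt = smoothed_sqrt_estimate[OF t smoothing_pos(3)] and ests = smoothed_sqrt_estimate[OF st(1) smoothing_pos(3)]
  have Vnn: "0 \<le> V \<epsilon> u \<omega>" for \<epsilon> u \<omega> unfolding V_def by (rule integral_nonneg_real) simp
  \<comment> \<open>Monotonicity of \<open>V\<close> in time makes the subsequence chosen for
    \<open>t\<close> work for \<open>s\<close> as well.\<close>
  have V0s: "AE \<omega> in M. (\<lambda>l. V (?\<epsilon> (\<rho> l)) s \<omega>) \<longlonglongrightarrow> 0"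
    using V0 AE_regular
  proof eventually_elim
    fix \<omega> assume lim: "(\<lambda>l. V (?\<epsilon> (\<rho> l)) t \<omega>) \<longlonglongrightarrow> 0" and \<omega>: "regular \<omega>"
    show "(\<lambda>l. V (?\<epsilon> (\<rho> l)) s \<omega>) \<longlonglongrightarrow> 0"
    proof (rule tendsto_sandwich[OF _ _ tendsto_const lim])
      show "\<forall>\<^sub>F l in sequentially. 0 \<le> V (?\<epsilon> (\<rho> l)) s \<omega>" by (simp add: Vnn)
      have "V (?\<epsilon> (\<rho> l)) s \<omega> \<le> V (?\<epsilon> (\<rho> l)) t \<omega>" for l
        using st by (intro V_mono[OF \<omega> _ _ smoothing_pos(3)]) auto
      then show "\<forall>\<^sub>F l in sequentially. V (?\<epsilon> (\<rho> l)) s \<omega> \<le> V (?\<epsilon> (\<rho> l)) t \<omega>" by simp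
    qed
  qed
  have ED: "(\<lambda>l. expectation (\<lambda>\<omega>. min 1 ((D (?\<epsilon> (\<rho> l)) u \<omega>)\<^sup>2))) \<longlonglongrightarrow> 0"
    if u: "0 < u" and V0: "AE \<omega> in M. (\<lambda>l. V (?\<epsilon> (\<rho> l)) u \<omega>) \<longlonglongrightarrow> 0" for u
  proof (rule tendsto_sandwich[OF _ _ tendsto_const])
    note est = smoothed_sqrt_estimate[OF u smoothing_pos(3)]
    have "(\<lambda>l. expectation (\<lambda>\<omega>. min 1 (V (?\<epsilon> (\<rho> l)) u \<omega>))) \<longlonglongrightarrow> expectation (\<lambda>\<omega>. min 1 0)"
      by (rule tendsto_expectation_min_1[OF est(2) _ V0 Vnn]) simp
    then show "(\<lambda>l. 4 * expectation (\<lambda>\<omega>. min 1 (V (?\<epsilon> (\<rho> l)) u \<omega>))) \<longlonglongrightarrow> 0"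
      by (intro tendsto_mult_right_zero) simp
    show "\<forall>\<^sub>F l in sequentially. expectation (\<lambda>\<omega>. min 1 ((D (?\<epsilon> (\<rho> l)) u \<omega>)\<^sup>2)) \<le> 4 * expectation (\<lambda>\<omega>. min 1 (V (?\<epsilon> (\<rho> l)) u \<omega>))"
      using est(3)[where \<eta> = 1] by simp
    show "\<forall>\<^sub>F l in sequentially. 0 \<le> expectation (\<lambda>\<omega>. min 1 ((D (?\<epsilon> (\<rho> l)) u \<omega>)\<^sup>2))" by simp
  qed
  define f where "f l \<omega> = (D (?\<epsilon> (\<rho> l)) t \<omega>)\<^sup>2 + (D (?\<epsilon> (\<rho> l)) s \<omega>)\<^sup>2" for l \<omega>
  have mf: "f l \<in> borel_measurable M" for l unfolding f_def using estt(1) ests(1) by simp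
  have "(\<lambda>l. expectation (\<lambda>\<omega>. min 1 (f l \<omega>))) \<longlonglongrightarrow> 0"
  proof (rule tendsto_sandwich[OF _ _ tendsto_const])
    show "(\<lambda>l. expectation (\<lambda>\<omega>. min 1 ((D (?\<epsilon> (\<rho> l)) t \<omega>)\<^sup>2)) + expectation (\<lambda>\<omega>. min 1 ((D (?\<epsilon> (\<rho> l)) s \<omega>)\<^sup>2))) \<longlonglongrightarrow> 0"
      using tendsto_add[OF ED[OF t V0] ED[OF st(1) V0s]] by simp
    have "expectation (\<lambda>\<omega>. min 1 (f l \<omega>)) \<le> expectation (\<lambda>\<omega>. min 1 ((D (?\<epsilon> (\<rho> l)) t \<omega>)\<^sup>2) + min 1 ((D (?\<epsilon> (\<rho> l)) s \<omega>)\<^sup>2))" for l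
    proof (rule integral_mono)
      show "integrable M (\<lambda>\<omega>. min 1 (f l \<omega>))" by (intro integrable_min_1 mf) (simp add: f_def)
      show "integrable M (\<lambda>\<omega>. min 1 ((D (?\<epsilon> (\<rho> l)) t \<omega>)\<^sup>2) + min 1 ((D (?\<epsilon> (\<rho> l)) s \<omega>)\<^sup>2))"
        using estt(1) ests(1) by (intro Bochner_Integration.integrable_add integrable_min_1) auto
      show "min 1 (f l \<omega>) \<le> min 1 ((D (?\<epsilon> (\<rho> l)) t \<omega>)\<^sup>2) + min 1 ((D (?\<epsilon> (\<rho> l)) s \<omega>)\<^sup>2)" for \<omega>
        unfolding f_def by (rule min_1_add_le) auto
    qed
    also have "\<And>l. expectation (\<lambda>\<omega>. min 1 ((D (?\<epsilon> (\<rho> l)) t \<omega>)\<^sup>2) + min 1 ((D (?\<epsilon> (\<rho> l)) s \<omega>)\<^sup>2)) =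
      expectation (\<lambda>\<omega>. min 1 ((D (?\<epsilon> (\<rho> l)) t \<omega>)\<^sup>2)) + expectation (\<lambda>\<omega>. min 1 ((D (?\<epsilon> (\<rho> l)) s \<omega>)\<^sup>2))"
      using estt(1) ests(1) by (intro Bochner_Integration.integral_add integrable_min_1) auto
    finally show "\<forall>\<^sub>F l in sequentially. expectation (\<lambda>\<omega>. min 1 (f l \<omega>)) \<le>
       expectation (\<lambda>\<omega>. min 1 ((D (?\<epsilon> (\<rho> l)) t \<omega>)\<^sup>2)) + expectation (\<lambda>\<omega>. min 1 ((D (?\<epsilon> (\<rho> l)) s \<omega>)\<^sup>2))" by simp
    show "\<forall>\<^sub>F l in sequentially. 0 \<le> expectation (\<lambda>\<omega>. min 1 (f l \<omega>))" by (simp add: f_def)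
  qed
  then obtain \<rho>' :: "nat \<Rightarrow> nat" where \<rho>': "strict_mono \<rho>'" and lim: "AE \<omega> in M. (\<lambda>l. f (\<rho>' l) \<omega>) \<longlonglongrightarrow> 0"
  proof (rule AE_subseq_of_expectation_min_1[rotated 2])
    show "0 \<le> f l \<omega>" for l \<omega> by (simp add: f_def)
    show "f l \<in> borel_measurable M" for l by (rule mf)
  qed (rule that)
  define \<kappa> where "\<kappa> l = \<rho> (\<rho>' l)" for l
  have \<kappa>: "strict_mono \<kappa>" unfolding \<kappa>_def using strict_mono_o[OF \<rho> \<rho>'] by (simp add: comp_def)
  show ?thesis
    using lim AE_regular
  proof eventually_elim
    fix \<omega> assume lim: "(\<lambda>l. f (\<rho>' l) \<omega>) \<longlonglongrightarrow> 0" and \<omega>: "regular \<omega>"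
    note X = regular_X[OF \<omega>]
    have "(\<lambda>l. (D (?\<epsilon> (\<kappa> l)) t \<omega>)\<^sup>2) \<longlonglongrightarrow> 0" "(\<lambda>l. (D (?\<epsilon> (\<kappa> l)) s \<omega>)\<^sup>2) \<longlonglongrightarrow> 0"
      by (rule tendsto_sandwich[OF _ _ tendsto_const lim]; simp add: f_def \<kappa>_def)+
    then have Dl: "(\<lambda>l. D (?\<epsilon> (\<kappa> l)) t \<omega>) \<longlonglongrightarrow> 0" "(\<lambda>l. D (?\<epsilon> (\<kappa> l)) s \<omega>) \<longlonglongrightarrow> 0"
      by (simp_all add: power_tendsto_0_iff)
    have Gl: "(\<lambda>l. G (?\<epsilon> (\<kappa> l)) u \<omega>) \<longlonglongrightarrow> \<Phi> u \<omega>" if "0 \<le> u" for u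
      using LIMSEQ_subseq_LIMSEQ[OF G_lim[OF \<omega> that] \<kappa>] by (simp add: comp_def)
    have Leq: "L (?\<epsilon> l) t \<omega> - L (?\<epsilon> l) s \<omega> = integral {s..t} (\<lambda>q. ?\<epsilon> l / (2 * sqrt (X q \<omega> + ?\<epsilon> l) ^ 3))" for l
      using Henstock_Kurzweil_Integration.integral_combine[OF _ _ L_integrable[OF \<omega> smoothing_pos(3)[of l] order_refl, of t], of s] st
      by (simp add: L_def)
    have "(\<lambda>l. (G (?\<epsilon> (\<kappa> l)) t \<omega> - D (?\<epsilon> (\<kappa> l)) t \<omega>) - (G (?\<epsilon> (\<kappa> l)) s \<omega> - D (?\<epsilon> (\<kappa> l)) s \<omega>)) \<longlonglongrightarrow> (\<Phi> t \<omega> - 0) - (\<Phi> s \<omega> - 0)"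
      using st by (intro tendsto_diff Gl Dl) auto
    then have Ll: "(\<lambda>l. integral {s..t} (\<lambda>q. ?\<epsilon> (\<kappa> l) / (2 * sqrt (X q \<omega> + ?\<epsilon> (\<kappa> l)) ^ 3))) \<longlonglongrightarrow> \<Phi> t \<omega> - \<Phi> s \<omega>"
      using D_eq[OF \<omega> smoothing_pos(3)] st by (simp add: Leq[symmetric])
    have Lnn: "0 \<le> integral {s..t} (\<lambda>q. ?\<epsilon> l / (2 * sqrt (X q \<omega> + ?\<epsilon> l) ^ 3))" for l
    proof (rule integral_nonneg_real)
      fix q assume "q \<in> {s..t}"
      then have "0 < X q \<omega> + ?\<epsilon> l" using X(3)[OF smoothing_pos(3)] st by simp
      then show "0 \<le> ?\<epsilon> l / (2 * sqrt (X q \<omega> + ?\<epsilon> l) ^ 3)" using smoothing_pos(3)[of l] by simp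
    qed
    have "0 \<le> \<Phi> t \<omega> - \<Phi> s \<omega>" by (rule LIMSEQ_le_const[OF Ll]) (use Lnn in blast)
    moreover have "\<Phi> t \<omega> - \<Phi> s \<omega> = 0" if pos: "\<forall>q\<in>{s..t}. 0 < X q \<omega>"
    proof -
      obtain q0 where q0: "q0 \<in> {s..t}" "\<And>q. q \<in> {s..t} \<Longrightarrow> X q0 \<omega> \<le> X q \<omega>"
        using continuous_attains_inf[OF compact_Icc _ X(2)[of s t]] st by auto
      define a where "a = X q0 \<omega>"
      have a: "0 < a" using pos q0 by (simp add: a_def)
      have ub: "integral {s..t} (\<lambda>q. ?\<epsilon> l / (2 * sqrt (X q \<omega> + ?\<epsilon> l) ^ 3)) \<le> ?\<epsilon> l * (1 / (2 * sqrt a ^ 3) * (t - s))" for l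
      proof -
        have "integral {s..t} (\<lambda>q. ?\<epsilon> l / (2 * sqrt (X q \<omega> + ?\<epsilon> l) ^ 3)) \<le> integral {s..t} (\<lambda>_. ?\<epsilon> l * (1 / (2 * sqrt a ^ 3)))"
        proof (rule integral_le[OF L_integrable[OF \<omega> smoothing_pos(3)]])
          fix q assume q: "q \<in> {s..t}"
          have "sqrt a \<le> sqrt (X q \<omega> + ?\<epsilon> l)" unfolding a_def using q0(2)[OF q] smoothing_pos(3)[of l] by (intro real_sqrt_le_mono) linarith
          then have "2 * sqrt a ^ 3 \<le> 2 * sqrt (X q \<omega> + ?\<epsilon> l) ^ 3" using a by (intro mult_left_mono power_mono) auto
          moreover have "0 < 2 * sqrt a ^ 3" using a by simp
          ultimately have "?\<epsilon> l / (2 * sqrt (X q \<omega> + ?\<epsilon> l) ^ 3) \<le> ?\<epsilon> l / (2 * sqrt a ^ 3)"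
            using smoothing_pos(3)[of l] by (intro divide_left_mono mult_pos_pos) linarith+
          then show "?\<epsilon> l / (2 * sqrt (X q \<omega> + ?\<epsilon> l) ^ 3) \<le> ?\<epsilon> l * (1 / (2 * sqrt a ^ 3))" by simp
        qed (use st in auto)
        then show ?thesis using st by (simp add: mult_ac)
      qed
      have ubl: "(\<lambda>l. ?\<epsilon> (\<kappa> l) * (1 / (2 * sqrt a ^ 3) * (t - s))) \<longlonglongrightarrow> 0"
        using LIMSEQ_subseq_LIMSEQ[OF smoothing_lim4 \<kappa>] by (intro tendsto_mult_left_zero) (simp add: comp_def)
      have "(\<lambda>l. integral {s..t} (\<lambda>q. ?\<epsilon> (\<kappa> l) / (2 * sqrt (X q \<omega> + ?\<epsilon> (\<kappa> l)) ^ 3))) \<longlonglongrightarrow> 0"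
        by (rule tendsto_sandwich[OF always_eventually always_eventually tendsto_const ubl])
          (intro allI Lnn ub)+
      with Ll show ?thesis by (rule LIMSEQ_unique)
    qed
    ultimately show "\<Phi> s \<omega> \<le> \<Phi> t \<omega> \<and> ((\<forall>q\<in>{s..t}. 0 < X q \<omega>) \<longrightarrow> \<Phi> s \<omega> = \<Phi> t \<omega>)" by auto
  qed
qed

text \<open>One null set can be had for countably many pairs only, so \<open>reflection_pair\<close>
  is used at positive rational times; continuity of \<open>\<Phi>\<close> extends both properties to
  all times, including the start at \<open>0\<close>.\<close>

lemma AE_reflected_path:
  "AE \<omega> in M. reflected_path (\<lambda>s. sqrt (X s \<omega>)) (\<lambda>s. W s \<omega>) b (sqrt x0)"
proof -
  have "AE \<omega> in M. \<forall>p\<in>{p \<in> \<rat> \<times> \<rat>. 0 < fst p \<and> fst p < snd p}.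
     \<Phi> (fst p) \<omega> \<le> \<Phi> (snd p) \<omega> \<and> ((\<forall>q\<in>{fst p..snd p}. 0 < X q \<omega>) \<longrightarrow> \<Phi> (fst p) \<omega> = \<Phi> (snd p) \<omega>)"
  proof (subst AE_ball_countable)
    show "countable {p \<in> \<rat> \<times> \<rat>. 0 < fst p \<and> fst p < (snd p :: real)}"
      by (rule countable_subset[of _ "\<rat> \<times> \<rat>"]) (auto intro: countable_rat)
  qed (use reflection_pair in auto)
  then show ?thesis using AE_regular
  proof eventually_elim
    fix \<omega> assume rat: "\<forall>p\<in>{p \<in> \<rat> \<times> \<rat>. 0 < fst p \<and> fst p < snd p}.
     \<Phi> (fst p) \<omega> \<le> \<Phi> (snd p) \<omega> \<and> ((\<forall>q\<in>{fst p..snd p}. 0 < X q \<omega>) \<longrightarrow> \<Phi> (fst p) \<omega> = \<Phi> (snd p) \<omega>)"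
      and \<omega>: "regular \<omega>"
    note X = regular_X[OF \<omega>]
    have le: "\<Phi> p \<omega> \<le> \<Phi> q \<omega>" if "p \<in> \<rat>" "q \<in> \<rat>" "0 < p" "p < q" for p q
      using rat that by (auto dest: bspec[of _ _ "(p, q)"])
    have eq: "\<Phi> p \<omega> = \<Phi> q \<omega>" if "p \<in> \<rat>" "q \<in> \<rat>" "0 < p" "p < q" "\<And>u. u \<in> {p..q} \<Longrightarrow> 0 < X u \<omega>" for p q
      using rat that by (auto dest: bspec[of _ _ "(p, q)"])
    have contZ: "continuous_on {u..v} (\<lambda>s. sqrt (X s \<omega>))" if "0 \<le> u" for u v
      using X(2)[OF that] by (intro continuous_intros)
    have contW: "continuous_on {u..v} (\<lambda>s. W s \<omega>)" if "0 \<le> u" for u v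
      using \<omega> that unfolding regular_def by (auto intro: continuous_on_subset)
    have cont\<Phi>: "continuous_on {s..t} (\<lambda>u. \<Phi> u \<omega>)" if "0 \<le> s" for s t
    proof -
      have "continuous_on {0..t} (\<lambda>u. integral {0..u} (\<lambda>s. sqrt (X s \<omega>)))"
        using contZ[of 0 t] by (intro indefinite_integral_continuous_1 integrable_continuous_interval) auto
      then have "continuous_on {s..t} (\<lambda>u. integral {0..u} (\<lambda>s. sqrt (X s \<omega>)))"
        using that by (auto intro: continuous_on_subset)
      then show ?thesis unfolding \<Phi>_def
        by (intro continuous_on_diff continuous_on_add continuous_on_mult continuous_on_const
            contZ[OF that] contW[OF that])
    qed
    have mono: "\<Phi> s \<omega> \<le> \<Phi> t \<omega>" if st: "0 \<le> s" "s < t" for s t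
    proof (rule ccontr)
      assume "\<not> \<Phi> s \<omega> \<le> \<Phi> t \<omega>"
      then have *: "- \<Phi> s \<omega> < - ((\<Phi> s \<omega> + \<Phi> t \<omega>) / 2)" "- ((\<Phi> s \<omega> + \<Phi> t \<omega>) / 2) < - \<Phi> t \<omega>" by auto
      obtain s' t' where "s' \<in> \<rat>" "t' \<in> \<rat>" "s < s'" "s' < t'" "t' < t" "- \<Phi> s' \<omega> < - \<Phi> t' \<omega>"
        by (rule continuous_rational_between[OF continuous_on_minus[OF cont\<Phi>[OF st(1)]] st(2) *], rule that)
      then show False using le[of s' t'] st by simp
    qed
    \<comment> \<open>The rational times lie inside \<open>{s..t}\<close>, so positivity of
      \<open>X\<close> is inherited there; a decrease is already excluded by
      \<open>mono\<close>.\<close>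
    have const: "\<Phi> s \<omega> = \<Phi> t \<omega>" if st: "0 \<le> s" "s < t" and pos: "\<And>u. u \<in> {s..t} \<Longrightarrow> 0 < X u \<omega>" for s t
    proof (rule ccontr)
      assume "\<Phi> s \<omega> \<noteq> \<Phi> t \<omega>"
      then have *: "\<Phi> s \<omega> < (\<Phi> s \<omega> + \<Phi> t \<omega>) / 2" "(\<Phi> s \<omega> + \<Phi> t \<omega>) / 2 < \<Phi> t \<omega>" using mono[OF st] by auto
      obtain s' t' where "s' \<in> \<rat>" "t' \<in> \<rat>" "s < s'" "s' < t'" "t' < t" "\<Phi> s' \<omega> < \<Phi> t' \<omega>"
        by (rule continuous_rational_between[OF cont\<Phi>[OF st(1)] st(2) *], rule that)
      then show False using eq[of s' t'] st pos by auto
    qed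
    have incr: "\<Phi> t \<omega> - \<Phi> s \<omega> = sqrt (X t \<omega>) - sqrt (X s \<omega>) + b / 2 * integral {s..t} (\<lambda>s. sqrt (X s \<omega>)) - (W t \<omega> - W s \<omega>)"
      if "0 \<le> s" "s \<le> t" for s t
    proof -
      have "(\<lambda>s. sqrt (X s \<omega>)) integrable_on {0..t}" using contZ[of 0 t] by (intro integrable_continuous_interval) auto
      note eq = Henstock_Kurzweil_Integration.integral_combine[OF that this, symmetric]
      show ?thesis unfolding \<Phi>_def eq by (simp add: algebra_simps)
    qed
    show "reflected_path (\<lambda>s. sqrt (X s \<omega>)) (\<lambda>s. W s \<omega>) b (sqrt x0)"
    proof
      show "continuous_on {0..1} (\<lambda>s. sqrt (X s \<omega>))" "continuous_on {0..1} (\<lambda>s. W s \<omega>)"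
        using contZ contW by auto
      show "sqrt (X 0 \<omega>) = sqrt x0" "W 0 \<omega> = 0" using \<omega> by (auto simp: regular_def)
      show "0 \<le> sqrt (X r \<omega>)" if "r \<in> {0..1}" for r using X(1) that by simp
      fix s r :: real assume sr: "0 \<le> s" "s \<le> r" "r \<le> 1"
      show "sqrt (X s \<omega>) - b / 2 * integral {s..r} (\<lambda>s. sqrt (X s \<omega>)) + (W r \<omega> - W s \<omega>) \<le> sqrt (X r \<omega>)"
        using incr[OF sr(1,2)] mono[of s r] sr by (cases "s = r") auto
      assume "\<And>q. q \<in> {s..r} \<Longrightarrow> 0 < sqrt (X q \<omega>)"
      then have "\<And>q. q \<in> {s..r} \<Longrightarrow> 0 < X q \<omega>" by simp
      then show "sqrt (X r \<omega>) = sqrt (X s \<omega>) - b / 2 * integral {s..r} (\<lambda>s. sqrt (X s \<omega>)) + (W r \<omega> - W s \<omega>)"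
        using incr[OF sr(1,2)] const[of s r] sr by (cases "s = r") auto
    qed
  qed
qed

end

section \<open>Moments\<close>

text \<open>The exponential halves the quadratic exponent: the product is \<open>sqrt 2\<close>
  times the normal density of variance \<open>2 * \<sigma>\<^sup>2\<close>.\<close>

lemma nn_integral_exp_normal_square:
  assumes \<sigma>: "0 < \<sigma>"
  shows "(\<integral>\<^sup>+x. ennreal (normal_density 0 \<sigma> x) * ennreal (exp (x\<^sup>2 / (4 * \<sigma>\<^sup>2))) \<partial>lborel) = ennreal (sqrt 2)"
proof -
  have "normal_density 0 \<sigma> x * exp (x\<^sup>2 / (4 * \<sigma>\<^sup>2)) = sqrt 2 * normal_density 0 (sqrt 2 * \<sigma>) x" for x
  proof -
    have "exp (- x\<^sup>2 / (2 * \<sigma>\<^sup>2)) * exp (x\<^sup>2 / (4 * \<sigma>\<^sup>2)) = exp (- x\<^sup>2 / (2 * (sqrt 2 * \<sigma>)\<^sup>2))"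
      unfolding exp_add[symmetric] using \<sigma> by (simp add: field_simps)
    moreover have "1 / sqrt (2 * pi * \<sigma>\<^sup>2) = sqrt 2 * (1 / sqrt (2 * pi * (sqrt 2 * \<sigma>)\<^sup>2))"
      using \<sigma> by (simp add: real_sqrt_mult power_mult_distrib field_simps)
    ultimately show ?thesis unfolding normal_density_def by (simp add: mult.assoc)
  qed
  then have "(\<integral>\<^sup>+x. ennreal (normal_density 0 \<sigma> x) * ennreal (exp (x\<^sup>2 / (4 * \<sigma>\<^sup>2))) \<partial>lborel) =
    (\<integral>\<^sup>+x. ennreal (sqrt 2 * normal_density 0 (sqrt 2 * \<sigma>) x) \<partial>lborel)"
    by (simp add: ennreal_mult[symmetric])
  also have "\<dots> = ennreal (\<integral>x. sqrt 2 * normal_density 0 (sqrt 2 * \<sigma>) x \<partial>lborel)"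
    using \<sigma> by (intro nn_integral_eq_integral) auto
  also have "(\<integral>x. sqrt 2 * normal_density 0 (sqrt 2 * \<sigma>) x \<partial>lborel) = sqrt 2"
    using \<sigma> by simp
  finally show ?thesis .
qed

section \<open>Expectation of the chaining functional\<close>

context brownian_setting
begin

lemma increment_exp_moment:
  assumes "0 \<le> s" "s < t"
  shows "(\<integral>\<^sup>+\<omega>. ennreal (exp ((W t \<omega> - W s \<omega>)\<^sup>2 / (4 * (t - s)))) \<partial>M) = ennreal (sqrt 2)"
proof -
  have "(\<integral>\<^sup>+x. ennreal (normal_density 0 (sqrt (t - s)) x) * ennreal (exp (x\<^sup>2 / (4 * (t - s)))) \<partial>lborel) =
    (\<integral>\<^sup>+\<omega>. ennreal (exp ((W t \<omega> - W s \<omega>)\<^sup>2 / (4 * (t - s)))) \<partial>M)"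
    by (rule distributed_nn_integral[OF increment_distributed[OF assms]]) simp
  then show ?thesis using nn_integral_exp_normal_square[of "sqrt (t - s)"] assms by simp
qed

lemma chain_sum_measurable: "(\<lambda>\<omega>. chain_sum n (\<lambda>s. W s \<omega>)) \<in> borel_measurable M"
proof -
  have [measurable]: "W (real i / real j) \<in> borel_measurable M" for i j by (rule W_measurable) simp
  show ?thesis unfolding chain_sum_def by measurable
qed

text \<open>Level \<open>j\<close> has \<open>n * 2 ^ j\<close> terms of expectation
  \<open>sqrt 2\<close> and weight \<open>1 / (n * 4 ^ j)\<close>; the dependence on
  \<open>n\<close> cancels and a geometric series of ratio 1/2 remains.\<close>

lemma nn_integral_chain_sum:
  assumes n: "1 \<le> n"
  shows "(\<integral>\<^sup>+\<omega>. chain_sum n (\<lambda>s. W s \<omega>) \<partial>M) = ennreal (2 * sqrt 2)"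
proof -
  have [measurable]: "W (real i / real j) \<in> borel_measurable M" for i j by (rule W_measurable) simp
  define e where "e j i \<omega> = ennreal (exp (real (n * 2 ^ j) * (W (real (Suc i) / real (n * 2 ^ j)) \<omega> - W (real i / real (n * 2 ^ j)) \<omega>)\<^sup>2 / 4))" for j i \<omega>
  have me[measurable]: "e j i \<in> borel_measurable M" for j i unfolding e_def by measurable
  have E: "(\<integral>\<^sup>+\<omega>. e j i \<omega> \<partial>M) = ennreal (sqrt 2)" for j i
  proof -
    let ?N = "real (n * 2 ^ j)"
    have N: "0 < ?N" using n by simp
    have d: "real (Suc i) / ?N - real i / ?N = 1 / ?N" by (simp add: diff_divide_distrib[symmetric])
    have "real i / ?N < real (Suc i) / ?N" using N by (intro divide_strict_right_mono) auto
    from increment_exp_moment[OF _ this] show ?thesis unfolding d e_def using N by (simp add: mult.commute)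
  qed
  have "(\<integral>\<^sup>+\<omega>. chain_sum n (\<lambda>s. W s \<omega>) \<partial>M) = (\<integral>\<^sup>+\<omega>. (\<Sum>j. ennreal (1 / (real n * 4 ^ j)) * (\<Sum>i<n * 2 ^ j. e j i \<omega>)) \<partial>M)"
    by (simp only: chain_sum_def e_def)
  also have "\<dots> = (\<Sum>j. \<integral>\<^sup>+\<omega>. ennreal (1 / (real n * 4 ^ j)) * (\<Sum>i<n * 2 ^ j. e j i \<omega>) \<partial>M)"
    by (rule nn_integral_suminf) measurable
  also have "\<dots> = (\<Sum>j. ennreal (sqrt 2 * (1 / 2) ^ j))"
  proof (rule suminf_cong)
    fix j
    have "(\<integral>\<^sup>+\<omega>. ennreal (1 / (real n * 4 ^ j)) * (\<Sum>i<n * 2 ^ j. e j i \<omega>) \<partial>M) =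
      ennreal (1 / (real n * 4 ^ j)) * (\<Sum>i<n * 2 ^ j. \<integral>\<^sup>+\<omega>. e j i \<omega> \<partial>M)"
      by (simp add: nn_integral_cmult nn_integral_sum)
    also have "\<dots> = ennreal (1 / (real n * 4 ^ j)) * (ennreal (real (n * 2 ^ j)) * ennreal (sqrt 2))"
      unfolding E by (simp only: sum_constant card_lessThan ennreal_of_nat_eq_real_of_nat)
    also have "\<dots> = ennreal (1 / (real n * 4 ^ j) * (real (n * 2 ^ j) * sqrt 2))"
    proof -
      have "ennreal x * (ennreal y * ennreal z) = ennreal (x * (y * z))" if "0 \<le> x" "0 \<le> y" "0 \<le> z" for x y z
        using that by (simp add: ennreal_mult)
      then show ?thesis by this simp_all
    qed
    also have "1 / (real n * 4 ^ j) * (real (n * 2 ^ j) * sqrt 2) = sqrt 2 * (1 / 2) ^ j"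
    proof -
      have "(4::real) ^ j = 2 ^ j * 2 ^ j" by (simp add: power_mult_distrib[symmetric])
      then show ?thesis using n by (simp add: power_divide)
    qed
    finally show "(\<integral>\<^sup>+\<omega>. ennreal (1 / (real n * 4 ^ j)) * (\<Sum>i<n * 2 ^ j. e j i \<omega>) \<partial>M) = ennreal (sqrt 2 * (1 / 2) ^ j)" .
  qed
  also have "\<dots> = ennreal (\<Sum>j. sqrt 2 * (1 / 2) ^ j)"
    by (intro suminf_ennreal2 summable_mult summable_geometric) auto
  also have "(\<Sum>j. sqrt 2 * (1 / 2) ^ j) = 2 * sqrt 2"
    by (subst suminf_mult) (auto simp: suminf_geometric summable_geometric)
  finally show ?thesis .
qed

end

text \<open>The pathwise bound does not depend on \<open>t\<close>, so it passes to the supremum.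
  The two chain sums contribute \<open>2 * sqrt 2\<close> each.\<close>

lemma (in cir_setting) sup_moment_le:
  assumes n: "1 \<le> n" and p: "1 \<le> p"
  shows "sup_moment M p X (\<lambda>t \<omega>. (proj_euler b x0 W n t \<omega>)\<^sup>2) \<le>
    ennreal (moment_const b (sqrt x0) p * mod_rate n powr p * (4 * sqrt 2))"
proof -
  let ?C = "moment_const b (sqrt x0) p * mod_rate n powr p"
  have C0: "0 \<le> ?C" by (simp add: moment_const_def)
  have "AE \<omega> in M. (SUP t\<in>{0..1}. ennreal (\<bar>X t \<omega> - (proj_euler b x0 W n t \<omega>)\<^sup>2\<bar> powr p)) \<le>
    ennreal ?C * (chain_sum 1 (\<lambda>s. W s \<omega>) + chain_sum n (\<lambda>s. W s \<omega>))"
    using AE_reflected_path AE_regular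
  proof eventually_elim
    fix \<omega> assume refl: "reflected_path (\<lambda>s. sqrt (X s \<omega>)) (\<lambda>s. W s \<omega>) b (sqrt x0)" and \<omega>: "regular \<omega>"
    interpret reflected_path "\<lambda>s. sqrt (X s \<omega>)" "\<lambda>s. W s \<omega>" b "sqrt x0" by (rule refl)
    show "(SUP t\<in>{0..1}. ennreal (\<bar>X t \<omega> - (proj_euler b x0 W n t \<omega>)\<^sup>2\<bar> powr p)) \<le>
      ennreal ?C * (chain_sum 1 (\<lambda>s. W s \<omega>) + chain_sum n (\<lambda>s. W s \<omega>))"
    proof (rule SUP_least)
      fix t :: real assume t: "t \<in> {0..1}"
      have "(sqrt (X t \<omega>))\<^sup>2 = X t \<omega>" using regular_X(1)[OF \<omega>] t by simp
      with scheme_square_error_powr[OF n _ p _ t, of "\<lambda>k. proj_euler_grid b x0 W n k \<omega>"]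
      show "ennreal (\<bar>X t \<omega> - (proj_euler b x0 W n t \<omega>)\<^sup>2\<bar> powr p) \<le>
        ennreal ?C * (chain_sum 1 (\<lambda>s. W s \<omega>) + chain_sum n (\<lambda>s. W s \<omega>))"
        by (simp add: proj_euler_def)
    qed
  qed
  then have "sup_moment M p X (\<lambda>t \<omega>. (proj_euler b x0 W n t \<omega>)\<^sup>2) \<le>
    (\<integral>\<^sup>+\<omega>. ennreal ?C * (chain_sum 1 (\<lambda>s. W s \<omega>) + chain_sum n (\<lambda>s. W s \<omega>)) \<partial>M)"
    unfolding sup_moment_def by (rule nn_integral_mono_AE)
  also have "\<dots> = ennreal ?C * (ennreal (2 * sqrt 2) + ennreal (2 * sqrt 2))"
    using chain_sum_measurable n by (simp add: nn_integral_cmult nn_integral_add nn_integral_chain_sum)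
  also have "\<dots> = ennreal (?C * (4 * sqrt 2))"
    using C0 by (subst ennreal_plus[symmetric]) (auto simp: ennreal_mult)
  finally show ?thesis .
qed

text \<open>Fixes a version \<open>I\<close> of the Ito integral and, by the integrability contained
  in \<open>strong_solution\<close>, turns the Lebesgue drift integral into the gauge integral used
  on paths.\<close>

lemma cir_settingI:
  assumes "usual_filtered_prob_space M F" "brownian_motion M F W" "cir_solution M F W b x0 X" "0 \<le> x0"
  obtains I where "cir_setting M F W X I b x0"
proof -
  interpret usual_filtered_prob_space M F by fact
  interpret brownian_setting M F W by unfold_locales fact
  obtain I where I: "adapted F X" "continuous_paths M X" "AE \<omega> in M. X 0 \<omega> = x0"
      "AE \<omega> in M. \<forall>t\<ge>0. set_integrable lborel {0..t} (\<lambda>s. 1 - b * X s \<omega>)"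
      "ito_integral M F W (\<lambda>t \<omega>. 2 * sqrt (X t \<omega>)) I"
      "AE \<omega> in M. \<forall>t\<ge>0. X t \<omega> = x0 + (LBINT s:{0..t}. 1 - b * X s \<omega>) + I t \<omega>"
      "AE \<omega> in M. \<forall>t\<ge>0. 0 \<le> X t \<omega>"
    using assms(3) unfolding cir_solution_def strong_solution_def by blast
  have "AE \<omega> in M. \<forall>t\<ge>0. X t \<omega> = x0 + integral {0..t} (\<lambda>s. 1 - b * X s \<omega>) + I t \<omega>"
    using I(4,6) by eventually_elim (simp add: set_borel_integral_eq_integral(2))
  then have "cir_setting M F W X I b x0"
    using I assms(4) by unfold_locales auto
  then show ?thesis by (rule that)
qed

theorem mainTheorem6:
  fixes x0 b p :: real
  assumes "x0 \<ge> 0" and "p \<ge> 1"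
  shows "\<exists>c>0. \<forall>(M :: 'a measure) F W X.
           usual_filtered_prob_space M F \<and> brownian_motion M F W \<and> cir_solution M F W b x0 X
           \<longrightarrow> (\<forall>n\<ge>1.
                 sup_moment M p X (\<lambda>t \<omega>. (proj_euler b x0 W n t \<omega>)\<^sup>2) < \<infinity> \<and>
                 enn2real (sup_moment M p X (\<lambda>t \<omega>. (proj_euler b x0 W n t \<omega>)\<^sup>2)) powr (1 / p)
                   \<le> c * (real n powr (- 1 / 2) * sqrt (ln (1 + real n))))"
proof -
  \<comment> \<open>Depends on \<open>b\<close>, \<open>x0\<close> and \<open>p\<close> only and is
    fixed before the probability space, the Brownian motion and the solution.\<close>
  define C where "C = moment_const b (sqrt x0) p * (4 * sqrt 2)"
  have C: "0 < C" using scheme_const_nonneg[of "sqrt x0" b] assms by (simp add: C_def moment_const_def)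
  \<comment> \<open>The factor \<open>sqrt 3\<close> converts \<open>mod_rate\<close> into the rate
    of the claim.\<close>
  define c where "c = C powr (1 / p) * sqrt 3"
  show ?thesis
  proof (intro exI[of _ c] conjI allI impI)
    show "0 < c" using C by (simp add: c_def)
    fix M :: "'a measure" and F W X and n :: nat
    assume "usual_filtered_prob_space M F \<and> brownian_motion M F W \<and> cir_solution M F W b x0 X" and n: "n \<ge> 1"
    then obtain I where "cir_setting M F W X I b x0" using cir_settingI assms(1) by metis
    then interpret cir_setting M F W X I b x0 .
    let ?S = "sup_moment M p X (\<lambda>t \<omega>. (proj_euler b x0 W n t \<omega>)\<^sup>2)"
    have \<rho>: "0 \<le> mod_rate n" using mod_rate_bounds(1)[OF n] .
    have S: "?S \<le> ennreal (C * mod_rate n powr p)"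
      using sup_moment_le[OF n assms(2)] by (simp add: C_def mult_ac)
    show "?S < \<infinity>" using le_less_trans[OF S ennreal_less_top] by (simp add: infinity_ennreal_def)
    have "enn2real ?S \<le> C * mod_rate n powr p" using S C by (intro enn2real_leI) auto
    then have "enn2real ?S powr (1 / p) \<le> (C * mod_rate n powr p) powr (1 / p)"
      using assms(2) by (intro powr_mono2) auto
    also have "\<dots> = C powr (1 / p) * mod_rate n"
      using C \<rho> assms(2) by (simp add: powr_mult powr_powr)
    also have "\<dots> \<le> C powr (1 / p) * (sqrt 3 * (real n powr (- 1 / 2) * sqrt (ln (1 + real n))))"
      using mod_rate_bounds(4)[OF n] by (intro mult_left_mono) auto
    also have "\<dots> = c * (real n powr (- 1 / 2) * sqrt (ln (1 + real n)))" by (simp add: c_def)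
    finally show "enn2real ?S powr (1 / p) \<le> c * (real n powr (- 1 / 2) * sqrt (ln (1 + real n)))" .
  qed
qed

end
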